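(* On any simply connected region of the $(a,b)$-plane $\mathbb{C}^2$ with $\Delta=4a^3+27b^2\neq0$ on which $V(D)$ is locally constant, every coefficient of the asymptotic expansion $$d\log D\;\sim\;\sum_{k\ge0}\frac{\hbar^{2k-1}}{2}\sum_{\gamma\in V(D)}dZ_{2k}(\gamma)\;+\;d\bigl(O(1)\bigr)$$ is an exact form. The curvature of the determinant line vanishes to all orders in $\hbar$ away from $\{\Delta=0\}$ and the parameter walls; the $\hbar$-corrections deform the flat connection with leading connection form $\frac{1}{2\hbar}\sum_{\gamma\in V(D)}dZ_0(\gamma)$ only by exact forms with poles on the discriminant $\{\Delta=0\}$.
   Context: $Q_0(x)=x^3+ax+b$, $E_{a,b}:y^2=Q_0(x)$. Quantum periods: write $y=\exp(\hbar^{-1}\int P\,dx)$, $P=\sum_k\hbar^ks_k$, solving the Riccati equation $Q_0=\hbar P'+P^2$ with $s_0=\sqrt{Q_0}$; for $\gamma\in H_1(E_{a,b},\mathbb{Z})$ set $Z_{2k}(\gamma)=\oint_\gamma s_{2k}\,dx$ (the odd-order terms are exact), so $Z(\gamma,\hbar)=\sum_{k\ge 0}\hbar^{2k}Z_{2k}(\gamma)$. $D(a,b;\hbar)$ is the spectral determinant (Stokes multiplier) of $\hbar^2y''=Q_0(x)y$ given by the Wronskian of the Sibuya-normalised solutions subdominant in the sector $S_0$ around the positive real axis and in the sector $S_2$ (two sectors counterclockwise among the five Stokes sectors at infinity); it is entire in $(a,b)$. $V(D)$ is the set of vanishing cycles of $E_{a,b}$ adjacent to the boundary sectors of $D$, continued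 along the parameter ray, and the small-$\hbar$ expansion of $\log D$ is taken in the form $\log D=\frac{1}{2\hbar}\sum_{\gamma\in V(D)}Z(\gamma,\hbar)+O(1)$, whose differential is the displayed expansion. The parameter walls are the loci across which $V(D)$ changes. The determinant line is the line with canonical holomorphic section $D$ and connection form $d\log D$. *)

theory Defs
  imports "HOL-Complex_Analysis.Complex_Analysis" "HOL-Homology.Homology"
begin

text \<open>A parameter is a pair \<open>(a, b)\<close>, a point of a curve is a pair \<open>(x, y)\<close>.\<close>

type_synonym param = "complex \<times> complex"
type_synonym point = "complex \<times> complex"

definition cubic :: "param \<Rightarrow> complex \<Rightarrow> complex" where
  "cubic u x = x ^ 3 + fst u * x + snd u"

definition discr :: "param \<Rightarrow> complex" where
  "discr u = 4 * fst u ^ 3 + 27 * snd u ^ 2"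

text \<open>
  The affine curve has the same first homology as its completion, which only adds one point at
  infinity; so \<open>H\<^sub>1(E, \<int>)\<close> is the library's singular homology of the affine curve.
\<close>

definition curve :: "param \<Rightarrow> point set" where
  "curve u = {(x, y). y ^ 2 = cubic u x}"

type_synonym hclass = "point chain set"

definition H1 :: "param \<Rightarrow> hclass set" where
  "H1 u = carrier (homology_group 1 (top_of_set (curve u)))"

text \<open>
  The class of a closed path, viewed as a singular 1-simplex; the coordinate \<open>t 1\<close> of the standard
  simplex runs from \<open>0\<close> to \<open>1\<close>, which matches the direction of the path.
\<close>

definition loop_class :: "param \<Rightarrow> (real \<Rightarrow> point) \<Rightarrow> hclass" where
  "loop_class u p = homologous_rel_set 1 (top_of_set (curve u)) {}
     (frag_of (restrict (\<lambda>t. p (t 1)) (standard_simplex 1)))"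


section \<open>Quantum periods\<close>

text \<open>
  On the curve \<open>dy/dx = Q'(x) / (2 y)\<close>, so this is \<open>d/dx\<close> on functions of \<open>(x, y)\<close>.
\<close>

definition curve_deriv :: "param \<Rightarrow> (point \<Rightarrow> complex) \<Rightarrow> point \<Rightarrow> complex" where
  "curve_deriv u f z =
     deriv (\<lambda>x. f (x, snd z)) (fst z)
     + (3 * fst z ^ 2 + fst u) / (2 * snd z) * deriv (\<lambda>y. f (fst z, y)) (snd z)"

text \<open>
  The coefficients of the formal solution of \<open>Q = \<hbar> P' + P\<^sup>2\<close> with \<open>s\<^sub>0 = y\<close>; lemma \<open>riccati\<close> below
  is that equation.
\<close>

fun riccati_coeff :: "param \<Rightarrow> nat \<Rightarrow> point \<Rightarrow> complex" where
  "riccati_coeff u 0 = (\<lambda>z. snd z)"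
| "riccati_coeff u (Suc n) = (\<lambda>z.
     - (curve_deriv u (riccati_coeff u n) z
        + (\<Sum>j = 1..n. riccati_coeff u j z * riccati_coeff u (Suc n - j) z)) / (2 * snd z))"

lemma riccati:
  assumes z: "z \<in> curve u" "snd z \<noteq> 0"
  shows "fps_const (cubic u (fst z)) =
           fps_X * Abs_fps (\<lambda>n. curve_deriv u (riccati_coeff u n) z)
           + (Abs_fps (\<lambda>n. riccati_coeff u n z)) ^ 2"
proof (rule fps_ext)
  fix n
  let ?s = "\<lambda>n. riccati_coeff u n z"
  have sq: "(Abs_fps ?s ^ 2) $ n = (\<Sum>j = 0..n. ?s j * ?s (n - j))"
    by (simp add: power2_eq_square fps_mult_nth)
  show "fps_const (cubic u (fst z)) $ n =
    (fps_X * Abs_fps (\<lambda>n. curve_deriv u (riccati_coeff u n) z) + (Abs_fps ?s) ^ 2) $ n"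
  proof (cases n)
    case 0
    then show ?thesis using z
      by (auto simp: curve_def sq power2_eq_square)
  next
    case (Suc m)
    have "(\<Sum>j = 0..Suc m. ?s j * ?s (Suc m - j))
        = ?s 0 * ?s (Suc m) + (\<Sum>j = 1..m. ?s j * ?s (Suc m - j)) + ?s (Suc m) * ?s 0"
      by (simp add: sum.atLeast_Suc_atMost[of 0] sum.nat_ivl_Suc' del: riccati_coeff.simps)
    also have "\<dots> = - curve_deriv u (riccati_coeff u m) z"
      using z(2) by (simp add: field_simps)
    finally show ?thesis
      using sq Suc by (simp del: riccati_coeff.simps)
  qed
qed

text \<open>
  \<open>s\<^sub>2\<^sub>k dx\<close> has poles at the turning points \<open>y = 0\<close>.  It changes sign under \<open>y \<mapsto> - y\<close>, hence has no
  residues there, and its integral depends only on the class in \<open>H\<^sub>1\<close>; representatives are chosen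
  off the turning points.
\<close>

definition regular_loop :: "param \<Rightarrow> (real \<Rightarrow> point) \<Rightarrow> bool" where
  "regular_loop u p \<longleftrightarrow> valid_path p \<and> pathfinish p = pathstart p \<and>
     path_image p \<subseteq> curve u \<and> (\<forall>z \<in> path_image p. snd z \<noteq> 0)"

definition loop_integral :: "(point \<Rightarrow> complex) \<Rightarrow> (real \<Rightarrow> point) \<Rightarrow> complex" where
  "loop_integral f p =
     integral {0..1} (\<lambda>t. f (p t) * vector_derivative (fst \<circ> p) (at t within {0..1}))"

definition period :: "param \<Rightarrow> (point \<Rightarrow> complex) \<Rightarrow> hclass \<Rightarrow> complex" where
  "period u f \<gamma> = (THE w. \<exists>p. regular_loop u p \<and> loop_class u p = \<gamma> \<and> w = loop_integral f p)"

definition qperiod :: "nat \<Rightarrow> param \<Rightarrow> hclass \<Rightarrow> complex" where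
  "qperiod k u \<gamma> = period u (riccati_coeff u (2 * k)) \<gamma>"


section \<open>Differential forms on the parameter plane\<close>

text \<open>The pair \<open>(A, B)\<close> stands for the form \<open>A da + B db\<close>; differentials are holomorphic.\<close>

type_synonym one_form = "param \<Rightarrow> complex \<times> complex"

definition has_differential ::
    "(param \<Rightarrow> complex) \<Rightarrow> complex \<times> complex \<Rightarrow> param \<Rightarrow> bool" where
  "has_differential F \<alpha> u \<longleftrightarrow> (F has_derivative (\<lambda>h. fst \<alpha> * fst h + snd \<alpha> * snd h)) (at u)"

definition exact_on :: "param set \<Rightarrow> one_form \<Rightarrow> bool" where
  "exact_on U \<theta> \<longleftrightarrow> (\<exists>F. \<forall>u \<in> U. has_differential F (\<theta> u) u)"

text \<open>The curvature of the connection form \<open>\<theta>\<close> on a line bundle: \<open>d\<theta> = K da \<and> db\<close> at \<open>u\<close>.\<close>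

definition has_curvature :: "one_form \<Rightarrow> complex \<Rightarrow> param \<Rightarrow> bool" where
  "has_curvature \<theta> K u \<longleftrightarrow> (\<exists>A B.
     ((\<lambda>a. snd (\<theta> (a, snd u))) has_field_derivative A) (at (fst u)) \<and>
     ((\<lambda>b. fst (\<theta> (fst u, b))) has_field_derivative B) (at (snd u)) \<and> K = A - B)"


section \<open>Parallel cycles\<close>

text \<open>
  Flat sections of the local system \<open>H\<^sub>1\<close> over the parameters: locally, the projection of the cycle
  to the \<open>x\<close>-plane is kept fixed, away from the turning points, and only the branch of \<open>y\<close> varies.
\<close>

definition flat_section :: "param set \<Rightarrow> (param \<Rightarrow> hclass) \<Rightarrow> bool" where
  "flat_section N g \<longleftrightarrow> open N \<and> (\<forall>w \<in> N. \<exists>M \<xi> \<eta>.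
     open M \<and> w \<in> M \<and> M \<subseteq> N \<and>
     continuous_on (M \<times> {0..1}) (\<lambda>(v, t). \<eta> v t :: complex) \<and>
     (\<forall>v \<in> M. regular_loop v (\<lambda>t. (\<xi> t, \<eta> v t)) \<and> loop_class v (\<lambda>t. (\<xi> t, \<eta> v t)) = g v))"

definition dqperiod :: "nat \<Rightarrow> param \<Rightarrow> hclass \<Rightarrow> complex \<times> complex" where
  "dqperiod k u \<gamma> = (THE \<alpha>. \<forall>N g. flat_section N g \<and> u \<in> N \<and> g u = \<gamma> \<longrightarrow>
     has_differential (\<lambda>v. qperiod k v (g v)) \<alpha> u)"

text \<open>Near \<open>u\<close>, the set \<open>V v\<close> consists of the distinct values of finitely many flat sections.\<close>

definition locally_constant_at :: "(param \<Rightarrow> hclass set) \<Rightarrow> param \<Rightarrow> bool" where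
  "locally_constant_at V u \<longleftrightarrow> (\<exists>N G. open N \<and> u \<in> N \<and> finite G \<and>
     (\<forall>g \<in> G. flat_section N g) \<and>
     (\<forall>v \<in> N. inj_on (\<lambda>g. g v) G \<and> V v = (\<lambda>g. g v) ` G))"

definition walls :: "(param \<Rightarrow> hclass set) \<Rightarrow> param set" where
  "walls V = {u. discr u \<noteq> 0 \<and> \<not> locally_constant_at V u}"

definition region :: "(param \<Rightarrow> hclass set) \<Rightarrow> param set \<Rightarrow> bool" where
  "region V U \<longleftrightarrow> open U \<and> simply_connected U \<and>
     (\<forall>u \<in> U. discr u \<noteq> 0 \<and> locally_constant_at V u)"


section \<open>The spectral determinant\<close>

text \<open>
  Sibuya's normalisation: the entire solution of \<open>\<hbar>\<^sup>2 Y'' = Q Y\<close> with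
  \<open>Y \<sim> x\<^bsup>-3/4\<^esup> exp (- (2/5 x\<^bsup>5/2\<^esup> + a x\<^bsup>1/2\<^esup>) / \<hbar>)\<close>, uniformly in closed subsectors of
  \<open>\<bar>arg x\<bar> < 3\<pi>/5\<close>.  It is subdominant in \<open>\<bar>arg x\<bar> < \<pi>/5\<close>, hence unique.
\<close>

definition sibuya_solution :: "real \<Rightarrow> param \<Rightarrow> (complex \<Rightarrow> complex) \<Rightarrow> bool" where
  "sibuya_solution h u Y \<longleftrightarrow> Y holomorphic_on UNIV \<and>
     (\<forall>x. of_real h ^ 2 * deriv (deriv Y) x = cubic u x * Y x) \<and>
     (\<forall>\<epsilon> > 0.
        ((\<lambda>x. Y x * x powr (3/4) *
            exp ((2/5 * x powr (5/2) + fst u * x powr (1/2)) / of_real h)) \<longlongrightarrow> 1)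
          (inf at_infinity (principal {x. \<bar>Arg x\<bar> \<le> 3 * pi / 5 - \<epsilon>})))"

definition sibuya :: "real \<Rightarrow> param \<Rightarrow> complex \<Rightarrow> complex" where
  "sibuya h u = (THE Y. sibuya_solution h u Y)"

definition rot :: complex where
  "rot = cis (2 * pi / 5)"

text \<open>
  Substituting \<open>x = \<omega>\<^sup>k z\<close> with \<open>\<omega>\<^sup>5 = 1\<close> turns the equation for \<open>(a, b)\<close> into the one for
  \<open>(\<omega>\<^bsup>3k\<^esup> a, \<omega>\<^bsup>2k\<^esup> b)\<close>, so this solves the original equation and is subdominant in the \<open>k\<close>-th sector.
\<close>

definition sibuya_rot :: "nat \<Rightarrow> real \<Rightarrow> param \<Rightarrow> complex \<Rightarrow> complex" where
  "sibuya_rot k h u x = sibuya h (rot ^ (3 * k) * fst u, rot ^ (2 * k) * snd u) (x / rot ^ k)"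

definition wronskian :: "(complex \<Rightarrow> complex) \<Rightarrow> (complex \<Rightarrow> complex) \<Rightarrow> complex \<Rightarrow> complex" where
  "wronskian f g x = f x * deriv g x - deriv f x * g x"

text \<open>
  The Wronskian does not depend on the point where it is evaluated.  The factor \<open>\<hbar>\<close> comes from
  taking it in the variable \<open>\<hbar>\<^bsup>-2/5\<^esup> x\<close>, in which the equation is Sibuya's equation without
  parameter \<open>\<hbar>\<close>; without it \<open>log D\<close> would contain \<open>- log \<hbar>\<close>, which is not \<open>O(1)\<close>.
\<close>

definition spectral_det :: "real \<Rightarrow> param \<Rightarrow> complex" where
  "spectral_det h u = of_real h * wronskian (sibuya_rot 0 h u) (sibuya_rot 2 h u) 0"

text \<open>The connection form \<open>d log D\<close> in which \<open>D\<close> is the canonical section.\<close>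

definition dlog_det :: "real \<Rightarrow> one_form" where
  "dlog_det h u =
     (deriv (\<lambda>a. spectral_det h (a, snd u)) (fst u) / spectral_det h u,
      deriv (\<lambda>b. spectral_det h (fst u, b)) (snd u) / spectral_det h u)"


section \<open>Vanishing cycles adjacent to the boundary sectors\<close>

definition sector :: "nat \<Rightarrow> complex set" where
  "sector k = {x. x \<noteq> 0 \<and> \<bar>Arg (x / rot ^ k)\<bar> < pi / 5}"

text \<open>
  A Stokes curve of the turning point \<open>e\<close> is a curve on which \<open>\<integral>\<^sub>e y dx\<close> is real.  It is
  parametrised by this integral, which means \<open>d\<sigma>/dt = 1/y\<close>.
\<close>

definition stokes_curve_into :: "param \<Rightarrow> complex \<Rightarrow> nat \<Rightarrow> bool" where
  "stokes_curve_into u e k \<longleftrightarrow> cubic u e = 0 \<and> (\<exists>\<sigma> \<eta>.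
     continuous_on {0..} \<sigma> \<and> \<sigma> 0 = e \<and> continuous_on {0<..} \<eta> \<and>
     (\<forall>t > 0. (\<sigma> t, \<eta> t) \<in> curve u \<and> \<eta> t \<noteq> 0 \<and> (\<sigma> has_vector_derivative 1 / \<eta> t) (at t)) \<and>
     filterlim \<sigma> at_infinity at_top \<and> eventually (\<lambda>t. \<sigma> t \<in> sector k) at_top)"

text \<open>
  A vanishing cycle is the preimage of an arc \<open>\<delta>\<close> that joins two turning points and avoids the third:
  the arc is run through on one sheet and back on the other.  It is adjacent to the boundary
  sectors \<open>S\<^sub>0\<close>, \<open>S\<^sub>2\<close> of \<open>D\<close> if its turning points send Stokes curves into both of them.
\<close>

definition adjacent_vanishing_cycle :: "param \<Rightarrow> hclass \<Rightarrow> bool" where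
  "adjacent_vanishing_cycle u \<gamma> \<longleftrightarrow> (\<exists>\<delta> \<eta>.
     arc \<delta> \<and> cubic u (pathstart \<delta>) = 0 \<and> cubic u (pathfinish \<delta>) = 0 \<and>
     (\<forall>t \<in> {0<..<1}. cubic u (\<delta> t) \<noteq> 0) \<and>
     continuous_on {0..1} \<eta> \<and> (\<forall>t \<in> {0..1}. (\<delta> t, \<eta> t) \<in> curve u) \<and>
     \<gamma> = loop_class u ((\<lambda>t. (\<delta> t, \<eta> t)) +++ reversepath (\<lambda>t. (\<delta> t, - \<eta> t))) \<and>
     (\<forall>k \<in> {0, 2}. \<exists>e \<in> {pathstart \<delta>, pathfinish \<delta>}. stokes_curve_into u e k))"

text \<open>
  Rescaling \<open>x\<close> identifies \<open>(t\<^sup>4 a, t\<^sup>6 b; \<hbar>)\<close> with \<open>(a, b; t\<^bsup>-5\<^esup> \<hbar>)\<close>: the limit \<open>\<hbar> \<rightarrow> 0\<close> is the limit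
  along the parameter ray \<open>t > 0\<close>, and the curves over a ray are isomorphic.
\<close>

definition ray :: "real \<Rightarrow> param \<Rightarrow> param" where
  "ray t u = (of_real t ^ 4 * fst u, of_real t ^ 6 * snd u)"

definition ray_iso :: "real \<Rightarrow> point \<Rightarrow> point" where
  "ray_iso t z = (of_real t ^ 2 * fst z, of_real t ^ 3 * snd z)"

definition boundary_cycles :: "(param \<Rightarrow> hclass set) \<Rightarrow> bool" where
  "boundary_cycles V \<longleftrightarrow> (\<forall>u. discr u \<noteq> 0 \<longrightarrow>
     finite (V u) \<and> V u \<subseteq> H1 u \<and> (\<forall>\<gamma> \<in> V u. adjacent_vanishing_cycle u \<gamma>) \<and>
     (\<forall>t > 0. V (ray t u) =
        hom_induced 1 (top_of_set (curve u)) {} (top_of_set (curve (ray t u))) {} (ray_iso t) ` V u))"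


section \<open>Small \<open>\<hbar>\<close> expansions\<close>

text \<open>\<open>f \<sim> \<Sum>\<^sub>j \<hbar>\<^bsup>j-1\<^esup> \<phi>\<^sub>j\<close> as \<open>\<hbar> \<rightarrow> 0+\<close>, uniformly on \<open>N\<close>; note the shift of the exponent.\<close>

definition expands_on ::
    "param set \<Rightarrow> (real \<Rightarrow> param \<Rightarrow> 'a::real_normed_vector) \<Rightarrow> (nat \<Rightarrow> param \<Rightarrow> 'a) \<Rightarrow> bool" where
  "expands_on N f \<phi> \<longleftrightarrow> (\<forall>n. \<exists>C. \<exists>\<delta> > 0. \<forall>h v. 0 < h \<and> h < \<delta> \<and> v \<in> N \<longrightarrow>
     norm (f h v - (\<Sum>j\<le>n. (h powi (int j - 1)) *\<^sub>R \<phi> j v)) \<le> C * h ^ n)"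

definition period_form :: "(param \<Rightarrow> hclass set) \<Rightarrow> nat \<Rightarrow> one_form" where
  "period_form V k u = (1/2) *\<^sub>R (\<Sum>\<gamma> \<in> V u. dqperiod k u \<gamma>)"

text \<open>
  The coefficients of \<open>\<hbar>\<^bsup>n-1\<^esup>\<close> in \<open>(2\<hbar>)\<^sup>-\<^sup>1 \<Sum>\<^sub>\<gamma> Z(\<gamma>, \<hbar>) + c\<close> and in its differential.  The \<open>O(1)\<close> term is
  the term \<open>c\<close> of order \<open>\<hbar>\<^sup>0\<close>: a remainder that is merely bounded would absorb all \<open>Z\<^sub>2\<^sub>k\<close> with \<open>k \<ge> 1\<close>.
\<close>

definition log_coeff ::
    "(param \<Rightarrow> hclass set) \<Rightarrow> (param \<Rightarrow> complex) \<Rightarrow> nat \<Rightarrow> param \<Rightarrow> complex" where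
  "log_coeff V c n u =
     (if n = 1 then c u
      else if even n then (1/2) * (\<Sum>\<gamma> \<in> V u. qperiod (n div 2) u \<gamma>) else 0)"

definition form_coeff :: "(param \<Rightarrow> hclass set) \<Rightarrow> one_form \<Rightarrow> nat \<Rightarrow> one_form" where
  "form_coeff V \<kappa> n u =
     (if n = 1 then \<kappa> u else if even n then period_form V (n div 2) u else 0)"

text \<open>\<open>L h\<close> is a local branch of \<open>log D\<close>; expansions are locally uniform in the parameters.\<close>

definition log_det_expansion ::
    "(param \<Rightarrow> hclass set) \<Rightarrow> (param \<Rightarrow> complex) \<Rightarrow> param set \<Rightarrow> bool" where
  "log_det_expansion V c U \<longleftrightarrow> (\<forall>u \<in> U. \<exists>N L. \<exists>\<delta> > 0. open N \<and> u \<in> N \<and> N \<subseteq> U \<and>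
     (\<forall>h. 0 < h \<and> h < \<delta> \<longrightarrow>
        continuous_on N (L h) \<and> (\<forall>v \<in> N. exp (L h v) = spectral_det h v)) \<and>
     expands_on N L (log_coeff V c))"

definition dlog_det_expansion ::
    "(param \<Rightarrow> hclass set) \<Rightarrow> one_form \<Rightarrow> param set \<Rightarrow> bool" where
  "dlog_det_expansion V \<kappa> U \<longleftrightarrow> (\<forall>u \<in> U. \<exists>N. open N \<and> u \<in> N \<and> N \<subseteq> U \<and>
     expands_on N dlog_det (form_coeff V \<kappa>))"

text \<open>
  A form built from periods is multivalued around \<open>\<Delta> = 0\<close>, so its poles are those of its coefficients
  in the frame of elliptic periods of \<open>dx/y\<close>, \<open>x dx/y\<close>: these coefficients are polynomials in
  \<open>(a, b)\<close> divided by a power of \<open>\<Delta>\<close>, the same for all parameters and cycles.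
\<close>

definition poly2 :: "complex poly poly \<Rightarrow> param \<Rightarrow> complex" where
  "poly2 p u = poly (poly p [:snd u:]) (fst u)"

definition elliptic_comb ::
    "complex poly poly \<Rightarrow> complex poly poly \<Rightarrow> param \<Rightarrow> hclass \<Rightarrow> complex" where
  "elliptic_comb p q u \<gamma> =
     poly2 p u * period u (\<lambda>z. 1 / snd z) \<gamma> + poly2 q u * period u (\<lambda>z. fst z / snd z) \<gamma>"

definition poles_on_discriminant :: "(param \<Rightarrow> hclass set) \<Rightarrow> one_form \<Rightarrow> bool" where
  "poles_on_discriminant V \<theta> \<longleftrightarrow> (\<exists>m p q p' q'. \<forall>u. discr u \<noteq> 0 \<and> u \<notin> walls V \<longrightarrow>
     \<theta> u = (\<Sum>\<gamma> \<in> V u. (elliptic_comb p q u \<gamma> / discr u ^ m, elliptic_comb p' q' u \<gamma> / discr u ^ m)))"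

end

theory Submission
  imports Defs
begin

text \<open>
  The forms are differentials of explicit functions.  Since \<open>s\<^sub>2\<^sub>k\<close> is a Laurent polynomial in \<open>y\<close>, odd
  under \<open>y \<mapsto> - y\<close> and with coefficients in \<open>\<complex>[a, b, x]\<close>, subtracting exact forms reduces \<open>s\<^sub>2\<^sub>k dx\<close> to
  a combination of \<open>dx/y\<close> and \<open>x dx/y\<close> over \<open>\<complex>[a, b, 1/\<Delta>]\<close>; the denominators come from the Bezout
  identity between \<open>Q\<close> and \<open>Q'\<close>.  These two forms are holomorphic on the whole affine curve, so all the
  integrals depend on the homology class only, and the periods are well defined.

  Along a flat section the projection of the cycle to the \<open>x\<close>-line stays fixed, so differentiating a
  period means differentiating the integrand, and the result is again an odd Laurent polynomial.
  Hence the sum of the periods over \<open>V\<close> is a local primitive of the period form, and its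
  coefficients in the elliptic frame have poles on \<open>\<Delta> = 0\<close> only.  Holomorphy in two variables makes
  mixed partial derivatives symmetric, which is the vanishing of the curvature.  Finally the
  \<open>O(1)\<close> term is a uniform limit of holomorphic functions, and Cauchy's estimates allow the
  expansion of \<open>log D\<close> to be differentiated term by term.
\<close>

section \<open>Holomorphic functions of two variables\<close>

text \<open>Cycles are classes of singular chains on the whole affine curve. Their simplices are
  merely continuous and may run through the turning points, where s_2k can have poles for k >= 1. A
  form that is to be integrated over such chains must therefore have a primitive near every point of
  the curve, and its integral over a simplex is taken to be the increment of a primitive glued along
  the simplex. At a turning point x is no coordinate, so the derivative condition is imposed
  elsewhere only; two primitives then differ by a function with countably many values, which is
  constant along a connected set. A second obstacle is that the loops of a flat section are only
  piecewise smooth in time, and that their branch of y is only known to be continuous in the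
  parameters. Locally that branch is an explicit square root, holomorphic in a and b, and the
  integral over a short piece of the loop equals one over a straight segment, which can be
  differentiated under the integral sign.\<close>

definition partial1 :: "(param \<Rightarrow> complex) \<Rightarrow> param \<Rightarrow> complex" where
  "partial1 F u = deriv (\<lambda>a. F (a, snd u)) (fst u)"

definition partial2 :: "(param \<Rightarrow> complex) \<Rightarrow> param \<Rightarrow> complex" where
  "partial2 F u = deriv (\<lambda>b. F (fst u, b)) (snd u)"

text \<open>Joint continuity makes Cauchy integrals over a circle in one variable depend
  continuously on the other one; with holomorphy in each variable it yields the total
  differential.\<close>

definition holomorphic2 :: "(param \<Rightarrow> complex) \<Rightarrow> param set \<Rightarrow> bool" where
  "holomorphic2 F N \<longleftrightarrow> open N \<and> continuous_on N F \<and>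
     (\<forall>u \<in> N. (\<lambda>a. F (a, snd u)) field_differentiable at (fst u) \<and>
              (\<lambda>b. F (fst u, b)) field_differentiable at (snd u))"

lemma has_differential_partials:
  assumes "has_differential F \<alpha> u"
  shows "((\<lambda>a. F (a, snd u)) has_field_derivative fst \<alpha>) (at (fst u))"
    and "((\<lambda>b. F (fst u, b)) has_field_derivative snd \<alpha>) (at (snd u))"
proof -
  have F: "(F has_derivative (\<lambda>h. fst \<alpha> * fst h + snd \<alpha> * snd h)) (at (fst u, snd u))"
    using assms by (simp add: has_differential_def)
  have g1: "((\<lambda>a. (a, snd u)) has_derivative (\<lambda>h. (h, 0))) (at (fst u))"
    and g2: "((\<lambda>b. (fst u, b)) has_derivative (\<lambda>h. (0, h))) (at (snd u))"
    by (auto intro!: derivative_eq_intros)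
  show "((\<lambda>a. F (a, snd u)) has_field_derivative fst \<alpha>) (at (fst u))"
    using has_derivative_compose[OF g1 F] by (simp add: has_field_derivative_def)
  show "((\<lambda>b. F (fst u, b)) has_field_derivative snd \<alpha>) (at (snd u))"
    using has_derivative_compose[OF g2 F] by (simp add: has_field_derivative_def)
qed

lemma has_differential_unique:
  "has_differential F \<alpha> u \<Longrightarrow> \<alpha> = (partial1 F u, partial2 F u)"
  using has_differential_partials[of F \<alpha> u]
  by (metis DERIV_imp_deriv partial1_def partial2_def prod.collapse)

lemma has_differential_imp_holomorphic2:
  assumes "open N" "\<And>v. v \<in> N \<Longrightarrow> has_differential F (\<theta> v) v"
  shows "holomorphic2 F N"
  unfolding holomorphic2_def
proof (intro conjI ballI)
  show "continuous_on N F"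
    using assms(2) has_derivative_continuous unfolding has_differential_def
    by (meson continuous_at_imp_continuous_on)
qed (use assms has_differential_partials field_differentiable_def in blast)+

lemma open_imp_polydisc:
  fixes N :: "(complex \<times> complex) set"
  assumes "open N" "u \<in> N"
  obtains r where "r > 0" "cball (fst u) r \<times> cball (snd u) r \<subseteq> N"
proof -
  obtain A B where AB: "open A" "open B" "u \<in> A \<times> B" "A \<times> B \<subseteq> N"
    using assms open_prod_elim by metis
  obtain r1 where r1: "r1 > 0" "cball (fst u) r1 \<subseteq> A"
    using AB open_contains_cball by (metis mem_Times_iff)
  obtain r2 where r2: "r2 > 0" "cball (snd u) r2 \<subseteq> B"
    using AB open_contains_cball by (metis mem_Times_iff)
  have "cball (fst u) (min r1 r2) \<times> cball (snd u) (min r1 r2) \<subseteq> N"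
    using r1 r2 AB by (auto simp: subset_iff)
  then show ?thesis using r1 r2 that[of "min r1 r2"] by auto
qed

lemma holomorphic2_slice1:
  assumes "holomorphic2 F N" "A \<times> {b} \<subseteq> N"
  shows "(\<lambda>a. F (a, b)) holomorphic_on A"
proof -
  have "(\<lambda>a. F (a, b)) field_differentiable at a" if "a \<in> A" for a
    using assms(1) that assms(2) by (force simp: holomorphic2_def dest: bspec[of _ _ "(a, b)"])
  then show ?thesis
    by (simp add: holomorphic_on_def field_differentiable_at_within)
qed

text \<open>Transfers results on \<open>partial1\<close> to \<open>partial2\<close>.\<close>

lemma holomorphic2_swap:
  assumes "holomorphic2 F N"
  shows "holomorphic2 (\<lambda>u. F (prod.swap u)) (prod.swap ` N)"
  unfolding holomorphic2_def
proof (intro conjI)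
  have *: "prod.swap ` N = prod.swap -` N" by (force simp: image_iff)
  show "open (prod.swap ` N)"
    unfolding * using assms by (intro continuous_open_vimage) (auto simp: holomorphic2_def continuous_on_swap prod.swap_def intro!: continuous_intros)
  show "continuous_on (prod.swap ` N) (\<lambda>u. F (prod.swap u))"
    using assms unfolding holomorphic2_def
    by (intro continuous_on_compose2[of N F _ prod.swap]) (auto intro: continuous_on_swap)
qed (use assms in \<open>auto simp: holomorphic2_def\<close>)

lemma partial_swap:
  "partial1 (\<lambda>u. F (prod.swap u)) (prod.swap u) = partial2 F u"
  "partial2 (\<lambda>u. F (prod.swap u)) (prod.swap u) = partial1 F u"
  by (simp_all add: partial1_def partial2_def)

section \<open>Cauchy's formula, total differentials and mixed partial derivatives\<close>

definition circ :: "complex \<Rightarrow> real \<Rightarrow> real \<Rightarrow> complex" where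
  "circ a r t = a + r * exp (2 * of_real pi * \<i> * t)"

lemma continuous_on_circ [continuous_intros]:
  "continuous_on S f \<Longrightarrow> continuous_on S (\<lambda>x. circ a r (f x))"
  unfolding circ_def by (intro continuous_intros)

lemma circ_in_cball: "r > 0 \<Longrightarrow> circ a r t \<in> cball a r"
  by (simp add: circ_def dist_norm norm_mult)

lemma circ_neq: "r > 0 \<Longrightarrow> w \<in> ball a r \<Longrightarrow> circ a r t \<noteq> w"
  by (auto simp: circ_def dist_norm norm_mult)

text \<open>The factor 2 pi i of Cauchy's formula cancels against the velocity 2 pi i (circ - a) of
  the circle. An integral over the fixed interval from 0 to 1 is the form to which the theorems on
  parameter integrals apply.\<close>

lemma deriv_eq_circ_integral:
  assumes "f holomorphic_on cball a r" "r > 0" "w \<in> ball a r"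
  shows "deriv f w = integral {0..1} (\<lambda>t. f (circ a r t) * (circ a r t - a) / (circ a r t - w) ^ 2)"
proof -
  have "deriv f w = contour_integral (circlepath a r) (\<lambda>u. f u / (u - w) ^ 2) / (2 * pi * \<i>)"
    using Cauchy_contour_integral_circlepath_2[of a r f w] assms
    by (simp add: holomorphic_on_imp_continuous_on holomorphic_on_subset)
  also have "\<dots> = integral {0..1} (\<lambda>t. f (circ a r t) / (circ a r t - w) ^ 2 * (2 * pi * \<i> * (circ a r t - a))) / (2 * pi * \<i>)"
    unfolding contour_integral_integral vector_derivative_circlepath
    by (simp add: circlepath circ_def mult_ac)
  also have "\<dots> = integral {0..1} (\<lambda>t. (f (circ a r t) / (circ a r t - w) ^ 2 * (2 * pi * \<i> * (circ a r t - a))) / (2 * pi * \<i>))"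
    by (simp only: integral_divide)
  also have "\<dots> = integral {0..1} (\<lambda>t. f (circ a r t) * (circ a r t - a) / (circ a r t - w) ^ 2)"
    by simp
  finally show ?thesis .
qed

lemma partial1_eq_circ_integral:
  assumes F: "holomorphic2 F N" and sub: "cball a r \<times> B \<subseteq> N" "r > 0" and v: "fst v \<in> ball a r" "snd v \<in> B"
  shows "partial1 F v = integral {0..1} (\<lambda>t. F (circ a r t, snd v) * (circ a r t - a) / (circ a r t - fst v) ^ 2)"
  unfolding partial1_def
  using v sub by (intro deriv_eq_circ_integral holomorphic2_slice1[OF F]) auto

text \<open>The circle stays fixed while the point moves inside it, and Cauchy's formula uses only
  values of \<open>F\<close>; so continuity of \<open>F\<close> passes to the derivative.\<close>

lemma continuous_on_partial1_local:
  assumes F: "holomorphic2 F N" and sub: "cball a r \<times> B \<subseteq> N" "r > 0"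
  shows "continuous_on (ball a r \<times> B) (partial1 F)"
proof -
  have FN: "continuous_on N F" using F by (simp add: holomorphic2_def)
  have *: "continuous_on ((ball a r \<times> B) \<times> cbox 0 1) (\<lambda>p. F (circ a r (snd p), snd (fst p)))"
    using sub circ_in_cball[of r a]
    by (intro continuous_on_compose2[OF FN]) (auto intro!: continuous_intros simp del: mem_cball)
  have "continuous_on ((ball a r \<times> B) \<times> cbox 0 1)
      (\<lambda>p. F (circ a r (snd p), snd (fst p)) * (circ a r (snd p) - a) / (circ a r (snd p) - fst (fst p)) ^ 2)"
    using circ_neq[OF sub(2)]
    by (intro continuous_intros *) auto
  then have "continuous_on (ball a r \<times> B) (\<lambda>v. integral (cbox 0 1) (\<lambda>t. F (circ a r t, snd v) * (circ a r t - a) / (circ a r t - fst v) ^ 2))"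
    by (intro integral_continuous_on_param) (simp add: split_beta)
  then show ?thesis
    by (rule continuous_on_eq) (use sub in \<open>auto simp: partial1_eq_circ_integral[OF F]\<close>)
qed

lemma continuous_on_partial1:
  assumes F: "holomorphic2 F N"
  shows "continuous_on N (partial1 F)"
proof (rule continuous_at_imp_continuous_on, intro ballI)
  fix u assume u: "u \<in> N"
  obtain r where r: "r > 0" "cball (fst u) r \<times> cball (snd u) r \<subseteq> N"
    using open_imp_polydisc u F unfolding holomorphic2_def by metis
  have "continuous_on (ball (fst u) r \<times> ball (snd u) r) (partial1 F)"
    by (rule continuous_on_partial1_local[OF F _ r(1)]) (use r in auto)
  moreover have "u \<in> ball (fst u) r \<times> ball (snd u) r" using r by (simp add: mem_Times_iff)
  ultimately show "isCont (partial1 F) u"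
    using continuous_on_eq_continuous_at open_Times open_ball by metis
qed

lemma continuous_on_partial2:
  assumes F: "holomorphic2 F N"
  shows "continuous_on N (partial2 F)"
proof -
  have "continuous_on N (\<lambda>u. partial1 (\<lambda>u. F (prod.swap u)) (prod.swap u))"
    by (rule continuous_on_compose2[OF continuous_on_partial1[OF holomorphic2_swap[OF F]]])
      (auto intro: continuous_on_swap)
  then show ?thesis by (simp add: partial_swap)
qed

lemma holomorphic2_partials:
  assumes F: "holomorphic2 F N" and u: "u \<in> N"
  shows "((\<lambda>a. F (a, snd u)) has_field_derivative partial1 F u) (at (fst u))"
    and "((\<lambda>b. F (fst u, b)) has_field_derivative partial2 F u) (at (snd u))"
  using assms unfolding holomorphic2_def partial1_def partial2_def
  by (auto simp: field_differentiable_derivI)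

text \<open>Partial derivatives combine to a total one as soon as one of them is continuous; here
  this is the derivative in the second variable.\<close>

lemma holomorphic2_imp_has_differential:
  assumes F: "holomorphic2 F N" and u: "u \<in> N"
  shows "has_differential F (partial1 F u, partial2 F u) u"
proof -
  obtain r where r: "r > 0" "cball (fst u) r \<times> cball (snd u) r \<subseteq> N"
    using open_imp_polydisc u F unfolding holomorphic2_def by metis
  define X Y where "X = ball (fst u) r" and "Y = ball (snd u) r"
  have XY: "X \<times> Y \<subseteq> N" "fst u \<in> X" "snd u \<in> Y" using r by (auto simp: X_def Y_def)
  have "((\<lambda>(x, y). F (x, y)) has_derivative
      (\<lambda>(tx, ty). (\<lambda>h. partial1 F u * h) tx + blinfun_mult_right (partial2 F (fst u, snd u)) ty))
      (at (fst u, snd u) within X \<times> Y)"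
  proof (rule has_derivative_partialsI)
    show "((\<lambda>x. F (x, snd u)) has_derivative (*) (partial1 F u)) (at (fst u) within X)"
      using holomorphic2_partials(1)[OF F u]
      by (simp add: has_field_derivative_def has_derivative_at_withinI)
    show "((\<lambda>y. F (x, y)) has_derivative blinfun_apply (blinfun_mult_right (partial2 F (x, y)))) (at y within Y)"
      if "x \<in> X" "y \<in> Y" for x y
      using holomorphic2_partials(2)[OF F, of "(x, y)"] that XY
      by (auto simp: has_field_derivative_def has_derivative_at_withinI)
    have "continuous_on (X \<times> Y) (\<lambda>v. blinfun_mult_right (partial2 F v))"
      by (intro bounded_linear.continuous_on[OF bounded_linear_blinfun_mult_right]
          continuous_on_subset[OF continuous_on_partial2[OF F] XY(1)])
    then have "continuous (at u within X \<times> Y) (\<lambda>v. blinfun_mult_right (partial2 F v))"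
      using XY(2,3) by (simp only: continuous_on_eq_continuous_within mem_Times_iff)
    then show "continuous (at (fst u, snd u) within X \<times> Y) (\<lambda>(x, y). blinfun_mult_right (partial2 F (x, y)))"
      by (simp add: case_prod_beta')
  qed (use XY in \<open>auto simp: Y_def\<close>)
  moreover have "at u within X \<times> Y = at u"
    using XY by (intro at_within_open) (auto simp: X_def Y_def mem_Times_iff open_Times)
  ultimately show ?thesis
    by (simp add: has_differential_def case_prod_beta')
qed

text \<open>Cauchy's formula in the second variable is differentiated under the integral sign in the
  first. The quotient is left uncancelled so that the result has the shape of Cauchy's formula for
  the derivative of \<open>partial1 F\<close>.\<close>

lemma partial2_has_derivative1:
  assumes F: "holomorphic2 F N"
    and r: "r > 0" "cball (fst u) r \<times> cball (snd u) r \<subseteq> N"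
  shows "((\<lambda>a. partial2 F (a, snd u)) has_field_derivative
    integral {0..1} (\<lambda>t. partial1 F (fst u, circ (snd u) r t) * (circ (snd u) r t - snd u) / (circ (snd u) r t - snd u) ^ 2)) (at (fst u))"
proof -
  define a b where "a = fst u" and "b = snd u"
  define D where "D w = integral (cbox 0 1) (\<lambda>t. partial1 F (w, circ b r t) * (circ b r t - b) / (circ b r t - b) ^ 2)" for w
  have FN: "continuous_on N F" using F by (simp add: holomorphic2_def)
  have sub: "(w, circ b r t) \<in> N" if "w \<in> cball a r" for w t
    using that r circ_in_cball[of r b t] unfolding a_def b_def by (auto simp del: mem_cball)
  have D: "((\<lambda>w. integral (cbox 0 1) (\<lambda>t. F (w, circ b r t) * (circ b r t - b) / (circ b r t - b) ^ 2))
      has_field_derivative D a) (at a within ball a r)"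
    unfolding D_def
  proof (rule leibniz_rule_field_derivative)
    fix w t assume w: "w \<in> ball a r"
    have "((\<lambda>w. F (w, circ b r t)) has_field_derivative partial1 F (w, circ b r t)) (at w within ball a r)"
      using holomorphic2_partials(1)[OF F sub[of w t]] w by (auto simp: has_field_derivative_at_within)
    then show "((\<lambda>w. F (w, circ b r t) * (circ b r t - b) / (circ b r t - b) ^ 2) has_field_derivative
        partial1 F (w, circ b r t) * (circ b r t - b) / (circ b r t - b) ^ 2) (at w within ball a r)"
      by (intro DERIV_cdivide DERIV_cmult_right)
  next
    fix w assume w: "w \<in> ball a r"
    have "continuous_on (cbox 0 1) (\<lambda>t. F (w, circ b r t))"
      using w sub by (intro continuous_on_compose2[OF FN]) (auto intro!: continuous_intros)
    then show "(\<lambda>t. F (w, circ b r t) * (circ b r t - b) / (circ b r t - b) ^ 2) integrable_on cbox 0 1"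
      using circ_neq[OF r(1), of b b] r(1) by (intro integrable_continuous continuous_intros) auto
  next
    have "continuous_on (ball a r \<times> cbox 0 1) (\<lambda>p. partial1 F (fst p, circ b r (snd p)))"
      using sub by (intro continuous_on_compose2[OF continuous_on_partial1[OF F]]) (auto intro!: continuous_intros)
    then have "continuous_on (ball a r \<times> cbox 0 1)
        (\<lambda>p. partial1 F (fst p, circ b r (snd p)) * (circ b r (snd p) - b) / (circ b r (snd p) - b) ^ 2)"
      using circ_neq[OF r(1), of b b] r(1) by (intro continuous_intros) auto
    then show "continuous_on (ball a r \<times> cbox 0 1)
        (\<lambda>(w, t). partial1 F (w, circ b r t) * (circ b r t - b) / (circ b r t - b) ^ 2)"
      by (simp add: case_prod_beta')
  qed (use r in auto)
  have slice2: "(\<lambda>y. F (w, y)) holomorphic_on cball b r" if "w \<in> cball a r" for w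
  proof -
    have "(\<lambda>y. F (w, y)) field_differentiable at y" if "y \<in> cball b r" for y
    proof -
      have "(w, y) \<in> N"
        using \<open>w \<in> cball a r\<close> that r(2) unfolding a_def b_def by auto
      then show ?thesis
        using F by (force simp: holomorphic2_def dest: bspec[of _ _ "(w, y)"])
    qed
    then show ?thesis
      by (simp add: holomorphic_on_def field_differentiable_at_within)
  qed
  have p2: "partial2 F (w, b) = integral (cbox 0 1) (\<lambda>t. F (w, circ b r t) * (circ b r t - b) / (circ b r t - b) ^ 2)"
    if "w \<in> ball a r" for w
    unfolding partial2_def using deriv_eq_circ_integral[OF slice2[of w] r(1), of b] that r(1) by simp
  have "((\<lambda>w. partial2 F (w, b)) has_field_derivative D a) (at a)"
    by (rule has_field_derivative_transform_within_open[of _ "D a" a "ball a r"])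
      (use D r(1) in \<open>auto simp: at_within_open[of a "ball a r"] p2\<close>)
  then show ?thesis
    by (simp add: D_def a_def b_def)
qed

lemma partial2_field_differentiable1:
  assumes F: "holomorphic2 F N" and u: "u \<in> N"
  shows "(\<lambda>a. partial2 F (a, snd u)) field_differentiable at (fst u)"
proof -
  obtain r where r: "r > 0" "cball (fst u) r \<times> cball (snd u) r \<subseteq> N"
    using open_imp_polydisc u F unfolding holomorphic2_def by metis
  then show ?thesis
    using partial2_has_derivative1[OF F] field_differentiable_def by blast
qed

lemma partial1_field_differentiable2:
  assumes F: "holomorphic2 F N" and u: "u \<in> N"
  shows "(\<lambda>b. partial1 F (fst u, b)) field_differentiable at (snd u)"
proof -
  have "partial2 (\<lambda>u. F (prod.swap u)) (b, a) = partial1 F (a, b)" for a b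
    using partial_swap(2)[of F "(a, b)"] by simp
  then show ?thesis
    using partial2_field_differentiable1[OF holomorphic2_swap[OF F], of "prod.swap u"] u by simp
qed

text \<open>Both mixed derivatives are the same Cauchy integral of \<open>partial1 F\<close> over a
  circle in the second variable.\<close>

lemma mixed_partials:
  assumes F: "holomorphic2 F N" and u: "u \<in> N"
  shows "\<exists>K. ((\<lambda>a. partial2 F (a, snd u)) has_field_derivative K) (at (fst u))
    \<and> ((\<lambda>b. partial1 F (fst u, b)) has_field_derivative K) (at (snd u))"
proof -
  obtain r where r: "r > 0" "cball (fst u) r \<times> cball (snd u) r \<subseteq> N"
    using open_imp_polydisc u F unfolding holomorphic2_def by metis
  let ?g = "\<lambda>b. partial1 F (fst u, b)"
  have diff: "?g field_differentiable at b" if "b \<in> cball (snd u) r" for b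
  proof -
    have "(fst u, b) \<in> N" using that r by (intro subsetD[OF r(2)]) auto
    from partial1_field_differentiable2[OF F this] show ?thesis by simp
  qed
  then have "?g holomorphic_on cball (snd u) r"
    by (auto simp: holomorphic_on_def field_differentiable_at_within)
  from deriv_eq_circ_integral[OF this r(1), of "snd u"] r(1)
  have "deriv ?g (snd u) = integral {0..1} (\<lambda>t. ?g (circ (snd u) r t) * (circ (snd u) r t - snd u) / (circ (snd u) r t - snd u) ^ 2)"
    by simp
  then have "((\<lambda>a. partial2 F (a, snd u)) has_field_derivative deriv ?g (snd u)) (at (fst u))"
    using partial2_has_derivative1[OF F r] by simp
  moreover have "(?g has_field_derivative deriv ?g (snd u)) (at (snd u))"
    using diff r(1) by (simp add: field_differentiable_derivI)
  ultimately show ?thesis by blast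
qed

text \<open>This is dd = 0. Nothing is known of the form outside \<open>N\<close>, so its components
  are compared with partial derivatives of \<open>F\<close> on discs through \<open>u\<close> that
  stay in \<open>N\<close>.\<close>

lemma has_curvature_zero:
  assumes "open N" "u \<in> N" and F: "\<And>v. v \<in> N \<Longrightarrow> has_differential F (\<theta> v) v"
  shows "has_curvature \<theta> 0 u"
proof -
  have hol: "holomorphic2 F N"
    using has_differential_imp_holomorphic2 assms by blast
  obtain K where K: "((\<lambda>a. partial2 F (a, snd u)) has_field_derivative K) (at (fst u))"
    "((\<lambda>b. partial1 F (fst u, b)) has_field_derivative K) (at (snd u))"
    using mixed_partials[OF hol assms(2)] by blast
  obtain r where r: "r > 0" "cball (fst u) r \<times> cball (snd u) r \<subseteq> N"
    using open_imp_polydisc assms by metis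
  have eq: "\<theta> v = (partial1 F v, partial2 F v)" if "v \<in> N" for v
    using F[OF that] has_differential_unique by blast
  have "((\<lambda>a. snd (\<theta> (a, snd u))) has_field_derivative K) (at (fst u))"
    by (rule has_field_derivative_transform_within_open[OF K(1), of "ball (fst u) r"])
      (use r eq in \<open>auto simp: subset_iff\<close>)
  moreover have "((\<lambda>b. fst (\<theta> (fst u, b))) has_field_derivative K) (at (snd u))"
    by (rule has_field_derivative_transform_within_open[OF K(2), of "ball (snd u) r"])
      (use r eq in \<open>auto simp: subset_iff\<close>)
  ultimately show ?thesis
    unfolding has_curvature_def by (metis diff_self)
qed

section \<open>Cauchy's estimates and uniform limits\<close>

lemma partial1_bound:
  assumes F: "holomorphic2 F N" and r: "r > 0" "cball (fst u) r \<times> cball (snd u) r \<subseteq> N"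
    and B: "\<And>v. v \<in> N \<Longrightarrow> cmod (F v) \<le> B"
  shows "cmod (partial1 F u) \<le> B / r"
proof -
  have hol: "(\<lambda>a. F (a, snd u)) holomorphic_on cball (fst u) r"
    using r by (intro holomorphic2_slice1[OF F]) auto
  have "cmod ((deriv ^^ 1) (\<lambda>a. F (a, snd u)) (fst u)) \<le> fact 1 * B / r ^ 1"
  proof (rule Cauchy_inequality)
    fix x assume "cmod (fst u - x) = r"
    then show "cmod (F (x, snd u)) \<le> B" using r by (intro B) (auto simp: dist_norm)
  qed (use hol r in \<open>auto intro: holomorphic_on_subset holomorphic_on_imp_continuous_on\<close>)
  then show ?thesis by (simp add: partial1_def)
qed

lemma partial2_bound:
  assumes F: "holomorphic2 F N" and r: "r > 0" "cball (fst u) r \<times> cball (snd u) r \<subseteq> N"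
    and B: "\<And>v. v \<in> N \<Longrightarrow> cmod (F v) \<le> B"
  shows "cmod (partial2 F u) \<le> B / r"
proof -
  have "cball (fst (prod.swap u)) r \<times> cball (snd (prod.swap u)) r \<subseteq> prod.swap ` N"
    using r by (force simp: image_iff)
  then show ?thesis
    using partial1_bound[OF holomorphic2_swap[OF F] r(1), of "prod.swap u" B] B
    by (auto simp: partial_swap)
qed

text \<open>Weierstrass' theorem is applied to each coordinate slice; joint continuity survives
  uniform limits.\<close>

lemma holomorphic2_uniform_limit:
  assumes F: "eventually (\<lambda>n. holomorphic2 (F n) N) sequentially" and N: "open N"
    and lim: "uniform_limit N F G sequentially"
  shows "holomorphic2 G N"
  unfolding holomorphic2_def
proof (intro conjI ballI)
  show "continuous_on N G"
    by (rule uniform_limit_theorem[OF _ lim])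
      (use F in \<open>auto simp: holomorphic2_def elim: eventually_mono\<close>)
next
  fix u assume u: "u \<in> N"
  obtain r where r: "r > 0" "cball (fst u) r \<times> cball (snd u) r \<subseteq> N"
    using open_imp_polydisc u N by metis
  have slice: "(\<lambda>a. H (a, snd u)) holomorphic_on cball (fst u) r" "(\<lambda>b. H (fst u, b)) holomorphic_on cball (snd u) r"
    if H: "holomorphic2 H N" for H
  proof -
    show "(\<lambda>a. H (a, snd u)) holomorphic_on cball (fst u) r"
      using r by (intro holomorphic2_slice1[OF H]) auto
    have "(\<lambda>b. H (prod.swap (b, fst u))) holomorphic_on cball (snd u) r"
      using r by (intro holomorphic2_slice1[OF holomorphic2_swap[OF H]]) (force simp: image_iff)
    then show "(\<lambda>b. H (fst u, b)) holomorphic_on cball (snd u) r" by simp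
  qed
  have "(\<lambda>a. G (a, snd u)) holomorphic_on ball (fst u) r"
  proof (rule holomorphic_uniform_limit[THEN conjunct2])
    show "\<forall>\<^sub>F n in sequentially. continuous_on (cball (fst u) r) (\<lambda>a. F n (a, snd u)) \<and>
        (\<lambda>a. F n (a, snd u)) holomorphic_on ball (fst u) r"
      using F by (rule eventually_mono)
        (intro conjI holomorphic_on_imp_continuous_on slice(1) holomorphic_on_subset[OF slice(1) ball_subset_cball])
    show "uniform_limit (cball (fst u) r) (\<lambda>n a. F n (a, snd u)) (\<lambda>a. G (a, snd u)) sequentially"
      using uniform_limit_compose'[OF lim, of "\<lambda>a. (a, snd u)" "cball (fst u) r"] r by (auto simp: subset_iff)
  qed auto
  then show "(\<lambda>a. G (a, snd u)) field_differentiable at (fst u)"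
    using r by (meson centre_in_ball holomorphic_on_imp_differentiable_at open_ball)
  have "(\<lambda>b. G (fst u, b)) holomorphic_on ball (snd u) r"
  proof (rule holomorphic_uniform_limit[THEN conjunct2])
    show "\<forall>\<^sub>F n in sequentially. continuous_on (cball (snd u) r) (\<lambda>b. F n (fst u, b)) \<and>
        (\<lambda>b. F n (fst u, b)) holomorphic_on ball (snd u) r"
      using F by (rule eventually_mono)
        (intro conjI holomorphic_on_imp_continuous_on slice(2) holomorphic_on_subset[OF slice(2) ball_subset_cball])
    show "uniform_limit (cball (snd u) r) (\<lambda>n b. F n (fst u, b)) (\<lambda>b. G (fst u, b)) sequentially"
      using uniform_limit_compose'[OF lim, of "\<lambda>b. (fst u, b)" "cball (snd u) r"] r by (auto simp: subset_iff)
  qed auto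
  then show "(\<lambda>b. G (fst u, b)) field_differentiable at (snd u)"
    using r by (meson centre_in_ball holomorphic_on_imp_differentiable_at open_ball)
qed (rule N)

section \<open>Primitives along maps into the curve\<close>

text \<open>A connected set of complex numbers with two points is uncountable. This yields constancy
  where local constancy is known only off the finitely many turning points.\<close>

lemma connected_countable_imp_const:
  fixes f :: "'a::topological_space \<Rightarrow> complex"
  assumes "connected S" "continuous_on S f" "countable (f ` S)" "x \<in> S" "y \<in> S"
  shows "f x = f y"
  by (rule ccontr) (metis assms connected_continuous_image connected_uncountable image_eqI)

text \<open>Primitives that are only defined locally glue on a convex set: their increments over short
  distances are consistent, and are summed along the segments issuing from a base point.\<close>

lemma glue_local_primitives:
  fixes K :: "'a::real_normed_vector set" and \<Psi> :: "'a \<Rightarrow> 'a \<Rightarrow> complex"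
  assumes K: "compact K" "convex K"
    and R: "\<And>k. k \<in> K \<Longrightarrow> R k > 0"
    and cont: "\<And>k. k \<in> K \<Longrightarrow> continuous_on (K \<inter> ball k (R k)) (\<Psi> k)"
    and cnt: "\<And>k k'. k \<in> K \<Longrightarrow> k' \<in> K \<Longrightarrow>
        countable ((\<lambda>x. \<Psi> k x - \<Psi> k' x) ` (K \<inter> ball k (R k) \<inter> ball k' (R k')))"
  shows "\<exists>\<Phi>. \<forall>k\<in>K. \<exists>r>0. \<exists>c. \<forall>x\<in>K \<inter> ball k r. \<Phi> x = \<Psi> k x + c"
proof (cases "K = {}")
  case False
  have consistent: "\<Psi> k y - \<Psi> k x = \<Psi> k' y - \<Psi> k' x"
    if "k \<in> K" "k' \<in> K" "x \<in> K" "y \<in> K" "x \<in> ball k (R k)" "x \<in> ball k' (R k')"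
      "y \<in> ball k (R k)" "y \<in> ball k' (R k')" for k k' x y
  proof -
    let ?C = "K \<inter> ball k (R k) \<inter> ball k' (R k')"
    have "\<Psi> k x - \<Psi> k' x = \<Psi> k y - \<Psi> k' y"
    proof (rule connected_countable_imp_const[of ?C "\<lambda>x. \<Psi> k x - \<Psi> k' x"])
      show "connected ?C"
        using K by (intro convex_connected convex_Int) auto
      show "continuous_on ?C (\<lambda>x. \<Psi> k x - \<Psi> k' x)"
        using that by (intro continuous_on_diff continuous_on_subset[OF cont[OF that(1)]]
            continuous_on_subset[OF cont[OF that(2)]]) auto
    qed (use that cnt in auto)
    then show ?thesis by (simp add: algebra_simps)
  qed
  \<comment> \<open>A Lebesgue number of the cover: everything within distance \<open>e\<close> of a
    point is seen by a single chart.\<close>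
  have "\<exists>e>0. \<forall>x\<in>K. \<exists>G\<in>(\<lambda>k. ball k (R k)) ` K. ball x e \<subseteq> G"
  proof (rule Heine_Borel_lemma[OF K(1), of "(\<lambda>k. ball k (R k)) ` K"])
    show "K \<subseteq> \<Union>((\<lambda>k. ball k (R k)) ` K)" using R by force
  qed auto
  then obtain e where e: "e > 0" "\<forall>x\<in>K. \<exists>k\<in>K. ball x e \<subseteq> ball k (R k)" by auto
  obtain \<kappa> where \<kappa>: "\<And>x. x \<in> K \<Longrightarrow> \<kappa> x \<in> K \<and> ball x e \<subseteq> ball (\<kappa> x) (R (\<kappa> x))"
    using bchoice[of K "\<lambda>x k. k \<in> K \<and> ball x e \<subseteq> ball k (R k)"] e(2) by blast
  define \<omega> where "\<omega> x y = \<Psi> (\<kappa> x) y - \<Psi> (\<kappa> x) x" for x y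
  have cocycle: "\<omega> x y + \<omega> y z = \<omega> x z"
    if "x \<in> K" "y \<in> K" "z \<in> K" "dist x y < e" "dist x z < e" "dist y z < e" for x y z
  proof -
    have "\<Psi> (\<kappa> y) z - \<Psi> (\<kappa> y) y = \<Psi> (\<kappa> x) z - \<Psi> (\<kappa> x) y"
      using that e \<kappa>[of x] \<kappa>[of y] by (intro consistent) (auto simp: subset_iff)
    then show ?thesis by (simp add: \<omega>_def)
  qed
  obtain x0 where x0: "x0 \<in> K" using False by auto
  obtain B where B: "B > 0" "\<And>x. x \<in> K \<Longrightarrow> dist x0 x < B"
    using compact_imp_bounded[OF K(1)]
    by (metis bounded_subset_ballD mem_ball subsetD)
  \<comment> \<open>With \<open>n\<close> subdivisions each step towards a point of \<open>K\<close>
    is shorter than \<open>e/2\<close>, so that one step and one displacement by less than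
    \<open>e/2\<close> together stay below \<open>e\<close>.\<close>
  obtain n where n: "B / (e/2) < real n" using reals_Archimedean2 by blast
  then have n0: "n > 0" using B e by (metis divide_pos_pos half_gt_zero gr0I of_nat_0 not_less_iff_gr_or_eq order_less_trans)
  define p where "p i x = x0 + (real i / real n) *\<^sub>R (x - x0)" for i x
  have pK: "p i x \<in> K" if "i \<le> n" "x \<in> K" for i x
  proof -
    have "p i x = (1 - real i / real n) *\<^sub>R x0 + (real i / real n) *\<^sub>R x"
      by (simp add: p_def algebra_simps)
    then show ?thesis
      using that n0 x0 K(2) by (auto intro!: convexD simp: field_simps)
  qed
  have pd: "dist (p i x) (p i y) \<le> dist x y" if "i \<le> n" for i x y
  proof -
    have "dist (p i x) (p i y) = (real i / real n) * dist x y"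
      by (simp add: p_def dist_norm flip: scaleR_diff_right)
    also have "\<dots> \<le> 1 * dist x y" using that n0 by (intro mult_right_mono) auto
    finally show ?thesis by simp
  qed
  have ps: "dist (p i x) (p (Suc i) x) < e/2" if "x \<in> K" for i x
  proof -
    have "p i x - p (Suc i) x = (- 1 / real n) *\<^sub>R (x - x0)"
      using n0 by (simp add: p_def flip: scaleR_diff_left) (simp add: field_simps)
    then have "dist (p i x) (p (Suc i) x) = dist x0 x / real n"
      by (simp add: dist_norm norm_minus_commute)
    also have "\<dots> < B / real n" using B that n0 by (intro divide_strict_right_mono) auto
    also have "\<dots> < e/2" using n n0 e by (simp add: field_simps)
    finally show ?thesis .
  qed
  define \<Phi> where "\<Phi> x = (\<Sum>i<n. \<omega> (p i x) (p (Suc i) x))" for x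
  have incr: "\<Phi> y - \<Phi> x = \<omega> x y" if xy: "x \<in> K" "y \<in> K" "dist x y < e/2" for x y
  proof -
    \<comment> \<open>In the small quadrilateral between two neighbouring segments both ways to the
      opposite corner have the same increment. Summed along the segments, the cross terms telescope
      and leave the increment between the end points.\<close>
    have step: "\<omega> (p i y) (p (Suc i) y) - \<omega> (p i x) (p (Suc i) x)
        = \<omega> (p (Suc i) x) (p (Suc i) y) - \<omega> (p i x) (p i y)" if i: "i < n" for i
    proof -
      have d: "dist (p i x) (p i y) < e/2" "dist (p (Suc i) x) (p (Suc i) y) < e/2"
        using pd[of i x y] pd[of "Suc i" x y] i xy by auto
      have d': "dist (p i x) (p (Suc i) x) < e/2" "dist (p i y) (p (Suc i) y) < e/2"
        using ps xy by auto
      have d'': "dist (p i x) (p (Suc i) y) < e"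
        using dist_triangle[of "p i x" "p (Suc i) y" "p i y"] d d' by simp
      have "\<omega> (p i x) (p (Suc i) x) + \<omega> (p (Suc i) x) (p (Suc i) y) = \<omega> (p i x) (p (Suc i) y)"
        using d d' d'' i xy e by (intro cocycle pK) auto
      moreover have "\<omega> (p i x) (p i y) + \<omega> (p i y) (p (Suc i) y) = \<omega> (p i x) (p (Suc i) y)"
        using d d' d'' i xy e by (intro cocycle pK) auto
      ultimately show ?thesis by (simp add: algebra_simps)
    qed
    have "\<Phi> y - \<Phi> x = (\<Sum>i<n. \<omega> (p (Suc i) x) (p (Suc i) y) - \<omega> (p i x) (p i y))"
      unfolding \<Phi>_def sum_subtractf[symmetric] by (rule sum.cong) (use step in auto)
    also have "\<dots> = \<omega> (p n x) (p n y) - \<omega> (p 0 x) (p 0 y)"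
      using sum_lessThan_telescope[of "\<lambda>i. \<omega> (p i x) (p i y)" n] by simp
    also have "\<dots> = \<omega> x y"
      using n0 by (simp add: p_def \<omega>_def)
    finally show ?thesis .
  qed
  have "\<exists>r>0. \<exists>c. \<forall>x\<in>K \<inter> ball k r. \<Phi> x = \<Psi> k x + c" if k: "k \<in> K" for k
  proof (intro exI conjI ballI)
    show "min (e/2) (R k) > 0" using e R k by auto
    fix x assume x: "x \<in> K \<inter> ball k (min (e/2) (R k))"
    have "\<Psi> (\<kappa> k) x - \<Psi> (\<kappa> k) k = \<Psi> k x - \<Psi> k k"
      using x k \<kappa>[of k] R[of k] e by (intro consistent) (auto simp: subset_iff)
    then have "\<omega> k x = \<Psi> k x - \<Psi> k k" by (simp only: \<omega>_def)
    moreover have "\<Phi> x = \<omega> k x + \<Phi> k" using incr[of k x] x k by (auto simp: diff_eq_eq)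
    ultimately show "\<Phi> x = \<Psi> k x + (\<Phi> k - \<Psi> k k)" by simp
  qed
  then show ?thesis by blast
qed simp

text \<open>The branch of \<open>y\<close> over the \<open>x\<close>-line that is close to the point \<open>z\<close>; \<open>z\<close> need not lie on the
  curve of \<open>u\<close>, so that the branch can be followed when \<open>u\<close> varies.\<close>

definition branch :: "param \<Rightarrow> point \<Rightarrow> complex \<Rightarrow> complex" where
  "branch u z x = snd z * csqrt (cubic u x / snd z ^ 2)"

text \<open>The condition puts the quotient under the square root into the unit disc about 1, away
  from the cut of \<open>csqrt\<close>; it is open in the parameter and in x together.\<close>

definition branch_dom :: "point \<Rightarrow> (param \<times> complex) set" where
  "branch_dom z = {(u, x). cmod (cubic u x - snd z ^ 2) < cmod (snd z) ^ 2}"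

lemma branch_in_curve: "snd z \<noteq> 0 \<Longrightarrow> (x, branch u z x) \<in> curve u"
  by (simp add: branch_def curve_def power_mult_distrib)

lemma branch_center: "z \<in> curve u \<Longrightarrow> snd z \<noteq> 0 \<Longrightarrow> branch u z (fst z) = snd z"
  by (auto simp: branch_def curve_def)

text \<open>The ratio of \<open>y\<close> to \<open>snd z\<close> lies in the unit disc about 1. Its
  real part is positive, so the principal root of its square is the ratio itself and not its
  negative.\<close>

lemma branch_eq:
  assumes "(x, y) \<in> curve u" "cmod (y - snd z) < cmod (snd z)"
  shows "branch u z x = y"
proof -
  have z: "snd z \<noteq> 0" using assms(2) by auto
  have "cmod (y / snd z - 1) < 1"
    using assms(2) z by (simp add: norm_divide divide_simps diff_divide_distrib[symmetric] flip: diff_divide_eq_iff)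
  then have "Re (y / snd z) > 0"
    using abs_Re_le_cmod[of "y / snd z - 1"] by simp
  then have "csqrt ((y / snd z) ^ 2) = y / snd z"
    by (intro csqrt_square) auto
  then show ?thesis
    using assms(1) z by (simp add: branch_def curve_def power_divide)
qed

lemma open_branch_dom: "open (branch_dom z)"
  unfolding branch_dom_def cubic_def case_prod_beta'
  by (intro open_Collect_less continuous_intros)

lemma center_in_branch_dom: "z \<in> curve u \<Longrightarrow> snd z \<noteq> 0 \<Longrightarrow> (u, fst z) \<in> branch_dom z"
  by (auto simp: branch_dom_def curve_def)

lemma branch_dom_Re:
  assumes "(u, x) \<in> branch_dom z"
  shows "snd z \<noteq> 0" "Re (cubic u x / snd z ^ 2) > 0" "branch u z x \<noteq> 0"
proof -
  have lt: "cmod (cubic u x - snd z ^ 2) < cmod (snd z) ^ 2" using assms by (simp add: branch_dom_def)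
  show z: "snd z \<noteq> 0"
    using lt by (metis norm_ge_zero norm_zero not_less power_zero_numeral)
  have "cubic u x / snd z ^ 2 - 1 = (cubic u x - snd z ^ 2) / snd z ^ 2"
    using z by (simp add: field_simps)
  then have "cmod (cubic u x / snd z ^ 2 - 1) < 1"
    using lt z by (simp add: norm_divide norm_power)
  then show *: "Re (cubic u x / snd z ^ 2) > 0"
    using abs_Re_le_cmod[of "cubic u x / snd z ^ 2 - 1"] by simp
  then show "branch u z x \<noteq> 0" using z by (auto simp: branch_def)
qed

lemma continuous_on_branch: "continuous_on (branch_dom z) (\<lambda>(u, x). branch u z x)"
  unfolding branch_def case_prod_beta'
proof (intro continuous_intros)
  have "(\<lambda>p. cubic (fst p) (snd p) / (snd z)\<^sup>2) ` branch_dom z \<subseteq> - \<real>\<^sub>\<le>\<^sub>0"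
    using branch_dom_Re(2)[of _ _ z] by (force simp: complex_nonpos_Reals_iff)
  moreover have "continuous_on (- \<real>\<^sub>\<le>\<^sub>0) csqrt"
    by (rule continuous_on_csqrt)
  moreover have "continuous_on (branch_dom z) (\<lambda>p. cubic (fst p) (snd p) / (snd z)\<^sup>2)"
    using branch_dom_Re(1)[of _ _ z] unfolding cubic_def by (intro continuous_intros) force
  ultimately show "continuous_on (branch_dom z) (\<lambda>p. csqrt (cubic (fst p) (snd p) / (snd z)\<^sup>2))"
    using continuous_on_compose2 by blast
qed

text \<open>From S^2 = Q follows S' = Q' / (2 S). Both the parameter and x may move, so one
  statement serves the derivatives in x, in a and in b.\<close>

lemma branch_chain:
  assumes "(u s, x s) \<in> branch_dom z"
    and "((\<lambda>s. cubic (u s) (x s)) has_field_derivative D) (at s)"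
  shows "((\<lambda>s. branch (u s) z (x s)) has_field_derivative D / (2 * branch (u s) z (x s))) (at s)"
proof -
  let ?q = "\<lambda>s. cubic (u s) (x s) / snd z ^ 2"
  note z = branch_dom_Re[OF assms(1)]
  have "?q s \<notin> \<real>\<^sub>\<le>\<^sub>0" using z(2) by (auto simp: complex_nonpos_Reals_iff)
  then have "((\<lambda>s. csqrt (?q s)) has_field_derivative (D / snd z ^ 2) * inverse (2 * csqrt (?q s))) (at s)"
    using DERIV_chain2[OF has_field_derivative_csqrt DERIV_cdivide[OF assms(2)], of "snd z ^ 2"]
    by (simp add: mult.commute)
  from DERIV_cmult[OF this, of "snd z"] show ?thesis
    using z(1,3) by (simp add: branch_def field_simps power2_eq_square)
qed

lemma branch_deriv_x:
  assumes "(u, x) \<in> branch_dom z"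
  shows "(branch u z has_field_derivative (3 * x ^ 2 + fst u) / (2 * branch u z x)) (at x)"
  using assms by (intro branch_chain[of "\<lambda>_. u" _ "\<lambda>x. x", simplified])
    (auto simp: cubic_def intro!: derivative_eq_intros)

lemma branch_deriv_a:
  assumes "((a, b), x) \<in> branch_dom z"
  shows "((\<lambda>a. branch (a, b) z x) has_field_derivative x / (2 * branch (a, b) z x)) (at a)"
  using assms by (intro branch_chain[of "\<lambda>a. (a, b)" a "\<lambda>_. x"])
    (auto simp: cubic_def intro!: derivative_eq_intros)

lemma branch_deriv_b:
  assumes "((a, b), x) \<in> branch_dom z"
  shows "((\<lambda>b. branch (a, b) z x) has_field_derivative 1 / (2 * branch (a, b) z x)) (at b)"
  using assms by (intro branch_chain[of "\<lambda>b. (a, b)" b "\<lambda>_. x"])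
    (auto simp: cubic_def intro!: derivative_eq_intros)

lemma isCont_branch:
  assumes "(u, x) \<in> branch_dom z"
  shows "isCont (branch u z) x"
  using branch_deriv_x[OF assms] DERIV_isCont by blast

lemma eventually_branch_dom:
  assumes "(u, x) \<in> branch_dom z"
  shows "eventually (\<lambda>x. (u, x) \<in> branch_dom z) (nhds x)"
proof -
  have "open (Pair u -` branch_dom z)"
    by (intro open_vimage open_branch_dom continuous_intros)
  from eventually_nhds_in_open[OF this, of x] show ?thesis using assms by simp
qed

lemma eventually_branch_in:
  assumes "(u, x) \<in> branch_dom z" "open W" "(x, branch u z x) \<in> W"
  shows "eventually (\<lambda>x. (x, branch u z x) \<in> W) (nhds x)"
proof -
  have "isCont (\<lambda>x. (x, branch u z x)) x"
    using isCont_branch[OF assms(1)] by (simp add: continuous_Pair)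
  then have "((\<lambda>x. (x, branch u z x)) \<longlongrightarrow> (x, branch u z x)) (nhds x)"
    unfolding isCont_def by (subst (asm) tendsto_at_iff_tendsto_nhds)
  then show ?thesis
    using assms(2,3) by (rule topological_tendstoD)
qed

text \<open>The germ of a branch depends only on the sheet and not on the point used to select it,
  so derivatives computed with different centres can be compared.\<close>

lemma branch_recenter:
  assumes "(u, x) \<in> branch_dom z"
  shows "eventually (\<lambda>x'. branch u (x, branch u z x) x' = branch u z x') (nhds x)"
proof -
  let ?y = "branch u z x"
  have "open {w :: point. cmod (snd w - ?y) < cmod ?y}"
    by (intro open_Collect_less continuous_intros)
  then have "eventually (\<lambda>x'. (x', branch u z x') \<in> {w. cmod (snd w - ?y) < cmod ?y}) (nhds x)"
    using branch_dom_Re(3)[OF assms] by (intro eventually_branch_in assms) auto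
  then show ?thesis
    by (rule eventually_mono) (auto intro!: branch_eq branch_in_curve branch_dom_Re(1)[OF assms])
qed

text \<open>Unlike \<open>curve_deriv\<close>, this reads \<open>G\<close> only at points of the
  curve (when y is nonzero at \<open>z\<close>), so primitives need no extension to the
  plane.\<close>

definition has_curve_derivative :: "param \<Rightarrow> (point \<Rightarrow> complex) \<Rightarrow> complex \<Rightarrow> point \<Rightarrow> bool" where
  "has_curve_derivative u G c z \<longleftrightarrow> ((\<lambda>x. G (x, branch u z x)) has_field_derivative c) (at (fst z))"

lemma has_curve_derivative_branch:
  assumes "has_curve_derivative u G c (x, branch u z x)" "(u, x) \<in> branch_dom z"
  shows "((\<lambda>x. G (x, branch u z x)) has_field_derivative c) (at x)"
proof -
  have "eventually (\<lambda>x'. G (x', branch u z x') = G (x', branch u (x, branch u z x) x')) (nhds x)"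
    using branch_recenter[OF assms(2)] by (rule eventually_mono) simp
  then show ?thesis
    using assms(1) DERIV_cong_ev[OF refl _ refl] unfolding has_curve_derivative_def by fastforce
qed

lemma has_curve_derivative_fst:
  "(P has_field_derivative c) (at (fst z)) \<Longrightarrow> has_curve_derivative u (\<lambda>w. P (fst w)) c z"
  by (simp add: has_curve_derivative_def)

text \<open>By continuity the path stays for a while on the branch through its present point. There
  \<open>G\<close> along the path is a function of x composed with the x-coordinate of the
  path.\<close>

lemma has_curve_derivative_path:
  assumes z: "\<sigma> t \<in> curve u" "snd (\<sigma> t) \<noteq> 0"
    and \<sigma>: "\<And>s. s \<in> T \<Longrightarrow> \<sigma> s \<in> curve u" "continuous (at t within T) \<sigma>" "t \<in> T"
    and v: "((fst \<circ> \<sigma>) has_vector_derivative v) (at t within T)"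
    and G: "has_curve_derivative u G c (\<sigma> t)"
  shows "((G \<circ> \<sigma>) has_vector_derivative c * v) (at t within T)"
proof -
  define S where "S = branch u (\<sigma> t)"
  have "((\<lambda>x. G (x, S x)) has_field_derivative c) (at ((fst \<circ> \<sigma>) t))"
    using G by (simp add: has_curve_derivative_def S_def)
  then have "((\<lambda>x. G (x, S x)) has_field_derivative c) (at ((fst \<circ> \<sigma>) t) within (fst \<circ> \<sigma>) ` T)"
    by (rule has_field_derivative_at_within)
  from field_vector_diff_chain_within[OF v this]
  have *: "((\<lambda>x. G (x, S x)) \<circ> (fst \<circ> \<sigma>) has_vector_derivative v * c) (at t within T)" .
  have "((\<lambda>s. snd (\<sigma> s)) \<longlongrightarrow> snd (\<sigma> t)) (at t within T)"
    using \<sigma>(2) by (auto simp: continuous_within intro: tendsto_snd)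
  then have "eventually (\<lambda>s. dist (snd (\<sigma> s)) (snd (\<sigma> t)) < cmod (snd (\<sigma> t))) (at t within T)"
    using z by (intro tendstoD) auto
  then obtain d where d: "d > 0" "\<And>s. s \<in> T \<Longrightarrow> s \<noteq> t \<Longrightarrow> dist s t < d \<Longrightarrow> dist (snd (\<sigma> s)) (snd (\<sigma> t)) < cmod (snd (\<sigma> t))"
    unfolding eventually_at by blast
  have "((G \<circ> \<sigma>) has_vector_derivative v * c) (at t within T)"
  proof (rule has_vector_derivative_transform_within[OF * d(1) \<sigma>(3)])
    fix s assume s: "s \<in> T" "dist s t < d"
    have "S (fst (\<sigma> s)) = snd (\<sigma> s)"
    proof (cases "s = t")
      case False
      then show ?thesis
        using d(2)[OF s(1) _ s(2)] \<sigma>(1)[OF s(1)] unfolding S_def by (intro branch_eq) (auto simp: dist_norm)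
    qed (use z in \<open>auto simp: S_def branch_center\<close>)
    then show "((\<lambda>x. G (x, S x)) \<circ> (fst \<circ> \<sigma>)) s = (G \<circ> \<sigma>) s" by simp
  qed
  then show ?thesis by (simp add: mult.commute)
qed

text \<open>The centre \<open>z\<close> may be a turning point. As x is no coordinate there, only
  continuity is required at it, and the derivative condition holds at the other points.\<close>

definition local_primitive ::
    "param \<Rightarrow> (point \<Rightarrow> complex) \<Rightarrow> point \<Rightarrow> (point \<Rightarrow> complex) \<Rightarrow> point set \<Rightarrow> bool" where
  "local_primitive u f z G W \<longleftrightarrow> open W \<and> z \<in> W \<and> continuous_on (W \<inter> curve u) G \<and>
     (\<forall>w \<in> W \<inter> curve u. snd w \<noteq> 0 \<longrightarrow> has_curve_derivative u G (f w) w)"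

lemma finite_turning_points: "finite {z \<in> curve u. snd z = 0}"
proof -
  have "poly [:snd u, fst u, 0, 1:] x = cubic u x" for x
    by (simp add: cubic_def algebra_simps power3_eq_cube)
  then have "finite {x. cubic u x = 0}"
    using poly_roots_finite[of "[:snd u, fst u, 0, 1:]"] by simp
  then have "finite ((\<lambda>x. (x, 0)) ` {x. cubic u x = 0})" by blast
  then show ?thesis
    by (rule finite_subset[rotated]) (auto simp: curve_def)
qed

text \<open>The difference is locally constant where y is nonzero, so by Lindelof's theorem it takes
  countably many values there, and the turning points add finitely many. The overlap need not be
  connected, so a single value cannot be expected.\<close>

lemma countable_local_primitive_diff:
  assumes 1: "local_primitive u f z1 G1 W1" and 2: "local_primitive u f z2 G2 W2"
  shows "countable ((\<lambda>z. G1 z - G2 z) ` (W1 \<inter> W2 \<inter> curve u))"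
proof -
  define H where "H z = G1 z - G2 z" for z
  define T where "T = {z \<in> W1 \<inter> W2 \<inter> curve u. snd z \<noteq> 0}"
  have "\<exists>O'. open O' \<and> z \<in> O' \<and> (\<forall>w \<in> O' \<inter> curve u. H w = H z)" if "z \<in> T" for z
  proof -
    have z: "z \<in> curve u" "snd z \<noteq> 0" "z \<in> W1 \<inter> W2" using that by (auto simp: T_def)
    note dom = center_in_branch_dom[OF z(1,2)]
    have op: "open (W1 \<inter> W2)" using 1 2 by (auto simp: local_primitive_def)
    have "eventually (\<lambda>x. (x, branch u z x) \<in> W1 \<inter> W2 \<and> (u, x) \<in> branch_dom z) (nhds (fst z))"
      using eventually_branch_in[OF dom op] eventually_branch_dom[OF dom] z
      by (auto simp: branch_center eventually_conj_iff)
    then obtain r where r: "r > 0"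
      "\<And>x. dist x (fst z) < r \<Longrightarrow> (x, branch u z x) \<in> W1 \<inter> W2 \<and> (u, x) \<in> branch_dom z"
      unfolding eventually_nhds_metric by blast
    have const: "H (x, branch u z x) = H z" if "x \<in> ball (fst z) r" for x
    proof -
      have "((\<lambda>x. H (x, branch u z x)) has_field_derivative 0) (at x within ball (fst z) r)"
        if "x \<in> ball (fst z) r" for x
      proof -
        have x: "(x, branch u z x) \<in> W1 \<inter> W2" "(u, x) \<in> branch_dom z"
          using that r(2)[of x] by (auto simp: dist_commute)
        have "(x, branch u z x) \<in> curve u" using z branch_in_curve by blast
        then have "has_curve_derivative u G1 (f (x, branch u z x)) (x, branch u z x)"
          "has_curve_derivative u G2 (f (x, branch u z x)) (x, branch u z x)"
          using 1 2 x branch_dom_Re(3)[OF x(2)] unfolding local_primitive_def by force+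
        from DERIV_diff[OF has_curve_derivative_branch[OF this(1) x(2)] has_curve_derivative_branch[OF this(2) x(2)]]
        show ?thesis by (simp add: H_def has_field_derivative_at_within)
      qed
      then obtain c where "\<forall>x\<in>ball (fst z) r. H (x, branch u z x) = c"
        using has_field_derivative_zero_constant[of "ball (fst z) r" "\<lambda>x. H (x, branch u z x)"] by auto
      then have "H (x, branch u z x) = H (fst z, branch u z (fst z))"
        using r(1) that by simp
      then show ?thesis using z by (simp add: branch_center)
    qed
    show ?thesis
    proof (intro exI conjI ballI)
      show "open {w. dist (fst z) (fst w) < r \<and> cmod (snd w - snd z) < cmod (snd z)}"
        by (intro open_Collect_conj open_Collect_less continuous_intros)
      show "z \<in> {w. dist (fst z) (fst w) < r \<and> cmod (snd w - snd z) < cmod (snd z)}"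
        using r z by simp
      fix w assume w: "w \<in> {w. dist (fst z) (fst w) < r \<and> cmod (snd w - snd z) < cmod (snd z)} \<inter> curve u"
      then have "branch u z (fst w) = snd w" by (intro branch_eq) auto
      then show "H w = H z" using const[of "fst w"] w by simp
    qed
  qed
  then obtain O' where O': "\<And>z. z \<in> T \<Longrightarrow> open (O' z) \<and> z \<in> O' z \<and> (\<forall>w \<in> O' z \<inter> curve u. H w = H z)"
    by metis
  have "open S" if "S \<in> O' ` T" for S using O' that by blast
  then obtain F where F: "F \<subseteq> O' ` T" "countable F" "\<Union> F = \<Union> (O' ` T)"
    using Lindelof[of "O' ` T"] by blast
  obtain C where C: "C \<subseteq> T" "countable C" "F = O' ` C"
    using countable_subset_image[of F O' T] F(1,2) by blast
  have "H ` T \<subseteq> H ` C"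
  proof
    fix h assume "h \<in> H ` T"
    then obtain z where z: "z \<in> T" "h = H z" by auto
    then have "z \<in> \<Union> F" using F(3) O'[of z] by blast
    then obtain c where "c \<in> C" "z \<in> O' c" using C(3) by blast
    then have "H z = H c" using O'[of c] C(1) z(1) by (auto simp: T_def)
    then show "h \<in> H ` C" using \<open>c \<in> C\<close> z by auto
  qed
  then have "countable (H ` T)" using C(2) by (meson countable_image countable_subset)
  then have "countable (H ` T \<union> H ` {z \<in> curve u. snd z = 0})"
    by (simp add: countable_finite finite_turning_points)
  then show ?thesis
    by (rule countable_subset[rotated]) (auto simp: H_def T_def)
qed

text \<open>The map into the curve is merely continuous, so differentiating along it makes no sense;
  instead \<open>\<Phi>\<close> is locally the pullback of a primitive on the curve, up to a
  constant.\<close>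

definition primitive_along ::
    "param \<Rightarrow> (point \<Rightarrow> complex) \<Rightarrow> 'a::metric_space set \<Rightarrow> ('a \<Rightarrow> point) \<Rightarrow> ('a \<Rightarrow> complex) \<Rightarrow> bool" where
  "primitive_along u f K \<sigma> \<Phi> \<longleftrightarrow> continuous_on K \<sigma> \<and> \<sigma> ` K \<subseteq> curve u \<and>
     (\<forall>k \<in> K. \<exists>G W. local_primitive u f (\<sigma> k) G W \<and>
       (\<exists>r>0. \<exists>c. \<forall>x \<in> K \<inter> ball k r. \<sigma> x \<in> W \<and> \<Phi> x = G (\<sigma> x) + c))"

lemma primitive_along_exists:
  fixes K :: "'a::real_normed_vector set"
  assumes K: "compact K" "convex K" and \<sigma>: "continuous_on K \<sigma>" "\<sigma> ` K \<subseteq> curve u"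
    and loc: "\<And>k. k \<in> K \<Longrightarrow> \<exists>G W. local_primitive u f (\<sigma> k) G W"
  shows "\<exists>\<Phi>. primitive_along u f K \<sigma> \<Phi>"
proof -
  obtain G W where GW: "\<And>k. k \<in> K \<Longrightarrow> local_primitive u f (\<sigma> k) (G k) (W k)"
    using loc by metis
  have "\<exists>r>0. \<forall>x \<in> K \<inter> ball k r. \<sigma> x \<in> W k" if "k \<in> K" for k
  proof -
    have "open (W k)" "\<sigma> k \<in> W k" using GW[OF that] by (auto simp: local_primitive_def)
    then have "\<exists>e>0. ball k e \<inter> K \<subseteq> K \<inter> \<sigma> -` W k"
      using continuous_openin_preimage_gen[OF \<sigma>(1), of "W k"] that
      unfolding openin_contains_ball by blast
    then show ?thesis by blast
  qed
  then obtain R where R: "\<And>k. k \<in> K \<Longrightarrow> R k > 0 \<and> (\<forall>x \<in> K \<inter> ball k (R k). \<sigma> x \<in> W k)"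
    by metis
  have "\<exists>\<Phi>. \<forall>k\<in>K. \<exists>r>0. \<exists>c. \<forall>x\<in>K \<inter> ball k r. \<Phi> x = (G k \<circ> \<sigma>) x + c"
  proof (rule glue_local_primitives[OF K, of R])
    fix k assume k: "k \<in> K"
    show "R k > 0" using R[OF k] by simp
    show "continuous_on (K \<inter> ball k (R k)) (G k \<circ> \<sigma>)"
    proof (rule continuous_on_compose)
      show "continuous_on (K \<inter> ball k (R k)) \<sigma>"
        using \<sigma>(1) continuous_on_subset by blast
      show "continuous_on (\<sigma> ` (K \<inter> ball k (R k))) (G k)"
        using GW[OF k] R[OF k] \<sigma>(2) unfolding local_primitive_def
        by (elim conjE) (erule continuous_on_subset, auto)
    qed
    fix k' assume k': "k' \<in> K"
    show "countable ((\<lambda>x. (G k \<circ> \<sigma>) x - (G k' \<circ> \<sigma>) x) ` (K \<inter> ball k (R k) \<inter> ball k' (R k')))"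
      using R[OF k] R[OF k'] \<sigma>(2)
      by (intro countable_subset[OF _ countable_local_primitive_diff[OF GW[OF k] GW[OF k']]])
        (fastforce simp: image_iff)
  qed
  then obtain \<Phi> where \<Phi>: "\<And>k. k \<in> K \<Longrightarrow> \<exists>r>0. \<exists>c. \<forall>x\<in>K \<inter> ball k r. \<Phi> x = (G k \<circ> \<sigma>) x + c" by blast
  have "\<exists>G W. local_primitive u f (\<sigma> k) G W \<and>
       (\<exists>r>0. \<exists>c. \<forall>x \<in> K \<inter> ball k r. \<sigma> x \<in> W \<and> \<Phi> x = G (\<sigma> x) + c)" if k: "k \<in> K" for k
  proof -
    obtain r c where r: "r > 0" "\<forall>x\<in>K \<inter> ball k r. \<Phi> x = (G k \<circ> \<sigma>) x + c" using \<Phi>[OF k] by blast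
    have "\<forall>x \<in> K \<inter> ball k (min r (R k)). \<sigma> x \<in> W k \<and> \<Phi> x = G k (\<sigma> x) + c"
      using r R[OF k] by auto
    moreover have "min r (R k) > 0" using r R[OF k] by auto
    ultimately show ?thesis using GW[OF k] by blast
  qed
  then show ?thesis using \<sigma> unfolding primitive_along_def by blast
qed

lemma primitive_along_continuous:
  assumes "primitive_along u f K \<sigma> \<Phi>"
  shows "continuous_on K \<Phi>"
  unfolding continuous_on_eq_continuous_within
proof
  fix k assume k: "k \<in> K"
  obtain G W r c where *: "local_primitive u f (\<sigma> k) G W" "r > 0"
      "\<forall>x \<in> K \<inter> ball k r. \<sigma> x \<in> W \<and> \<Phi> x = G (\<sigma> x) + c"
    using assms k unfolding primitive_along_def by blast
  have "continuous_on (K \<inter> ball k r) (\<lambda>x. G (\<sigma> x) + c)"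
    using * assms unfolding primitive_along_def local_primitive_def
    by (intro continuous_intros continuous_on_compose2[of "W \<inter> curve u" G _ \<sigma>]) (auto intro: continuous_on_subset)
  then have "continuous_on (K \<inter> ball k r) \<Phi>"
    by (rule continuous_on_eq) (use * in auto)
  then have "continuous (at k within K \<inter> ball k r) \<Phi>"
    using k *(2) by (simp add: continuous_on_eq_continuous_within)
  moreover have "at k within K \<inter> ball k r = at k within K"
    using *(2) by (intro at_within_nhd[of _ "ball k r"]) auto
  ultimately show "continuous (at k within K) \<Phi>" by simp
qed

text \<open>Near each point the difference is a translate of a difference of local primitives and
  takes countably many values; a countable cover of \<open>K\<close> leaves countably many in
  total.\<close>

lemma primitive_along_unique:
  fixes K :: "'a::{metric_space, second_countable_topology} set"
  assumes 1: "primitive_along u f K \<sigma> \<Phi>" and 2: "primitive_along u f K \<sigma> \<Psi>"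
    and K: "connected K" "k \<in> K" "k' \<in> K"
  shows "\<Phi> k - \<Psi> k = \<Phi> k' - \<Psi> k'"
proof (rule connected_countable_imp_const[OF K(1) _ _ K(2,3), of "\<lambda>x. \<Phi> x - \<Psi> x"])
  show "continuous_on K (\<lambda>x. \<Phi> x - \<Psi> x)"
    using 1 2 by (intro continuous_on_diff primitive_along_continuous)
  have "\<exists>r>0. countable ((\<lambda>x. \<Phi> x - \<Psi> x) ` (K \<inter> ball k r))" if k: "k \<in> K" for k
  proof -
    obtain G W r c where G: "local_primitive u f (\<sigma> k) G W" "r > 0"
        "\<forall>x \<in> K \<inter> ball k r. \<sigma> x \<in> W \<and> \<Phi> x = G (\<sigma> x) + c"
      using 1 k unfolding primitive_along_def by blast
    obtain G' W' r' c' where G': "local_primitive u f (\<sigma> k) G' W'" "r' > 0"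
        "\<forall>x \<in> K \<inter> ball k r'. \<sigma> x \<in> W' \<and> \<Psi> x = G' (\<sigma> x) + c'"
      using 2 k unfolding primitive_along_def by blast
    have sub: "\<sigma> ` K \<subseteq> curve u" using 1 by (auto simp: primitive_along_def)
    have "(\<lambda>x. \<Phi> x - \<Psi> x) ` (K \<inter> ball k (min r r'))
        \<subseteq> (\<lambda>h. h + (c - c')) ` ((\<lambda>z. G z - G' z) ` (W \<inter> W' \<inter> curve u))"
    proof (rule image_subsetI)
      fix x assume x: "x \<in> K \<inter> ball k (min r r')"
      then have "\<Phi> x - \<Psi> x = (G (\<sigma> x) - G' (\<sigma> x)) + (c - c')" "\<sigma> x \<in> W \<inter> W' \<inter> curve u"
        using G(3) G'(3) sub by auto
      then show "\<Phi> x - \<Psi> x \<in> (\<lambda>h. h + (c - c')) ` ((\<lambda>z. G z - G' z) ` (W \<inter> W' \<inter> curve u))"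
        by blast
    qed
    moreover have "countable ((\<lambda>h. h + (c - c')) ` ((\<lambda>z. G z - G' z) ` (W \<inter> W' \<inter> curve u)))"
      by (intro countable_image countable_local_primitive_diff[OF G(1) G'(1)])
    ultimately show ?thesis
      using G(2) G'(2) by (intro exI[of _ "min r r'"]) (auto intro: countable_subset)
  qed
  then obtain R where R: "\<And>k. k \<in> K \<Longrightarrow> R k > 0 \<and> countable ((\<lambda>x. \<Phi> x - \<Psi> x) ` (K \<inter> ball k (R k)))"
    by metis
  obtain F where F: "F \<subseteq> (\<lambda>k. ball k (R k)) ` K" "countable F" "\<Union> F = \<Union> ((\<lambda>k. ball k (R k)) ` K)"
    using Lindelof[of "(\<lambda>k. ball k (R k)) ` K"] by auto
  have "(\<lambda>x. \<Phi> x - \<Psi> x) ` K \<subseteq> (\<Union>B\<in>F. (\<lambda>x. \<Phi> x - \<Psi> x) ` (K \<inter> B))"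
  proof (rule image_subsetI)
    fix x assume "x \<in> K"
    then have "x \<in> \<Union> F" using F(3) R by fastforce
    then show "\<Phi> x - \<Psi> x \<in> (\<Union>B\<in>F. (\<lambda>x. \<Phi> x - \<Psi> x) ` (K \<inter> B))" using \<open>x \<in> K\<close> by auto
  qed
  moreover have "countable (\<Union>B\<in>F. (\<lambda>x. \<Phi> x - \<Psi> x) ` (K \<inter> B))"
    using F(1,2) R by (intro countable_UN) auto
  ultimately show "countable ((\<lambda>x. \<Phi> x - \<Psi> x) ` K)" by (rule countable_subset)
qed

lemma primitive_along_compose:
  assumes P: "primitive_along u f K \<sigma> \<Phi>" and g: "continuous_on L g" "g ` L \<subseteq> K"
  shows "primitive_along u f L (\<sigma> \<circ> g) (\<Phi> \<circ> g)"
  unfolding primitive_along_def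
proof (intro conjI ballI)
  show "continuous_on L (\<sigma> \<circ> g)"
    using P g unfolding primitive_along_def by (intro continuous_on_compose) (auto intro: continuous_on_subset)
  show "(\<sigma> \<circ> g) ` L \<subseteq> curve u"
    using P g unfolding primitive_along_def by auto
  fix l assume l: "l \<in> L"
  then obtain G W r c where *: "local_primitive u f (\<sigma> (g l)) G W" "r > 0"
      "\<forall>x \<in> K \<inter> ball (g l) r. \<sigma> x \<in> W \<and> \<Phi> x = G (\<sigma> x) + c"
    using P g(2) unfolding primitive_along_def by blast
  obtain d where d: "d > 0" "\<And>x. x \<in> L \<Longrightarrow> dist x l < d \<Longrightarrow> dist (g x) (g l) < r"
    using g(1) l *(2) unfolding continuous_on_iff by blast
  have "(\<sigma> \<circ> g) x \<in> W \<and> (\<Phi> \<circ> g) x = G ((\<sigma> \<circ> g) x) + c" if "x \<in> L \<inter> ball l d" for x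
    using *(3) d(2)[of x] g(2) that by (auto simp: dist_commute image_subset_iff)
  then have "\<exists>r>0. \<exists>c. \<forall>x \<in> L \<inter> ball l r. (\<sigma> \<circ> g) x \<in> W \<and> (\<Phi> \<circ> g) x = G ((\<sigma> \<circ> g) x) + c"
    using d(1) by blast
  then show "\<exists>G W. local_primitive u f ((\<sigma> \<circ> g) l) G W \<and>
      (\<exists>r>0. \<exists>c. \<forall>x \<in> L \<inter> ball l r. (\<sigma> \<circ> g) x \<in> W \<and> (\<Phi> \<circ> g) x = G ((\<sigma> \<circ> g) x) + c)"
    using *(1) unfolding comp_apply by blast
qed

text \<open>\<open>loop_integral\<close> takes the value 0 when the integrand is not integrable;
  this version carries integrability along, as additivity requires.\<close>

definition has_loop_integral :: "(point \<Rightarrow> complex) \<Rightarrow> complex \<Rightarrow> (real \<Rightarrow> point) \<Rightarrow> bool" where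
  "has_loop_integral f I p \<longleftrightarrow>
     ((\<lambda>t. f (p t) * vector_derivative (fst \<circ> p) (at t within {0..1})) has_integral I) {0..1}"

lemma has_loop_integral_imp_eq: "has_loop_integral f I p \<Longrightarrow> loop_integral f p = I"
  unfolding has_loop_integral_def loop_integral_def by (rule integral_unique)

text \<open>The fundamental theorem tolerates the finitely many times at which a valid path is not
  differentiable. The derivative of \<open>\<Phi>\<close> is demanded only where the path has
  one.\<close>

lemma has_integral_along_path:
  fixes \<Phi> :: "real \<Rightarrow> complex" and p :: "real \<Rightarrow> point"
  assumes p: "valid_path p" and st: "0 \<le> s" "s \<le> t" "t \<le> 1" and \<Phi>: "continuous_on {s..t} \<Phi>"
    and D: "\<And>r v. s < r \<Longrightarrow> r < t \<Longrightarrow> (p has_vector_derivative v) (at r) \<Longrightarrow>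
        (\<Phi> has_vector_derivative f (p r) * fst v) (at r)"
  shows "((\<lambda>r. f (p r) * vector_derivative (fst \<circ> p) (at r within {0..1})) has_integral \<Phi> t - \<Phi> s) {s..t}"
proof -
  obtain S where S: "finite S" "p C1_differentiable_on ({0..1} - S)"
    using p by (auto simp: valid_path_def piecewise_C1_differentiable_on_def)
  show ?thesis
  proof (rule fundamental_theorem_of_calculus_interior_strong[OF S(1) st(2)])
    fix r assume r: "r \<in> {s<..<t} - S"
    then have r': "r \<in> {0<..<1} - S" using st by auto
    obtain d where "\<forall>t\<in>{0..1} - S. (p has_vector_derivative d t) (at t)"
      using S(2) unfolding C1_differentiable_on_def by blast
    then have v: "(p has_vector_derivative d r) (at r)" using r' by auto
    have "((fst \<circ> p) has_vector_derivative fst (d r)) (at r)"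
      using bounded_linear.has_vector_derivative[OF bounded_linear_fst v] by (simp add: o_def)
    then have "((fst \<circ> p) has_vector_derivative fst (d r)) (at r within {0..1})"
      by (rule has_vector_derivative_at_within)
    then have "vector_derivative (fst \<circ> p) (at r within {0..1}) = fst (d r)"
      using r' by (intro vector_derivative_within_closed_interval) auto
    then show "(\<Phi> has_vector_derivative f (p r) * vector_derivative (fst \<circ> p) (at r within {0..1})) (at r)"
      using D[OF _ _ v] r by auto
  qed (rule \<Phi>)
qed

lemma primitive_along_has_loop_integral:
  assumes p: "regular_loop u p" and \<Phi>: "primitive_along u f {0..1} p \<Phi>"
  shows "has_loop_integral f (\<Phi> 1 - \<Phi> 0) p"
  unfolding has_loop_integral_def
proof (rule has_integral_along_path)
  show "valid_path p" using p by (simp add: regular_loop_def)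
  show "continuous_on {0..1} \<Phi>" using \<Phi> by (rule primitive_along_continuous)
  fix t v assume t: "0 < t" "t < (1::real)" and v: "(p has_vector_derivative v) (at t)"
  have pc: "p s \<in> curve u" "snd (p s) \<noteq> 0" if "s \<in> {0..1}" for s
    using p that unfolding regular_loop_def path_image_def by auto
  have t': "t \<in> {0..1}" using t by simp
  obtain G W r c where *: "local_primitive u f (p t) G W" "r > 0"
      "\<forall>x \<in> {0..1} \<inter> ball t r. p x \<in> W \<and> \<Phi> x = G (p x) + c"
    using \<Phi> t' unfolding primitive_along_def by blast
  have G: "has_curve_derivative u G (f (p t)) (p t)"
    using * pc[of t] t unfolding local_primitive_def by auto
  have "((G \<circ> p) has_vector_derivative f (p t) * fst v) (at t within {0<..<1})"
  proof (rule has_curve_derivative_path[where u = u])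
    show "continuous (at t within {0<..<1}) p"
      using v has_vector_derivative_continuous continuous_at_imp_continuous_at_within by blast
    show "((fst \<circ> p) has_vector_derivative fst v) (at t within {0<..<1})"
      using bounded_linear.has_vector_derivative[OF bounded_linear_fst v]
      by (simp add: o_def has_vector_derivative_at_within)
  qed (use t pc G in auto)
  then have "((G \<circ> p) has_vector_derivative f (p t) * fst v) (at t)"
    using t by (simp add: at_within_open[of t "{0<..<1}"])
  then have "((\<lambda>x. (G \<circ> p) x + c) has_vector_derivative f (p t) * fst v) (at t)"
    by (simp add: has_vector_derivative_add_const o_def)
  then show "(\<Phi> has_vector_derivative f (p t) * fst v) (at t)"
  proof (rule has_vector_derivative_transform_within_open)
    show "open (ball t r \<inter> {0<..<1})" by auto
  qed (use t * in auto)
qed simp_all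

section \<open>Homology invariance\<close>

lemma local_primitive_regular:
  assumes z: "z \<in> curve u" "snd z \<noteq> 0" and A: "open A" "fst z \<in> A"
    and hol: "(\<lambda>x. f (x, branch u z x)) holomorphic_on A"
  shows "\<exists>G W. local_primitive u f z G W"
proof -
  obtain r where r: "r > 0" "ball (fst z) r \<subseteq> A" using A open_contains_ball by blast
  obtain P where P: "\<And>x. x \<in> ball (fst z) r \<Longrightarrow> (P has_field_derivative f (x, branch u z x)) (at x)"
    using holomorphic_convex_primitive'[of "ball (fst z) r" "\<lambda>x. f (x, branch u z x)"]
      holomorphic_on_subset[OF hol r(2)] by (auto simp: at_within_open[of _ "ball (fst z) r"])
  define W where "W = {w :: point. dist (fst z) (fst w) < r \<and> cmod (snd w - snd z) < cmod (snd z)}"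
  have "local_primitive u f z (\<lambda>w. P (fst w)) W"
    unfolding local_primitive_def
  proof (intro conjI ballI impI)
    show "open W" unfolding W_def by (intro open_Collect_conj open_Collect_less continuous_intros)
    show "z \<in> W" using r z by (simp add: W_def)
    have "continuous_on (ball (fst z) r) P" using P by (meson DERIV_isCont continuous_at_imp_continuous_on)
    then show "continuous_on (W \<inter> curve u) (\<lambda>w. P (fst w))"
      by (rule continuous_on_compose2) (auto simp: W_def intro!: continuous_intros)
    fix w assume w: "w \<in> W \<inter> curve u"
    then have "branch u z (fst w) = snd w" by (intro branch_eq) (auto simp: W_def)
    then show "has_curve_derivative u (\<lambda>w. P (fst w)) (f w) w"
      using P[of "fst w"] w by (intro has_curve_derivative_fst) (auto simp: W_def)
  qed
  then show ?thesis by blast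
qed

lemma cubic_derivative_nonzero:
  assumes "discr u \<noteq> 0" "cubic u e = 0"
  shows "3 * e ^ 2 + fst u \<noteq> 0"
proof
  assume *: "3 * e ^ 2 + fst u = 0"
  \<comment> \<open>The Bezout identity between Q and Q'; its cofactors return in
    \<open>reducible_odd_neg\<close>.\<close>
  have "discr u = (27 * snd u - 18 * fst u * e) * cubic u e
      + (6 * fst u * e ^ 2 - 9 * snd u * e + 4 * fst u ^ 2) * (3 * e ^ 2 + fst u)"
    unfolding discr_def cubic_def by (simp add: algebra_simps power2_eq_square power3_eq_cube)
  with * assms show False by simp
qed

text \<open>Where \<open>y = 0\<close>, the function \<open>y\<close> is a coordinate of the curve and \<open>dx/y = 2 dy/Q'(x)\<close>.\<close>

lemma local_primitive_turning:
  assumes d: "discr u \<noteq> 0" and z: "z \<in> curve u" "snd z = 0" and h: "h holomorphic_on UNIV"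
  shows "\<exists>G W. local_primitive u (\<lambda>w. h (fst w) / snd w) z G W"
proof -
  define e where "e = fst z"
  have e: "cubic u e = 0" "z = (e, 0)" using z by (auto simp: curve_def e_def)
  have Q': "(cubic u has_field_derivative 3 * x ^ 2 + fst u) (at x)" for x
    unfolding cubic_def by (auto intro!: derivative_eq_intros)
  have Qhol: "cubic u holomorphic_on S" for S
    using Q' by (meson field_differentiable_at_within field_differentiable_def holomorphic_on_def)
  have "deriv (cubic u) e \<noteq> 0" using cubic_derivative_nonzero[OF d e(1)] DERIV_imp_deriv[OF Q'] by simp
  then obtain r where r: "r > 0" "open (cubic u ` ball e r)" "inj_on (cubic u) (ball e r)"
    using has_complex_derivative_locally_invertible[OF Qhol UNIV_I open_UNIV, of e] by auto
  obtain g where g: "g holomorphic_on cubic u ` ball e r"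
      "\<And>x. x \<in> ball e r \<Longrightarrow> deriv (cubic u) x * deriv g (cubic u x) = 1"
      "\<And>x. x \<in> ball e r \<Longrightarrow> g (cubic u x) = x"
    using holomorphic_has_inverse[OF Qhol _ r(3)] by auto
  have "open ((\<lambda>y. y ^ 2) -` (cubic u ` ball e r))"
    by (intro open_vimage r(2) continuous_intros)
  moreover have "0 \<in> (\<lambda>y. y ^ 2) -` (cubic u ` ball e r)"
    using e(1) r(1) by (force simp: image_iff)
  ultimately obtain \<rho> where \<rho>: "\<rho> > 0" "ball 0 \<rho> \<subseteq> (\<lambda>y. y ^ 2) -` (cubic u ` ball e r)"
    using open_contains_ball by blast
  \<comment> \<open>Near the turning point x = g(y^2), hence dx = 2 y g'(y^2) dy; the factor y
    cancels the denominator of h dx / y, and \<open>D\<close> is what remains in front of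
    dy.\<close>
  define D where "D y = 2 * h (g (y ^ 2)) * deriv g (y ^ 2)" for y
  have sq: "(\<lambda>y. y ^ 2) holomorphic_on ball 0 \<rho>" "(\<lambda>y. y ^ 2) ` ball 0 \<rho> \<subseteq> cubic u ` ball e r"
    using \<rho>(2) by (auto intro!: holomorphic_intros)
  have g2: "(\<lambda>y. g (y ^ 2)) holomorphic_on ball 0 \<rho>"
    using holomorphic_on_compose_gen[OF sq(1) g(1) sq(2)] by (simp add: o_def)
  have "(\<lambda>y. deriv g (y ^ 2)) holomorphic_on ball 0 \<rho>"
    using holomorphic_on_compose_gen[OF sq(1) holomorphic_deriv[OF g(1) r(2)] sq(2)] by (simp add: o_def)
  moreover have "(\<lambda>y. h (g (y ^ 2))) holomorphic_on ball 0 \<rho>"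
    using holomorphic_on_compose_gen[OF g2 h] by (simp add: o_def)
  ultimately have "D holomorphic_on ball 0 \<rho>"
    unfolding D_def by (intro holomorphic_intros)
  then obtain G where G: "\<And>y. y \<in> ball 0 \<rho> \<Longrightarrow> (G has_field_derivative D y) (at y)"
    using holomorphic_convex_primitive'[of "ball 0 \<rho>" D] by (auto simp: at_within_open[of _ "ball 0 \<rho>"])
  define W where "W = ball e r \<times> ball (0 :: complex) \<rho>"
  have "local_primitive u (\<lambda>w. h (fst w) / snd w) z (\<lambda>w. G (snd w)) W"
    unfolding local_primitive_def
  proof (intro conjI ballI impI)
    show "open W" by (simp add: W_def open_Times)
    show "z \<in> W" using r \<rho> e by (simp add: W_def)
    have "continuous_on (ball 0 \<rho>) G" using G by (meson DERIV_isCont continuous_at_imp_continuous_on)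
    then show "continuous_on (W \<inter> curve u) (\<lambda>w. G (snd w))"
      by (rule continuous_on_compose2) (auto simp: W_def intro!: continuous_intros)
    fix w assume w: "w \<in> W \<inter> curve u" "snd w \<noteq> 0"
    obtain x y where xy: "w = (x, y)" by (cases w)
    have y: "y \<noteq> 0" "cubic u x = y ^ 2" "x \<in> ball e r" "y \<in> ball 0 \<rho>" and wc: "w \<in> curve u"
      using w by (auto simp: xy W_def curve_def)
    have "(3 * x ^ 2 + fst u) * deriv g (y ^ 2) = 1"
      using g(2)[OF y(3)] by (simp only: y(2) DERIV_imp_deriv[OF Q'])
    then have nz: "3 * x ^ 2 + fst u \<noteq> 0" "deriv g (y ^ 2) = inverse (3 * x ^ 2 + fst u)"
      using inverse_unique[of "3 * x ^ 2 + fst u" "deriv g (y ^ 2)"] by auto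
    have gx: "g (y ^ 2) = x" using g(3)[OF y(3)] by (simp only: y(2))
    have b: "branch u w x = y" using branch_center[OF wc w(2)] by (simp add: xy)
    have "((\<lambda>x. G (branch u w x)) has_field_derivative D y * ((3 * x ^ 2 + fst u) / (2 * y))) (at x)"
      using DERIV_chain2[of G "D y" "branch u w" x] G[OF y(4)]
        branch_deriv_x[of u x w] center_in_branch_dom[OF wc w(2)] b
      by (simp add: xy del: times_divide_eq_right)
    moreover have "D y * ((3 * x ^ 2 + fst u) / (2 * y)) = h x / y"
      unfolding D_def gx nz(2) using nz(1) y(1) by (simp add: divide_simps)
    ultimately show "has_curve_derivative u (\<lambda>w. G (snd w)) (h (fst w) / snd w) w"
      by (simp add: has_curve_derivative_def xy)
  qed
  then show ?thesis by blast
qed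

lemma local_primitive_holomorphic_over_y:
  assumes d: "discr u \<noteq> 0" and z: "z \<in> curve u" and h: "h holomorphic_on UNIV"
  shows "\<exists>G W. local_primitive u (\<lambda>w. h (fst w) / snd w) z G W"
proof (cases "snd z = 0")
  case False
  define A where "A = {x. (u, x) \<in> branch_dom z}"
  have A: "open A"
    using open_vimage[OF open_branch_dom[of z], of "Pair u"] unfolding A_def vimage_def
    by (simp add: continuous_on_Pair)
  have "(branch u z) holomorphic_on A"
    using branch_deriv_x[of u _ z] A unfolding A_def
    by (auto simp: holomorphic_on_open)
  then have "(\<lambda>x. h x / branch u z x) holomorphic_on A"
    using branch_dom_Re(3)[of u _ z] by (intro holomorphic_intros holomorphic_on_subset[OF h]) (auto simp: A_def)
  then show ?thesis
    using local_primitive_regular[OF z False A] center_in_branch_dom[OF z False] by (simp add: A_def)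
qed (use local_primitive_turning assms in blast)

section \<open>Integration over singular chains\<close>

definition edge :: "real \<Rightarrow> nat \<Rightarrow> real" where
  "edge s i = (if i = 0 then 1 - s else if i = 1 then s else 0)"

definition triangle :: "real \<times> real \<Rightarrow> nat \<Rightarrow> real" where
  "triangle p i = (if i = 0 then 1 - fst p - snd p else if i = 1 then fst p else if i = 2 then snd p else 0)"

definition triangle_dom :: "(real \<times> real) set" where
  "triangle_dom = {p. 0 \<le> fst p \<and> 0 \<le> snd p \<and> fst p + snd p \<le> 1}"

lemma edge_in_simplex: "s \<in> {0..1} \<Longrightarrow> edge s \<in> standard_simplex 1"
  by (auto simp: standard_simplex_def edge_def)

lemma triangle_in_simplex: "p \<in> triangle_dom \<Longrightarrow> triangle p \<in> standard_simplex 2"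
  by (auto simp: standard_simplex_def triangle_def triangle_dom_def numeral_2_eq_2)

lemma continuous_on_triangle: "continuous_on S (\<lambda>p. triangle p i)"
  unfolding triangle_def
  by (cases "i = 0"; cases "i = 1"; cases "i = 2") (auto intro!: continuous_intros)

lemma compact_triangle_dom: "compact triangle_dom"
proof -
  have "closed triangle_dom"
    unfolding triangle_dom_def
    by (intro closed_Collect_conj closed_Collect_le continuous_intros)
  moreover have "triangle_dom \<subseteq> cbox (0, 0) (1, 1)"
    by (auto simp: triangle_dom_def cbox_Pair_eq)
  ultimately show ?thesis
    by (meson bounded_cbox bounded_subset compact_eq_bounded_closed)
qed

lemma convex_triangle_dom: "convex triangle_dom"
proof (rule convexI)
  fix p q :: "real \<times> real" and a b :: real
  assume *: "p \<in> triangle_dom" "q \<in> triangle_dom" "0 \<le> a" "0 \<le> b" "a + b = 1"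
  have "a * (fst p + snd p) + b * (fst q + snd q) \<le> a * 1 + b * 1"
    using * by (intro add_mono mult_left_mono) (auto simp: triangle_dom_def)
  then show "a *\<^sub>R p + b *\<^sub>R q \<in> triangle_dom"
    using * by (auto simp: triangle_dom_def algebra_simps)
qed

lemma singular_simplex_compose:
  assumes g: "singular_simplex p (top_of_set (C :: 'b::topological_space set)) g"
    and c: "\<And>i. continuous_on K (\<lambda>x. c x i)" "\<And>x. x \<in> K \<Longrightarrow> c x \<in> standard_simplex p"
  shows "continuous_on K (g \<circ> c)" "(g \<circ> c) ` K \<subseteq> C"
proof -
  have "continuous_map (top_of_set K) (subtopology (powertop_real UNIV) (standard_simplex p)) c"
    using c by (auto simp: continuous_map_in_subtopology continuous_map_componentwise_UNIV)
  then have "continuous_map (top_of_set K) (top_of_set C) (g \<circ> c)"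
    using g continuous_map_compose unfolding singular_simplex_def by blast
  then show "continuous_on K (g \<circ> c)" "(g \<circ> c) ` K \<subseteq> C"
    by (auto simp: continuous_map_in_subtopology)
qed

text \<open>Singular simplices need not be differentiable, so the integral is the increment of a
  primitive along the edge; \<open>primitive_along_unique\<close> makes it independent of the
  primitive.\<close>

definition simplex_integral :: "param \<Rightarrow> (point \<Rightarrow> complex) \<Rightarrow> ((nat \<Rightarrow> real) \<Rightarrow> point) \<Rightarrow> complex" where
  "simplex_integral u f \<sigma> = (THE w. \<exists>\<Phi>. primitive_along u f {0..1} (\<sigma> \<circ> edge) \<Phi> \<and> w = \<Phi> 1 - \<Phi> 0)"

lemma simplex_integral_eq:
  assumes "primitive_along u f {0..1} (\<sigma> \<circ> edge) \<Phi>"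
  shows "simplex_integral u f \<sigma> = \<Phi> 1 - \<Phi> 0"
  unfolding simplex_integral_def
proof (rule the_equality)
  fix w assume "\<exists>\<Phi>. primitive_along u f {0..1} (\<sigma> \<circ> edge) \<Phi> \<and> w = \<Phi> 1 - \<Phi> 0"
  then obtain \<Psi> where \<Psi>: "primitive_along u f {0..1} (\<sigma> \<circ> edge) \<Psi>" "w = \<Psi> 1 - \<Psi> 0" by blast
  have "\<Phi> 1 - \<Psi> 1 = \<Phi> 0 - \<Psi> 0"
    by (rule primitive_along_unique[OF assms \<Psi>(1)]) auto
  then have "\<Phi> 1 = \<Phi> 0 - \<Psi> 0 + \<Psi> 1" by (simp only: diff_eq_eq)
  then show "w = \<Phi> 1 - \<Phi> 0" using \<Psi>(2) by simp
qed (use assms in blast)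

lemma primitive_along_cong:
  assumes "primitive_along u f K \<sigma> \<Phi>" "\<And>x. x \<in> K \<Longrightarrow> \<sigma> x = \<tau> x"
  shows "primitive_along u f K \<tau> \<Phi>"
  using assms unfolding primitive_along_def
proof (elim conjE, intro conjI ballI)
  fix k
  assume k: "k \<in> K" and *: "\<forall>k\<in>K. \<exists>G W. local_primitive u f (\<sigma> k) G W \<and>
      (\<exists>r>0. \<exists>c. \<forall>x\<in>K \<inter> ball k r. \<sigma> x \<in> W \<and> \<Phi> x = G (\<sigma> x) + c)"
    and eq: "\<And>x. x \<in> K \<Longrightarrow> \<sigma> x = \<tau> x"
  obtain G W r c where G: "local_primitive u f (\<sigma> k) G W" "r > 0"
      "\<forall>x\<in>K \<inter> ball k r. \<sigma> x \<in> W \<and> \<Phi> x = G (\<sigma> x) + c"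
    using * k by blast
  have "\<forall>x\<in>K \<inter> ball k r. \<tau> x \<in> W \<and> \<Phi> x = G (\<tau> x) + c" using G(3) eq by simp
  then show "\<exists>G W. local_primitive u f (\<tau> k) G W \<and>
      (\<exists>r>0. \<exists>c. \<forall>x\<in>K \<inter> ball k r. \<tau> x \<in> W \<and> \<Phi> x = G (\<tau> x) + c)"
    using G(1,2) unfolding eq[OF k, symmetric] by blast
qed (auto cong: continuous_on_cong)

definition chain_integral :: "param \<Rightarrow> (point \<Rightarrow> complex) \<Rightarrow> point chain \<Rightarrow> complex" where
  "chain_integral u f c = (\<Sum>\<sigma> \<in> Poly_Mapping.keys c. of_int (Poly_Mapping.lookup c \<sigma>) * simplex_integral u f \<sigma>)"

lemma chain_integral_superset:
  assumes "finite S" "Poly_Mapping.keys c \<subseteq> S"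
  shows "chain_integral u f c = (\<Sum>\<sigma> \<in> S. of_int (Poly_Mapping.lookup c \<sigma>) * simplex_integral u f \<sigma>)"
  unfolding chain_integral_def
  by (rule sum.mono_neutral_left) (use assms in \<open>auto simp: in_keys_iff\<close>)

lemma chain_integral_0 [simp]: "chain_integral u f 0 = 0"
  by (simp add: chain_integral_def)

lemma chain_integral_diff: "chain_integral u f (a - b) = chain_integral u f a - chain_integral u f b"
proof -
  let ?S = "Poly_Mapping.keys a \<union> Poly_Mapping.keys b"
  have "Poly_Mapping.keys (a - b) \<subseteq> ?S" by (rule keys_diff)
  then show ?thesis
    by (simp add: chain_integral_superset[of ?S] lookup_minus sum_subtractf left_diff_distrib)
qed

lemma chain_integral_of [simp]: "chain_integral u f (frag_of \<sigma>) = simplex_integral u f \<sigma>"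
  by (simp add: chain_integral_def)

text \<open>The triangle is compact and convex, so one primitive exists on all of it and restricts
  to the three edges. The alternating sum of its increments between the corners is zero.\<close>

lemma chain_integral_boundary_simplex:
  assumes loc: "\<And>z. z \<in> curve u \<Longrightarrow> \<exists>G W. local_primitive u f z G W"
    and g: "singular_simplex 2 (top_of_set (curve u)) g"
  shows "chain_integral u f (chain_boundary 2 (frag_of g)) = 0"
proof -
  note tri = singular_simplex_compose[OF g, of triangle_dom triangle, OF continuous_on_triangle triangle_in_simplex]
  have "\<exists>G W. local_primitive u f ((g \<circ> triangle) k) G W" if "k \<in> triangle_dom" for k
    by (rule loc) (use tri(2) that in blast)
  then obtain \<Phi> where \<Phi>: "primitive_along u f triangle_dom (g \<circ> triangle) \<Phi>"
    using primitive_along_exists[OF compact_triangle_dom convex_triangle_dom tri] by blast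
  have face: "simplex_integral u f (singular_face 2 k g) = \<Phi> (l 1) - \<Phi> (l 0)"
    if l: "continuous_on {0..1} l" "l ` {0..1} \<subseteq> triangle_dom"
      "\<And>s. s \<in> {0..1} \<Longrightarrow> simplical_face k (edge s) = triangle (l s)" for k and l :: "real \<Rightarrow> real \<times> real"
  proof -
    have "primitive_along u f {0..1} ((g \<circ> triangle) \<circ> l) (\<Phi> \<circ> l)"
      by (rule primitive_along_compose[OF \<Phi> l(1,2)])
    then have "primitive_along u f {0..1} (singular_face 2 k g \<circ> edge) (\<Phi> \<circ> l)"
      by (rule primitive_along_cong) (use l(3) edge_in_simplex in \<open>auto simp: singular_face_def\<close>)
    from simplex_integral_eq[OF this] show ?thesis by simp
  qed
  have 0: "simplex_integral u f (singular_face 2 0 g) = \<Phi> (0, 1) - \<Phi> (1, 0)"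
  proof -
    have "simplical_face 0 (edge s) = triangle (1 - s, s)" if "s \<in> {0..1}" for s
      by (auto simp: triangle_def edge_def simplical_face_def fun_eq_iff)
    moreover have "continuous_on {0..1} (\<lambda>s::real. (1 - s, s))" by (intro continuous_intros)
    moreover have "(\<lambda>s::real. (1 - s, s)) ` {0..1} \<subseteq> triangle_dom" by (auto simp: triangle_dom_def)
    ultimately show ?thesis using face[of "\<lambda>s. (1 - s, s)" 0] by simp
  qed
  have 1: "simplex_integral u f (singular_face 2 1 g) = \<Phi> (0, 1) - \<Phi> (0, 0)"
  proof -
    have "simplical_face 1 (edge s) = triangle (0, s)" if "s \<in> {0..1}" for s
      by (auto simp: triangle_def edge_def simplical_face_def fun_eq_iff)
    moreover have "continuous_on {0..1} (\<lambda>s::real. (0, s))" by (intro continuous_intros)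
    moreover have "(\<lambda>s::real. (0, s)) ` {0..1} \<subseteq> triangle_dom" by (auto simp: triangle_dom_def)
    ultimately show ?thesis using face[of "\<lambda>s. (0, s)" 1] by simp
  qed
  have 2: "simplex_integral u f (singular_face 2 2 g) = \<Phi> (1, 0) - \<Phi> (0, 0)"
  proof -
    have "simplical_face 2 (edge s) = triangle (s, 0)" if "s \<in> {0..1}" for s
      by (auto simp: triangle_def edge_def simplical_face_def fun_eq_iff)
    moreover have "continuous_on {0..1} (\<lambda>s::real. (s, 0))" by (intro continuous_intros)
    moreover have "(\<lambda>s::real. (s, 0)) ` {0..1} \<subseteq> triangle_dom" by (auto simp: triangle_dom_def)
    ultimately show ?thesis using face[of "\<lambda>s. (s, 0)" 2] by simp
  qed
  have "chain_boundary 2 (frag_of g) = frag_of (singular_face 2 0 g) - frag_of (singular_face 2 1 g)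
      - (0 - frag_of (singular_face 2 2 g))"
    by (simp add: chain_boundary_of numeral_2_eq_2)
  then show ?thesis
    by (simp only: chain_integral_diff chain_integral_of chain_integral_0 0 1 2) simp
qed

lemma chain_integral_boundary:
  assumes loc: "\<And>z. z \<in> curve u \<Longrightarrow> \<exists>G W. local_primitive u f z G W"
    and d: "singular_chain 2 (top_of_set (curve u)) d"
  shows "chain_integral u f (chain_boundary 2 d) = 0"
proof (rule frag_induction[of d "singular_simplex_set 2 (top_of_set (curve u))"])
  show "Poly_Mapping.keys d \<subseteq> singular_simplex_set 2 (top_of_set (curve u))"
    using d by (simp add: singular_chain_def)
qed (auto simp: chain_integral_boundary_simplex[OF loc] chain_boundary_diff chain_integral_diff)

text \<open>Primitives are required at every point, turning points included: the loops avoid these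
  points, but the 2-chain between two homologous loops may cover them.\<close>

theorem loop_integral_homology_invariant:
  assumes loc: "\<And>z. z \<in> curve u \<Longrightarrow> \<exists>G W. local_primitive u f z G W"
    and p: "regular_loop u p" and q: "regular_loop u q" and eq: "loop_class u p = loop_class u q"
  shows "loop_integral f p = loop_integral f q"
proof -
  let ?s = "\<lambda>p. restrict (\<lambda>t. p (t 1)) (standard_simplex 1) :: (nat \<Rightarrow> real) \<Rightarrow> point"
  have *: "simplex_integral u f (?s p) = loop_integral f p" if p: "regular_loop u p" for p
  proof -
    have "continuous_on {0..1} p" "p ` {0..1} \<subseteq> curve u"
      using p valid_path_imp_path unfolding regular_loop_def path_def path_image_def by auto
    then obtain \<Phi> where \<Phi>: "primitive_along u f {0..1} p \<Phi>"
      using primitive_along_exists[of "{0..1::real}" p u f] loc by (auto simp: image_subset_iff)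
    have "primitive_along u f {0..1} (?s p \<circ> edge) \<Phi>"
      by (rule primitive_along_cong[OF \<Phi>]) (use edge_in_simplex in \<open>auto simp: edge_def\<close>)
    then show ?thesis
      using simplex_integral_eq[of u f "?s p" \<Phi>] has_loop_integral_imp_eq[OF primitive_along_has_loop_integral[OF p \<Phi>]] by simp
  qed
  have "homologous_rel 1 (top_of_set (curve u)) {} (frag_of (?s p)) (frag_of (?s q))"
    using eq by (simp add: loop_class_def homologous_rel_set_eq)
  then obtain d where d: "singular_chain 2 (top_of_set (curve u)) d"
      "chain_boundary 2 d = frag_of (?s p) - frag_of (?s q)"
    by (auto simp: homologous_rel_def singular_relboundary_def numeral_2_eq_2 mod_subset_def singular_chain_empty)
  have "chain_integral u f (frag_of (?s p) - frag_of (?s q)) = 0"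
    using chain_integral_boundary[OF loc d(1)] d(2) by simp
  then show ?thesis by (simp only: chain_integral_diff chain_integral_of * p q) simp
qed

section \<open>Reduction to elliptic integrals\<close>

text \<open>Laurent polynomials in \<open>y\<close> over \<open>\<complex>[a, b, x]\<close>, odd or even under \<open>y \<mapsto> - y\<close>; only their values
  at \<open>y \<noteq> 0\<close> matter.\<close>

inductive laurent :: "bool \<Rightarrow> (param \<Rightarrow> point \<Rightarrow> complex) \<Rightarrow> bool" where
  monomial: "laurent (odd l) (\<lambda>u z. c * fst u ^ i * snd u ^ j * fst z ^ k * snd z powi l)"
| add: "laurent p f \<Longrightarrow> laurent p g \<Longrightarrow> laurent p (\<lambda>u z. f u z + g u z)"
| cong: "laurent p f \<Longrightarrow> (\<And>u z. snd z \<noteq> 0 \<Longrightarrow> f u z = g u z) \<Longrightarrow> laurent p g"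

lemma laurent_zero: "laurent p (\<lambda>u z. 0)"
  using laurent.monomial[of 1 0 0 0 0] laurent.monomial[of 0 0 0 0 0] by (cases p) simp_all

lemma laurent_sum: "(\<And>i. i \<in> A \<Longrightarrow> laurent p (f i)) \<Longrightarrow> laurent p (\<lambda>u z. \<Sum>i\<in>A. f i u z)"
  by (induction A rule: infinite_finite_induct) (auto intro: laurent_zero laurent.add)

lemma laurent_mult_monomial:
  "laurent p f \<Longrightarrow> laurent (odd l \<noteq> p) (\<lambda>u z. c * fst u ^ i * snd u ^ j * fst z ^ k * snd z powi l * f u z)"
proof (induction rule: laurent.induct)
  case (monomial l' c' i' j' k')
  have "odd (l + l') = (odd l \<noteq> odd l')" by auto
  then show ?case
    using laurent.cong[OF laurent.monomial[of "l + l'" "c * c'" "i + i'" "j + j'" "k + k'"]]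
    by (simp add: power_add power_int_add mult_ac)
next
  case (add p f g)
  show ?case by (rule laurent.cong[OF laurent.add[OF add.IH]]) (simp add: algebra_simps)
next
  case (cong p f g)
  show ?case by (rule laurent.cong[OF cong.IH]) (simp add: cong)
qed

lemma laurent_mult: "laurent p f \<Longrightarrow> laurent q g \<Longrightarrow> laurent (p \<noteq> q) (\<lambda>u z. f u z * g u z)"
proof (induction rule: laurent.induct)
  case (monomial l c i j k)
  then show ?case by (rule laurent_mult_monomial)
next
  case (add p f h)
  have "laurent (p \<noteq> q) (\<lambda>u z. f u z * g u z + h u z * g u z)"
    by (rule laurent.add) (use add in auto)
  then show ?case by (simp add: distrib_right)
next
  case (cong p f h)
  show ?case by (rule laurent.cong[OF cong.IH[OF cong.prems]]) (simp add: cong)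
qed

lemma laurent_y_power: "laurent (odd l) (\<lambda>u z. snd z powi l)"
  using laurent.monomial[of l 1 0 0 0] by simp

text \<open>\<open>curve_deriv\<close> treats x and y as independent variables. Differentiation in y
  lowers the exponent by one, which flips the parity.\<close>

lemma laurent_partial_xy:
  assumes "laurent p f"
  shows "\<exists>fx fy. laurent p fx \<and> laurent (\<not> p) fy \<and> (\<forall>u x y. y \<noteq> 0 \<longrightarrow>
     ((\<lambda>x. f u (x, y)) has_field_derivative fx u (x, y)) (at x) \<and>
     ((\<lambda>y. f u (x, y)) has_field_derivative fy u (x, y)) (at y))"
  using assms
proof (induction rule: laurent.induct)
  case (monomial l c i j k)
  define fx where "fx = (\<lambda>(u::param) (z::point). (of_nat k * c) * fst u ^ i * snd u ^ j * fst z ^ (k - 1) * snd z powi l)"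
  define fy where "fy = (\<lambda>(u::param) (z::point). (of_int l * c) * fst u ^ i * snd u ^ j * fst z ^ k * snd z powi (l - 1))"
  have "laurent (odd l) fx" "laurent (\<not> odd l) fy"
    using laurent.monomial[of l "of_nat k * c" i j "k - 1"] laurent.monomial[of "l - 1" "of_int l * c" i j k]
    by (simp_all add: fx_def fy_def)
  moreover have "((\<lambda>x. c * fst u ^ i * snd u ^ j * fst (x, y) ^ k * snd (x, y) powi l) has_field_derivative fx u (x, y)) (at x) \<and>
     ((\<lambda>y. c * fst u ^ i * snd u ^ j * fst (x, y) ^ k * snd (x, y) powi l) has_field_derivative fy u (x, y)) (at y)"
    if "y \<noteq> 0" for u x y
    using that unfolding fx_def fy_def by (auto intro!: derivative_eq_intros simp: mult_ac)
  ultimately show ?case by blast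
next
  case (add p f g)
  obtain fx fy where f: "laurent p fx" "laurent (\<not> p) fy" "\<forall>u x y. y \<noteq> 0 \<longrightarrow>
     ((\<lambda>x. f u (x, y)) has_field_derivative fx u (x, y)) (at x) \<and>
     ((\<lambda>y. f u (x, y)) has_field_derivative fy u (x, y)) (at y)" using add.IH(1) by blast
  obtain gx gy where g: "laurent p gx" "laurent (\<not> p) gy" "\<forall>u x y. y \<noteq> 0 \<longrightarrow>
     ((\<lambda>x. g u (x, y)) has_field_derivative gx u (x, y)) (at x) \<and>
     ((\<lambda>y. g u (x, y)) has_field_derivative gy u (x, y)) (at y)" using add.IH(2) by blast
  show ?case
    by (rule exI[of _ "\<lambda>u z. fx u z + gx u z"], rule exI[of _ "\<lambda>u z. fy u z + gy u z"])
      (use f g in \<open>auto intro: laurent.add DERIV_add\<close>)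
next
  case (cong p f g)
  obtain fx fy where f: "laurent p fx" "laurent (\<not> p) fy" "\<And>u x y. y \<noteq> 0 \<Longrightarrow>
     ((\<lambda>x. f u (x, y)) has_field_derivative fx u (x, y)) (at x) \<and>
     ((\<lambda>y. f u (x, y)) has_field_derivative fy u (x, y)) (at y)" using cong.IH by blast
  have "((\<lambda>x. g u (x, y)) has_field_derivative fx u (x, y)) (at x)"
    "((\<lambda>y. g u (x, y)) has_field_derivative fy u (x, y)) (at y)" if y: "y \<noteq> 0" for u x y
  proof -
    show "((\<lambda>x. g u (x, y)) has_field_derivative fx u (x, y)) (at x)"
      using f(3)[OF y, of u x] cong.hyps(2)[of "(_, y)" u] y by simp
    show "((\<lambda>y. g u (x, y)) has_field_derivative fy u (x, y)) (at y)"
      by (rule has_field_derivative_transform_within_open[OF conjunct2[OF f(3)[OF y]], of "- {0}"])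
        (use y cong.hyps(2) in auto)
  qed
  with f show ?case by blast
qed

text \<open>The derivatives in \<open>a\<close> and \<open>b\<close> along a branch of \<open>y\<close> over a fixed \<open>x\<close>.\<close>

definition has_param_derivs ::
    "(param \<Rightarrow> point \<Rightarrow> complex) \<Rightarrow> (param \<Rightarrow> point \<Rightarrow> complex) \<Rightarrow> (param \<Rightarrow> point \<Rightarrow> complex) \<Rightarrow> bool" where
  "has_param_derivs f A B \<longleftrightarrow>
     (\<forall>a b x S. (S has_field_derivative x / (2 * S a)) (at a) \<longrightarrow> S a \<noteq> 0 \<longrightarrow>
        ((\<lambda>a. f (a, b) (x, S a)) has_field_derivative A (a, b) (x, S a)) (at a)) \<and>
     (\<forall>a b x S. (S has_field_derivative 1 / (2 * S b)) (at b) \<longrightarrow> S b \<noteq> 0 \<longrightarrow>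
        ((\<lambda>b. f (a, b) (x, S b)) has_field_derivative B (a, b) (x, S b)) (at b))"

lemma has_param_derivsD:
  assumes "has_param_derivs f A B"
  shows "(S has_field_derivative x / (2 * S a)) (at a) \<Longrightarrow> S a \<noteq> 0 \<Longrightarrow>
        ((\<lambda>a. f (a, b) (x, S a)) has_field_derivative A (a, b) (x, S a)) (at a)"
    and "(S has_field_derivative 1 / (2 * S b)) (at b) \<Longrightarrow> S b \<noteq> 0 \<Longrightarrow>
        ((\<lambda>b. f (a, b) (x, S b)) has_field_derivative B (a, b) (x, S b)) (at b)"
  using assms unfolding has_param_derivs_def by simp_all

text \<open>Differentiating a power of y in a or b brings down x / (2 y^2) or 1 / (2 y^2). The
  exponent drops by two, so an odd function stays odd and the derivative of a period is again an
  integral of the same kind.\<close>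

lemma laurent_param_deriv:
  assumes "laurent p f"
  shows "\<exists>A B. laurent p A \<and> laurent p B \<and> has_param_derivs f A B"
  using assms
proof (induction rule: laurent.induct)
  case (monomial l c i j k)
  define A where "A = (\<lambda>(u::param) (z::point). (of_nat i * c) * fst u ^ (i - 1) * snd u ^ j * fst z ^ k * snd z powi l
     + (of_int l * c / 2) * fst u ^ i * snd u ^ j * fst z ^ Suc k * snd z powi (l - 2))"
  define B where "B = (\<lambda>(u::param) (z::point). (of_nat j * c) * fst u ^ i * snd u ^ (j - 1) * fst z ^ k * snd z powi l
     + (of_int l * c / 2) * fst u ^ i * snd u ^ j * fst z ^ k * snd z powi (l - 2))"
  have odd2: "odd (l - 2) = odd l" by simp
  have "laurent (odd l) A" "laurent (odd l) B"
    unfolding A_def B_def by (intro laurent.add laurent.monomial laurent.monomial[of "l - 2", unfolded odd2])+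
  moreover have "((\<lambda>a. c * fst (a, b) ^ i * snd (a, b) ^ j * fst (x, S a) ^ k * snd (x, S a) powi l) has_field_derivative A (a, b) (x, S a)) (at a)"
    if S: "(S has_field_derivative x / (2 * S a)) (at a)" "S a \<noteq> 0" for a b x S
  proof -
    have "S a powi (l - 1) = S a powi (l - 2) * S a"
      using S(2) power_int_add[of "S a" "l - 2" 1] by simp
    with S show ?thesis
      unfolding A_def by (auto intro!: derivative_eq_intros simp: field_simps)
  qed
  moreover have "((\<lambda>b. c * fst (a, b) ^ i * snd (a, b) ^ j * fst (x, S b) ^ k * snd (x, S b) powi l) has_field_derivative B (a, b) (x, S b)) (at b)"
    if S: "(S has_field_derivative 1 / (2 * S b)) (at b)" "S b \<noteq> 0" for a b x S
  proof -
    have "S b powi (l - 1) = S b powi (l - 2) * S b"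
      using S(2) power_int_add[of "S b" "l - 2" 1] by simp
    with S show ?thesis
      unfolding B_def by (auto intro!: derivative_eq_intros simp: field_simps)
  qed
  ultimately show ?case
    unfolding has_param_derivs_def by (intro exI[of _ A] exI[of _ B] conjI allI impI)
next
  case (add p f g)
  obtain A B where f: "laurent p A" "laurent p B" "has_param_derivs f A B"
    using add.IH(1) by blast
  obtain A' B' where g: "laurent p A'" "laurent p B'" "has_param_derivs g A' B'"
    using add.IH(2) by blast
  show ?case
    by (rule exI[of _ "\<lambda>u z. A u z + A' u z"], rule exI[of _ "\<lambda>u z. B u z + B' u z"])
      (use f g in \<open>auto simp: has_param_derivs_def intro: laurent.add DERIV_add\<close>)
next
  case (cong p f g)
  obtain A B where f: "laurent p A" "laurent p B" "has_param_derivs f A B"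
    using cong.IH by blast
  \<comment> \<open>The two functions agree only where y is nonzero, and a branch that is nonzero at
    a point remains so nearby.\<close>
  have ev: "eventually (\<lambda>s. S s \<noteq> 0) (nhds t)"
    if "(S has_field_derivative D) (at t)" "S t \<noteq> 0" for S :: "complex \<Rightarrow> complex" and D t
  proof -
    have "(S \<longlongrightarrow> S t) (nhds t)"
      using DERIV_isCont[OF that(1)] unfolding isCont_def by (subst (asm) tendsto_at_iff_tendsto_nhds)
    then show ?thesis using that(2) by (rule tendsto_imp_eventually_ne)
  qed
  have "((\<lambda>a. g (a, b) (x, S a)) has_field_derivative A (a, b) (x, S a)) (at a)"
    if S: "(S has_field_derivative x / (2 * S a)) (at a)" "S a \<noteq> 0" for a b x S
  proof -
    have "eventually (\<lambda>a. f (a, b) (x, S a) = g (a, b) (x, S a)) (nhds a)"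
      using ev[OF S] by (rule eventually_mono) (simp add: cong.hyps(2))
    then show ?thesis
      by (rule iffD1[OF DERIV_cong_ev[OF refl _ refl] has_param_derivsD(1)[OF f(3) S]])
  qed
  moreover have "((\<lambda>b. g (a, b) (x, S b)) has_field_derivative B (a, b) (x, S b)) (at b)"
    if S: "(S has_field_derivative 1 / (2 * S b)) (at b)" "S b \<noteq> 0" for a b x S
  proof -
    have "eventually (\<lambda>b. f (a, b) (x, S b) = g (a, b) (x, S b)) (nhds b)"
      using ev[OF S] by (rule eventually_mono) (simp add: cong.hyps(2))
    then show ?thesis
      by (rule iffD1[OF DERIV_cong_ev[OF refl _ refl] has_param_derivsD(2)[OF f(3) S]])
  qed
  ultimately have "has_param_derivs g A B" unfolding has_param_derivs_def by (intro conjI allI impI)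
  then show ?case using f(1,2) by blast
qed

lemma laurent_continuous:
  "laurent p f \<Longrightarrow> continuous_on {q. snd (snd q) \<noteq> 0} (\<lambda>q. f (fst q) (snd q))"
proof (induction rule: laurent.induct)
  case (monomial l c i j k)
  show ?case by (intro continuous_intros) auto
next
  case (add p f g)
  then show ?case by (intro continuous_intros)
next
  case (cong p f g)
  show ?case by (rule continuous_on_eq[OF cong.IH]) (use cong in auto)
qed

lemma laurent_curve_deriv:
  assumes "laurent p f"
  shows "laurent p (\<lambda>u. curve_deriv u (f u))"
proof -
  obtain fx fy where f: "laurent p fx" "laurent (\<not> p) fy" "\<And>u x y. y \<noteq> 0 \<Longrightarrow>
     ((\<lambda>x. f u (x, y)) has_field_derivative fx u (x, y)) (at x) \<and>
     ((\<lambda>y. f u (x, y)) has_field_derivative fy u (x, y)) (at y)"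
    using laurent_partial_xy[OF assms] by blast
  have odd: "(odd (- 1 :: int) \<noteq> (\<not> p)) = p" by simp
  \<comment> \<open>The two summands of dy/dx = (3 x^2 + a) / (2 y), each multiplied by the
    derivative in y; the factor 1 / y restores the parity.\<close>
  note 1 = laurent_mult_monomial[OF f(2), of "-1" "3/2" 0 0 2, unfolded odd]
  note 2 = laurent_mult_monomial[OF f(2), of "-1" "1/2" 1 0 0, unfolded odd]
  show ?thesis
  proof (rule laurent.cong[OF laurent.add[OF f(1) laurent.add[OF 1 2]]])
    fix u :: param and z :: point assume "snd z \<noteq> 0"
    then have "deriv (\<lambda>x. f u (x, snd z)) (fst z) = fx u z" "deriv (\<lambda>y. f u (fst z, y)) (snd z) = fy u z"
      using f(3)[of "snd z" u "fst z"] by (auto intro: DERIV_imp_deriv)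
    then show "fx u z + ((3/2) * fst u ^ 0 * snd u ^ 0 * fst z ^ 2 * snd z powi (-1) * fy u z
        + (1/2) * fst u ^ 1 * snd u ^ 0 * fst z ^ 0 * snd z powi (-1) * fy u z) = curve_deriv u (f u) z"
      using \<open>snd z \<noteq> 0\<close> by (simp add: curve_deriv_def field_simps)
  qed
qed

text \<open>The flag \<open>True\<close> means odd in y, so the coefficients with even index are the
  odd ones. They start with y; the curve derivative preserves parity, and division by 2 y flips it
  at each step of the recursion.\<close>

lemma laurent_riccati_coeff: "laurent (even n) (\<lambda>u. riccati_coeff u n)"
proof (induction n rule: less_induct)
  case (less n)
  show ?case
  proof (cases n)
    case 0
    then show ?thesis using laurent_y_power[of 1] by simp
  next
    case (Suc m)
    define R where "R = (\<lambda>u z. curve_deriv u (riccati_coeff u m) z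
        + (\<Sum>j = 1..m. riccati_coeff u j z * riccati_coeff u (Suc m - j) z))"
    have "laurent (even m) (\<lambda>u z. riccati_coeff u j z * riccati_coeff u (Suc m - j) z)" if "j \<in> {1..m}" for j
    proof -
      have "(even j \<noteq> even (Suc m - j)) = even m" using that by auto
      then show ?thesis
        using laurent_mult[OF less.IH[of j] less.IH[of "Suc m - j"]] that Suc by (simp del: riccati_coeff.simps)
    qed
    moreover have "laurent (even m) (\<lambda>u. curve_deriv u (riccati_coeff u m))"
      using Suc by (intro laurent_curve_deriv less.IH) auto
    ultimately have "laurent (even m) R"
      unfolding R_def by (intro laurent.add laurent_sum)
    from laurent_mult_monomial[OF this, of "-1" "-1/2" 0 0 0]
    have "laurent (odd m) (\<lambda>u z. (-1/2) * snd z powi (-1) * R u z)" by simp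
    then have "laurent (odd m) (\<lambda>u. riccati_coeff u (Suc m))"
      by (rule laurent.cong) (simp add: R_def field_simps)
    then show ?thesis using Suc by (simp del: riccati_coeff.simps)
  qed
qed

section \<open>Reduction modulo exact forms\<close>

lemma poly2_simps [simp]:
  "poly2 (p + q) u = poly2 p u + poly2 q u"
  "poly2 (p * q) u = poly2 p u * poly2 q u"
  "poly2 (p ^ n) u = poly2 p u ^ n"
  "poly2 0 u = 0" "poly2 1 u = 1"
  by (simp_all add: poly2_def)

lemma poly2_generators:
  "poly2 [:[:c:]:] u = c" "poly2 [:[:0, 1:]:] u = fst u" "poly2 [:0, 1:] u = snd u"
  "poly2 [:[:0, 0, 0, 4:], 0, [:27:]:] u = discr u"
  by (simp_all add: poly2_def discr_def power2_eq_square power3_eq_cube)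

text \<open>Cohomology is expressed through integrals over all regular loops. The exponent and the
  polynomials are chosen before the parameter and the loop, which makes the coefficients rational
  functions with denominator a power of the discriminant.\<close>

definition reducible :: "(param \<Rightarrow> point \<Rightarrow> complex) \<Rightarrow> bool" where
  "reducible f \<longleftrightarrow> (\<exists>m p q. \<forall>u \<gamma>. discr u \<noteq> 0 \<longrightarrow> regular_loop u \<gamma> \<longrightarrow>
     has_loop_integral (f u)
       ((poly2 p u * loop_integral (\<lambda>z. 1 / snd z) \<gamma>
         + poly2 q u * loop_integral (\<lambda>z. fst z / snd z) \<gamma>) / discr u ^ m) \<gamma>)"

lemma has_loop_integral_cong:
  assumes "has_loop_integral f I p" "regular_loop u p"
    and "\<And>z. z \<in> curve u \<Longrightarrow> snd z \<noteq> 0 \<Longrightarrow> f z = g z"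
  shows "has_loop_integral g I p"
proof -
  have "f (p t) = g (p t)" if "t \<in> {0..1}" for t
    using assms(2,3) that unfolding regular_loop_def path_image_def by blast
  then show ?thesis
    using assms(1) unfolding has_loop_integral_def
    by (subst has_integral_cong[of _ _ "\<lambda>t. f (p t) * vector_derivative (fst \<circ> p) (at t within {0..1})"]) auto
qed

lemma has_loop_integral_add:
  "has_loop_integral f I p \<Longrightarrow> has_loop_integral g J p \<Longrightarrow> has_loop_integral (\<lambda>z. f z + g z) (I + J) p"
  unfolding has_loop_integral_def by (drule (1) has_integral_add) (simp add: distrib_right)

lemma has_loop_integral_cmult:
  "has_loop_integral f I p \<Longrightarrow> has_loop_integral (\<lambda>z. c * f z) (c * I) p"
  unfolding has_loop_integral_def by (drule has_integral_mult_right[of _ _ _ c]) (simp add: mult.assoc)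

lemma has_loop_integral_holomorphic_over_y:
  assumes "discr u \<noteq> 0" "regular_loop u p" "h holomorphic_on UNIV"
  shows "has_loop_integral (\<lambda>w. h (fst w) / snd w) (loop_integral (\<lambda>w. h (fst w) / snd w) p) p"
proof -
  have p: "continuous_on {0..1} p" "p ` {0..1} \<subseteq> curve u"
    using assms(2) valid_path_imp_path unfolding regular_loop_def path_def path_image_def by auto
  have "\<exists>G W. local_primitive u (\<lambda>w. h (fst w) / snd w) (p k) G W" if "k \<in> {0..1}" for k
    by (rule local_primitive_holomorphic_over_y[OF assms(1) _ assms(3)]) (use p(2) that in blast)
  then obtain \<Phi> where "primitive_along u (\<lambda>w. h (fst w) / snd w) {0..1} p \<Phi>"
    using primitive_along_exists[OF _ _ p, of "\<lambda>w. h (fst w) / snd w"] by auto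
  from primitive_along_has_loop_integral[OF assms(2) this]
  show ?thesis using has_loop_integral_imp_eq by fastforce
qed

text \<open>The integrand is d(x^k y^l)/dx on the curve, with dy/dx = (3 x^2 + a) / (2 y); its
  primitive is single-valued along the loop.\<close>

lemma has_loop_integral_exact:
  assumes p: "regular_loop u p"
  shows "has_loop_integral (\<lambda>z. of_nat k * fst z ^ (k - 1) * snd z powi l
      + of_int l / 2 * fst z ^ k * snd z powi (l - 2) * (3 * fst z ^ 2 + fst u)) 0 p"
proof -
  let ?f = "\<lambda>z. of_nat k * fst z ^ (k - 1) * snd z powi l
      + of_int l / 2 * fst z ^ k * snd z powi (l - 2) * (3 * fst z ^ 2 + fst u)"
  define G where "G = (\<lambda>z :: point. fst z ^ k * snd z powi l)"
  define W where "W = {w :: point. snd w \<noteq> 0}"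
  have pc: "continuous_on {0..1} p" "p ` {0..1} \<subseteq> curve u" "p ` {0..1} \<subseteq> W"
    using p valid_path_imp_path unfolding regular_loop_def path_def path_image_def W_def by auto
  have D: "has_curve_derivative u G (?f w) w" if w: "w \<in> curve u" "snd w \<noteq> 0" for w
  proof -
    have y: "branch u w (fst w) = snd w" using w by (rule branch_center)
    have "snd w powi (l - 1) = snd w powi (l - 2) * snd w"
      using w(2) power_int_add[of "snd w" "l - 2" 1] by simp
    moreover have "(branch u w has_field_derivative (3 * fst w ^ 2 + fst u) / (2 * snd w)) (at (fst w))"
      using branch_deriv_x[OF center_in_branch_dom[OF w]] by (simp add: y)
    ultimately show ?thesis
      unfolding has_curve_derivative_def G_def fst_conv snd_conv
      using w(2) y by (auto intro!: derivative_eq_intros simp: field_simps)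
  qed
  have "open W" unfolding W_def by (intro open_Collect_neq continuous_intros)
  moreover have "continuous_on W G" unfolding G_def W_def by (intro continuous_intros) auto
  ultimately have "local_primitive u ?f (p t) G W" if "t \<in> {0..1}" for t
    unfolding local_primitive_def using D pc(3) that by (auto intro: continuous_on_subset)
  moreover have "(1::real) > 0 \<and> (\<forall>x \<in> {0..1} \<inter> ball k 1. p x \<in> W \<and> G (p x) = G (p x) + 0)" for k
    using pc(3) by auto
  ultimately have "primitive_along u ?f {0..1} p (\<lambda>t. G (p t))"
    unfolding primitive_along_def using pc(1,2) by blast
  from primitive_along_has_loop_integral[OF p this]
  show ?thesis using p by (simp add: regular_loop_def pathfinish_def pathstart_def)
qed

lemma reducible_cong:
  assumes "reducible f" "\<And>u z. discr u \<noteq> 0 \<Longrightarrow> z \<in> curve u \<Longrightarrow> snd z \<noteq> 0 \<Longrightarrow> f u z = g u z"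
  shows "reducible g"
  using assms has_loop_integral_cong unfolding reducible_def by (metis (no_types, lifting))

lemma reducible_add:
  assumes "reducible f" "reducible g"
  shows "reducible (\<lambda>u z. f u z + g u z)"
proof -
  let ?D = "[:[:0, 0, 0, 4:], 0, [:27:]:] :: complex poly poly"
  obtain m p q where f: "\<And>u \<gamma>. discr u \<noteq> 0 \<Longrightarrow> regular_loop u \<gamma> \<Longrightarrow>
     has_loop_integral (f u) ((poly2 p u * loop_integral (\<lambda>z. 1 / snd z) \<gamma>
         + poly2 q u * loop_integral (\<lambda>z. fst z / snd z) \<gamma>) / discr u ^ m) \<gamma>"
    using assms(1) unfolding reducible_def by blast
  obtain m' p' q' where g: "\<And>u \<gamma>. discr u \<noteq> 0 \<Longrightarrow> regular_loop u \<gamma> \<Longrightarrow>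
     has_loop_integral (g u) ((poly2 p' u * loop_integral (\<lambda>z. 1 / snd z) \<gamma>
         + poly2 q' u * loop_integral (\<lambda>z. fst z / snd z) \<gamma>) / discr u ^ m') \<gamma>"
    using assms(2) unfolding reducible_def by blast
  show ?thesis
    unfolding reducible_def
  proof (rule exI[of _ "m + m'"], rule exI[of _ "p * ?D ^ m' + p' * ?D ^ m"],
      rule exI[of _ "q * ?D ^ m' + q' * ?D ^ m"], intro allI impI)
    fix u \<gamma> assume u: "discr u \<noteq> 0" and "regular_loop u \<gamma>"
    note h = has_loop_integral_add[OF f[OF this] g[OF this]]
    have eq: "(P * X + Q * Y) / d ^ m + (P' * X + Q' * Y) / d ^ m'
      = ((P * d ^ m' + P' * d ^ m) * X + (Q * d ^ m' + Q' * d ^ m) * Y) / d ^ (m + m')"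
      if "d \<noteq> 0" for P Q P' Q' X Y d :: complex
      using that by (simp add: power_add divide_simps) (simp add: algebra_simps)
    show "has_loop_integral (\<lambda>z. f u z + g u z)
      ((poly2 (p * ?D ^ m' + p' * ?D ^ m) u * loop_integral (\<lambda>z. 1 / snd z) \<gamma>
         + poly2 (q * ?D ^ m' + q' * ?D ^ m) u * loop_integral (\<lambda>z. fst z / snd z) \<gamma>) / discr u ^ (m + m')) \<gamma>"
      using h by (simp only: poly2_simps poly2_generators eq[OF u])
  qed
qed

lemma reducible_scale:
  assumes "reducible f"
  shows "reducible (\<lambda>u z. poly2 c u * f u z)"
proof -
  obtain m p q where f: "\<And>u \<gamma>. discr u \<noteq> 0 \<Longrightarrow> regular_loop u \<gamma> \<Longrightarrow>
     has_loop_integral (f u) ((poly2 p u * loop_integral (\<lambda>z. 1 / snd z) \<gamma>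
         + poly2 q u * loop_integral (\<lambda>z. fst z / snd z) \<gamma>) / discr u ^ m) \<gamma>"
    using assms(1) unfolding reducible_def by blast
  show ?thesis
    unfolding reducible_def
  proof (rule exI[of _ m], rule exI[of _ "c * p"], rule exI[of _ "c * q"], intro allI impI)
    fix u \<gamma> assume "discr u \<noteq> 0" "regular_loop u \<gamma>"
    from has_loop_integral_cmult[OF f[OF this], of "poly2 c u"]
    show "has_loop_integral (\<lambda>z. poly2 c u * f u z) ((poly2 (c * p) u * loop_integral (\<lambda>z. 1 / snd z) \<gamma>
         + poly2 (c * q) u * loop_integral (\<lambda>z. fst z / snd z) \<gamma>) / discr u ^ m) \<gamma>"
      by (simp add: algebra_simps)
  qed
qed

lemma reducible_const: "reducible f \<Longrightarrow> reducible (\<lambda>u z. c * f u z)"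
  and reducible_a: "reducible f \<Longrightarrow> reducible (\<lambda>u z. fst u * f u z)"
  and reducible_b: "reducible f \<Longrightarrow> reducible (\<lambda>u z. snd u * f u z)"
  using reducible_scale[of f "[:[:c:]:]"] reducible_scale[of f "[:[:0, 1:]:]"] reducible_scale[of f "[:0, 1:]"]
  by (simp_all add: poly2_generators)

lemma reducible_divide_discr:
  assumes "reducible f"
  shows "reducible (\<lambda>u z. f u z / discr u)"
proof -
  obtain m p q where f: "\<And>u \<gamma>. discr u \<noteq> 0 \<Longrightarrow> regular_loop u \<gamma> \<Longrightarrow>
     has_loop_integral (f u) ((poly2 p u * loop_integral (\<lambda>z. 1 / snd z) \<gamma>
         + poly2 q u * loop_integral (\<lambda>z. fst z / snd z) \<gamma>) / discr u ^ m) \<gamma>"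
    using assms(1) unfolding reducible_def by blast
  show ?thesis
    unfolding reducible_def
  proof (rule exI[of _ "Suc m"], rule exI[of _ p], rule exI[of _ q], intro allI impI)
    fix u \<gamma> assume "discr u \<noteq> 0" "regular_loop u \<gamma>"
    from has_loop_integral_cmult[OF f[OF this], of "inverse (discr u)"]
    show "has_loop_integral (\<lambda>z. f u z / discr u) ((poly2 p u * loop_integral (\<lambda>z. 1 / snd z) \<gamma>
         + poly2 q u * loop_integral (\<lambda>z. fst z / snd z) \<gamma>) / discr u ^ Suc m) \<gamma>"
      by (simp add: field_simps)
  qed
qed

lemma reducible_exact:
  "reducible (\<lambda>u z. of_nat k * fst z ^ (k - 1) * snd z powi l
      + of_int l / 2 * fst z ^ k * snd z powi (l - 2) * (3 * fst z ^ 2 + fst u))"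
  unfolding reducible_def
  by (rule exI[of _ 0], rule exI[of _ 0], rule exI[of _ 0]) (use has_loop_integral_exact in auto)

lemma reducible_base:
  "reducible (\<lambda>u z. fst z ^ 0 * snd z powi (-1))" "reducible (\<lambda>u z. fst z ^ 1 * snd z powi (-1))"
proof -
  have "has_loop_integral (\<lambda>z. 1 / snd z) (loop_integral (\<lambda>z. 1 / snd z) \<gamma>) \<gamma>"
    "has_loop_integral (\<lambda>z. fst z / snd z) (loop_integral (\<lambda>z. fst z / snd z) \<gamma>) \<gamma>"
    if "discr u \<noteq> 0" "regular_loop u \<gamma>" for u \<gamma>
    using has_loop_integral_holomorphic_over_y[OF that, of "\<lambda>_. 1"]
      has_loop_integral_holomorphic_over_y[OF that, of "\<lambda>x. x"] by auto
  then show "reducible (\<lambda>u z. fst z ^ 0 * snd z powi (-1))" "reducible (\<lambda>u z. fst z ^ 1 * snd z powi (-1))"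
    unfolding reducible_def
    by - (rule exI[of _ 0], rule exI[of _ 1], rule exI[of _ 0], simp add: divide_inverse,
        rule exI[of _ 0], rule exI[of _ 0], rule exI[of _ 1], simp add: divide_inverse)
qed

lemma reducible_over_y: "reducible (\<lambda>u z. fst z ^ k * snd z powi (-1))"
proof (induction k rule: less_induct)
  case (less k)
  consider "k = 0" | "k = 1" | j where "k = j + 2"
    by (metis One_nat_def add_2_eq_Suc' not0_implies_Suc)
  then show ?case
  proof cases
    case 3
    \<comment> \<open>In d(x^j y) the factor y is written as Q / y. The coefficient of x^(j+2) / y
      becomes j + 3/2, those of a x^j / y and b x^(j-1) / y become j + 1/2 and j; solving for the
      first term lowers the degree.\<close>
    let ?c = "of_nat j + 3/2 :: complex"
    have "?c = of_nat (2 * j + 3) / 2" by (simp add: field_simps)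
    moreover have "(of_nat (2 * j + 3) :: complex) \<noteq> 0" unfolding of_nat_eq_0_iff by simp
    ultimately have c: "?c \<noteq> 0" by (metis divide_eq_0_iff zero_neq_numeral)
    have "(of_nat (6 + j * 4) :: complex) \<noteq> 0" unfolding of_nat_eq_0_iff by simp
    then have c2: "6 + of_nat j * 4 \<noteq> (0 :: complex)" by simp
    have "reducible (\<lambda>u z. (1 / ?c) * (of_nat j * fst z ^ (j - 1) * snd z powi 1
      + of_int 1 / 2 * fst z ^ j * snd z powi (1 - 2) * (3 * fst z ^ 2 + fst u))
      + ((- (of_nat j + 1/2) / ?c) * (fst u * (fst z ^ j * snd z powi (-1)))
      + (- of_nat j / ?c) * (snd u * (fst z ^ (j - 1) * snd z powi (-1)))))"
      using 3 by (intro reducible_add reducible_const reducible_a reducible_b reducible_exact less.IH) auto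
    then show ?thesis
    proof (rule reducible_cong)
      fix u :: param and z assume z: "z \<in> curve u" "snd z \<noteq> 0"
      obtain x y where xy: "z = (x, y)" by (cases z)
      have y: "y = (x ^ 3 + fst u * x + snd u) / y" "y \<noteq> 0"
        using z by (auto simp: xy curve_def cubic_def power2_eq_square field_simps)
      \<comment> \<open>For j = 0 the truncated exponent j - 1 is harmless because the factor j
        vanishes.\<close>
      have "of_nat j * x ^ (j - 1) * y = of_nat j * x ^ (j - 1) * (x ^ 3 + fst u * x + snd u) / y"
        using y(1) by (metis times_divide_eq_right)
      also have "\<dots> = (of_nat j * x ^ (j + 2) + of_nat j * fst u * x ^ j + of_nat j * snd u * x ^ (j - 1)) / y"
        by (cases j) (simp_all add: algebra_simps power2_eq_square power3_eq_cube)
      finally have E: "of_nat j * x ^ (j - 1) * y = (of_nat j * x ^ (j + 2) + of_nat j * fst u * x ^ j + of_nat j * snd u * x ^ (j - 1)) / y" .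
      show "(1 / ?c) * (of_nat j * fst z ^ (j - 1) * snd z powi 1
      + of_int 1 / 2 * fst z ^ j * snd z powi (1 - 2) * (3 * fst z ^ 2 + fst u))
      + ((- (of_nat j + 1/2) / ?c) * (fst u * (fst z ^ j * snd z powi (-1)))
      + (- of_nat j / ?c) * (snd u * (fst z ^ (j - 1) * snd z powi (-1)))) = fst z ^ k * snd z powi (-1)"
        using c c2 y(2) 3 E by (simp add: xy divide_simps power2_eq_square) (simp add: algebra_simps)
    qed
  qed (use reducible_base in simp_all)
qed

text \<open>Each factor y^2 is traded for the cubic, until only 1 / y is left.\<close>

lemma reducible_odd_nonneg: "reducible (\<lambda>u z. fst z ^ k * snd z powi (2 * int n - 1))"
proof (induction n arbitrary: k)
  case 0
  then show ?case using reducible_over_y by simp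
next
  case (Suc n)
  have "reducible (\<lambda>u z. fst z ^ (k + 3) * snd z powi (2 * int n - 1)
     + (fst u * (fst z ^ (k + 1) * snd z powi (2 * int n - 1)) + snd u * (fst z ^ k * snd z powi (2 * int n - 1))))"
    by (intro reducible_add reducible_a reducible_b Suc.IH)
  then show ?case
  proof (rule reducible_cong)
    fix u :: param and z assume z: "z \<in> curve u" "snd z \<noteq> 0"
    have "snd z powi (2 * int (Suc n) - 1) = snd z powi (2 * int n - 1) * snd z ^ 2"
      using power_int_add[of "snd z" "2 * int n - 1" 2] z(2) by (simp add: algebra_simps)
    moreover have "snd z ^ 2 = fst z ^ 3 + fst u * fst z + snd u"
      using z by (auto simp: curve_def cubic_def)
    ultimately show "fst z ^ (k + 3) * snd z powi (2 * int n - 1)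
     + (fst u * (fst z ^ (k + 1) * snd z powi (2 * int n - 1)) + snd u * (fst z ^ k * snd z powi (2 * int n - 1)))
     = fst z ^ k * snd z powi (2 * int (Suc n) - 1)"
      by (simp add: algebra_simps power_add)
  qed
qed

text \<open>The order of the pole in \<open>y\<close> is lowered by writing \<open>\<Delta>\<close> as a combination of \<open>Q\<close> and \<open>Q'\<close>:
  the factor \<open>Q = y\<^sup>2\<close> cancels a pole, and \<open>Q'\<close> is removed by an exact form.\<close>

lemma reducible_odd_neg: "reducible (\<lambda>u z. fst z ^ k * snd z powi (- 1 - 2 * int n))"
proof (induction n arbitrary: k)
  case 0
  then show ?case using reducible_over_y by simp
next
  case (Suc n)
  define l where "l = - 1 - 2 * int n"
  have l0: "of_int l \<noteq> (0 :: complex)" unfolding l_def of_int_eq_0_iff by presburger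
  have IH: "reducible (\<lambda>u z. fst z ^ k * snd z powi l)" for k
    using Suc.IH by (simp only: l_def)
  \<comment> \<open>Up to the exact form d(x^i y^l), the term with the factor Q' has the milder pole
    y^l. Dividing by l is allowed since l is odd.\<close>
  have T: "reducible (\<lambda>u z. fst z ^ i * snd z powi (l - 2) * (3 * fst z ^ 2 + fst u))" for i
  proof -
    have "reducible (\<lambda>u z. (2 / of_int l) * (of_nat i * fst z ^ (i - 1) * snd z powi l
      + of_int l / 2 * fst z ^ i * snd z powi (l - 2) * (3 * fst z ^ 2 + fst u))
      + (- 2 * of_nat i / of_int l) * (fst z ^ (i - 1) * snd z powi l))"
      by (intro reducible_add reducible_const reducible_exact IH)
    then show ?thesis
      by (rule reducible_cong) (use l0 in \<open>simp add: field_simps\<close>)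
  qed
  let ?M = "\<lambda>i z. fst z ^ i * snd z powi l"
  let ?T = "\<lambda>i u z. fst z ^ i * snd z powi (l - 2) * (3 * fst z ^ 2 + fst u)"
  \<comment> \<open>The coefficients -18, 27 of Q and 6, -9, 4 of Q' are the cofactors of the Bezout
    identity in \<open>cubic_derivative_nonzero\<close>.\<close>
  have "reducible (\<lambda>u z. (((- 18) * (fst u * ?M (k + 1) z) + 27 * (snd u * ?M k z))
     + (6 * (fst u * ?T (k + 2) u z) + ((- 9) * (snd u * ?T (k + 1) u z) + 4 * (fst u * (fst u * ?T k u z))))) / discr u)"
    by (intro reducible_divide_discr reducible_add reducible_const reducible_a reducible_b IH T)
  then have "reducible (\<lambda>u z. fst z ^ k * snd z powi (l - 2))"
  proof (rule reducible_cong)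
    fix u :: param and z assume d: "discr u \<noteq> 0" and z: "z \<in> curve u" "snd z \<noteq> 0"
    define x Y where "x = fst z" and "Y = snd z powi (l - 2)"
    have "snd z powi l = Y * snd z ^ 2"
      using power_int_add[of "snd z" "l - 2" 2] z(2) by (simp add: Y_def)
    then have y: "snd z powi l = Y * (x ^ 3 + fst u * x + snd u)"
      using z by (auto simp: curve_def cubic_def x_def)
    have "((- 18) * (fst u * (x ^ (k + 1) * (Y * (x ^ 3 + fst u * x + snd u)))) + 27 * (snd u * (x ^ k * (Y * (x ^ 3 + fst u * x + snd u)))))
     + (6 * (fst u * (x ^ (k + 2) * Y * (3 * x ^ 2 + fst u))) + ((- 9) * (snd u * (x ^ (k + 1) * Y * (3 * x ^ 2 + fst u)))
     + 4 * (fst u * (fst u * (x ^ k * Y * (3 * x ^ 2 + fst u)))))) = x ^ k * Y * discr u"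
      unfolding discr_def by (simp add: algebra_simps power_add power2_eq_square power3_eq_cube)
    then show "(((- 18) * (fst u * ?M (k + 1) z) + 27 * (snd u * ?M k z))
     + (6 * (fst u * ?T (k + 2) u z) + ((- 9) * (snd u * ?T (k + 1) u z) + 4 * (fst u * (fst u * ?T k u z))))) / discr u
     = fst z ^ k * snd z powi (l - 2)"
      using d unfolding y x_def[symmetric] Y_def[symmetric] by simp
  qed
  moreover have "l - 2 = - 1 - 2 * int (Suc n)" by (simp add: l_def)
  ultimately show ?case by simp
qed

theorem reducible_laurent: "laurent p f \<Longrightarrow> p \<Longrightarrow> reducible f"
proof (induction rule: laurent.induct)
  case (monomial l c i j k)
  have "reducible (\<lambda>u z. fst z ^ k * snd z powi l)"
  proof (cases "l \<ge> 0")
    case True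
    with monomial have "l = 2 * int (nat ((l + 1) div 2)) - 1" by simp presburger
    then obtain n where "l = 2 * int n - 1" by blast
    then show ?thesis using reducible_odd_nonneg by simp
  next
    case False
    with monomial have "l = - 1 - 2 * int (nat ((- 1 - l) div 2))" by simp
    then obtain n where "l = - 1 - 2 * int n" by blast
    then show ?thesis using reducible_odd_neg by simp
  qed
  from reducible_scale[OF this, of "[:[:c:]:] * [:[:0, 1:]:] ^ i * [:0, 1:] ^ j"]
  show ?case
    by (rule reducible_cong) (simp only: poly2_generators poly2_simps mult_ac)
next
  case (add p f g)
  then show ?case by (intro reducible_add) auto
next
  case (cong p f g)
  show ?case by (rule reducible_cong[OF cong.IH[OF cong.prems]]) (simp add: cong.hyps)
qed

section \<open>Dependence of periods on the parameter\<close>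

text \<open>The integrand may have poles at the turning points, so chains cannot be used directly.
  Its integral is a fixed combination of the two elliptic integrals, whose integrands have
  primitives everywhere.\<close>

lemma loop_integral_laurent_invariant:
  assumes f: "laurent True f" and d: "discr u \<noteq> 0"
    and p: "regular_loop u p" and q: "regular_loop u q" and eq: "loop_class u p = loop_class u q"
  shows "loop_integral (f u) p = loop_integral (f u) q"
proof -
  have 0: "loop_integral (\<lambda>z. 1 / snd z) p = loop_integral (\<lambda>z. 1 / snd z) q"
    by (rule loop_integral_homology_invariant[OF _ p q eq])
      (use local_primitive_holomorphic_over_y[OF d, of _ "\<lambda>_. 1"] in auto)
  have 1: "loop_integral (\<lambda>z. fst z / snd z) p = loop_integral (\<lambda>z. fst z / snd z) q"
    by (rule loop_integral_homology_invariant[OF _ p q eq])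
      (use local_primitive_holomorphic_over_y[OF d, of _ "\<lambda>x. x"] in auto)
  obtain m P Q where "\<And>u \<gamma>. discr u \<noteq> 0 \<Longrightarrow> regular_loop u \<gamma> \<Longrightarrow>
     has_loop_integral (f u) ((poly2 P u * loop_integral (\<lambda>z. 1 / snd z) \<gamma>
         + poly2 Q u * loop_integral (\<lambda>z. fst z / snd z) \<gamma>) / discr u ^ m) \<gamma>"
    using reducible_laurent[OF f TrueI] unfolding reducible_def by blast
  from this[OF d p, THEN has_loop_integral_imp_eq] this[OF d q, THEN has_loop_integral_imp_eq]
  show ?thesis by (simp add: 0 1)
qed

lemma period_eq:
  assumes inv: "\<And>q. regular_loop u q \<Longrightarrow> loop_class u q = loop_class u p \<Longrightarrow> loop_integral f q = loop_integral f p"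
    and p: "regular_loop u p"
  shows "period u f (loop_class u p) = loop_integral f p"
  unfolding period_def
proof (rule the_equality)
  show "\<exists>q. regular_loop u q \<and> loop_class u q = loop_class u p \<and> loop_integral f p = loop_integral f q"
    using p by blast
  show "w = loop_integral f p"
    if "\<exists>q. regular_loop u q \<and> loop_class u q = loop_class u p \<and> w = loop_integral f q" for w
    using that inv by blast
qed

lemma period_laurent:
  assumes "laurent True f" "discr u \<noteq> 0" "regular_loop u p"
  shows "period u (f u) (loop_class u p) = loop_integral (f u) p"
  by (rule period_eq[OF loop_integral_laurent_invariant[OF assms(1,2) _ assms(3)] assms(3)])

lemma period_reduction:
  assumes f: "laurent True f"
  shows "\<exists>m p q. \<forall>u \<gamma>. discr u \<noteq> 0 \<longrightarrow> regular_loop u \<gamma> \<longrightarrow>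
    period u (f u) (loop_class u \<gamma>) = elliptic_comb p q u (loop_class u \<gamma>) / discr u ^ m"
proof -
  obtain m P Q where *: "\<And>u \<gamma>. discr u \<noteq> 0 \<Longrightarrow> regular_loop u \<gamma> \<Longrightarrow>
     has_loop_integral (f u) ((poly2 P u * loop_integral (\<lambda>z. 1 / snd z) \<gamma>
         + poly2 Q u * loop_integral (\<lambda>z. fst z / snd z) \<gamma>) / discr u ^ m) \<gamma>"
    using reducible_laurent[OF f TrueI] unfolding reducible_def by blast
  have "period u (f u) (loop_class u \<gamma>) = elliptic_comb P Q u (loop_class u \<gamma>) / discr u ^ m"
    if d: "discr u \<noteq> 0" and \<gamma>: "regular_loop u \<gamma>" for u \<gamma>
  proof -
    have "laurent True (\<lambda>u z. 1 / snd z)" "laurent True (\<lambda>u z. fst z / snd z)"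
      using laurent.monomial[of "-1" 1 0 0 0] laurent.monomial[of "-1" 1 0 0 1] by (simp_all add: divide_inverse)
    from this[THEN period_laurent, OF d \<gamma>] show ?thesis
      using has_loop_integral_imp_eq[OF *[OF d \<gamma>]] period_laurent[OF f d \<gamma>] by (simp add: elliptic_comb_def)
  qed
  then show ?thesis by blast
qed

lemma laurent_branch_holomorphic:
  assumes "laurent p f" "S holomorphic_on A" "\<And>x. x \<in> A \<Longrightarrow> S x \<noteq> 0"
  shows "(\<lambda>x. f u (x, S x)) holomorphic_on A"
  using assms
proof (induction rule: laurent.induct)
  case (monomial l c i j k)
  then show ?case by (simp, intro holomorphic_intros) auto
next
  case (add p f g)
  then show ?case by (intro holomorphic_intros) auto
next
  case (cong p f g)
  have "(\<lambda>x. f u (x, S x)) holomorphic_on A" using cong by blast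
  then show ?case by (rule holomorphic_transform) (use cong in auto)
qed

text \<open>Over a disc that avoids the turning points the integral along the loop can be replaced by one
  along a segment, whose end points and integrand do not involve the derivative of the path.\<close>

lemma integral_piece_eq_segment:
  assumes h: "laurent b h" and p: "regular_loop v p" and st: "0 \<le> s" "s \<le> t" "t \<le> 1"
    and dom: "\<And>x. x \<in> ball c \<rho> \<Longrightarrow> (v, x) \<in> branch_dom z"
    and path: "\<And>r. r \<in> {s..t} \<Longrightarrow> fst (p r) \<in> ball c \<rho> \<and> branch v z (fst (p r)) = snd (p r)"
  shows "((\<lambda>r. h v (p r) * vector_derivative (fst \<circ> p) (at r within {0..1})) has_integral
     integral {0..1} (\<lambda>r. h v (linepath (fst (p s)) (fst (p t)) r, branch v z (linepath (fst (p s)) (fst (p t)) r))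
        * (fst (p t) - fst (p s)))) {s..t}"
proof -
  let ?B = "ball c \<rho>" and ?l = "linepath (fst (p s)) (fst (p t))"
  define g where "g x = h v (x, branch v z x)" for x
  have "branch v z holomorphic_on ?B"
    unfolding holomorphic_on_open[OF open_ball] using branch_deriv_x[OF dom] by blast
  then have "g holomorphic_on ?B"
    unfolding g_def using branch_dom_Re(3)[OF dom] by (intro laurent_branch_holomorphic[OF h]) auto
  then obtain P where P: "\<And>x. x \<in> ?B \<Longrightarrow> (P has_field_derivative g x) (at x)"
    using holomorphic_convex_primitive'[of ?B g] by (auto simp: at_within_open[of _ ?B])
  have "closed_segment (fst (p s)) (fst (p t)) \<subseteq> ?B"
    using path st by (intro closed_segment_subset) auto
  then have "(g has_contour_integral (P (pathfinish ?l) - P (pathstart ?l))) ?l"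
    by (intro contour_integral_primitive[of ?B P g] has_field_derivative_at_within[OF P]) auto
  then have "((\<lambda>r. g (?l r) * (fst (p t) - fst (p s))) has_integral P (fst (p t)) - P (fst (p s))) {0..1}"
    by (simp add: has_contour_integral_linepath)
  then have seg: "integral {0..1} (\<lambda>r. g (?l r) * (fst (p t) - fst (p s))) = P (fst (p t)) - P (fst (p s))"
    by (rule integral_unique)
  have "((\<lambda>r. h v (p r) * vector_derivative (fst \<circ> p) (at r within {0..1})) has_integral
      (\<lambda>r. P (fst (p r))) t - (\<lambda>r. P (fst (p r))) s) {s..t}"
  proof (rule has_integral_along_path[OF _ st])
    show vp: "valid_path p" using p by (simp add: regular_loop_def)
    have c1: "continuous_on {s..t} (\<lambda>r. fst (p r))"
      using valid_path_imp_path[OF vp] st unfolding path_def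
      by (intro continuous_intros) (auto intro: continuous_on_subset)
    have "continuous_on ?B P" using P by (meson DERIV_isCont continuous_at_imp_continuous_on)
    then show "continuous_on {s..t} (\<lambda>r. P (fst (p r)))"
      by (rule continuous_on_compose2[OF _ c1]) (use path in blast)
    fix r w assume r: "s < r" "r < t" and w: "(p has_vector_derivative w) (at r)"
    have "((\<lambda>r. fst (p r)) has_vector_derivative fst w) (at r)"
      using bounded_linear.has_vector_derivative[OF bounded_linear_fst w] by simp
    from field_vector_diff_chain_at[OF this, of P "g (fst (p r))"] P[of "fst (p r)"] path[of r] r
    have "((\<lambda>r. P (fst (p r))) has_vector_derivative fst w * g (fst (p r))) (at r)"
      by (simp add: o_def)
    moreover have "g (fst (p r)) = h v (p r)"
      using path[of r] r by (simp add: g_def)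
    ultimately show "((\<lambda>r. P (fst (p r))) has_vector_derivative h v (p r) * fst w) (at r)"
      by (simp add: mult.commute)
  qed
  with seg show ?thesis by (simp add: g_def)
qed

text \<open>Leibniz' rule is used in each variable separately, and the theory of two variables turns
  the partial derivatives into a total differential.\<close>

lemma has_differential_integral:
  fixes k kA kB :: "param \<Rightarrow> real \<Rightarrow> complex"
  assumes XY: "open X" "convex X" "open Y" "convex Y" and w: "w \<in> X \<times> Y"
    and k: "continuous_on ((X \<times> Y) \<times> {0..1}) (\<lambda>(v, t). k v t)"
    and kA: "continuous_on ((X \<times> Y) \<times> {0..1}) (\<lambda>(v, t). kA v t)"
    and kB: "continuous_on ((X \<times> Y) \<times> {0..1}) (\<lambda>(v, t). kB v t)"
    and A: "\<And>a b t. a \<in> X \<Longrightarrow> b \<in> Y \<Longrightarrow> t \<in> {0..1} \<Longrightarrow>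
        ((\<lambda>a. k (a, b) t) has_field_derivative kA (a, b) t) (at a)"
    and B: "\<And>a b t. a \<in> X \<Longrightarrow> b \<in> Y \<Longrightarrow> t \<in> {0..1} \<Longrightarrow>
        ((\<lambda>b. k (a, b) t) has_field_derivative kB (a, b) t) (at b)"
  shows "has_differential (\<lambda>v. integral {0..1} (k v)) (integral {0..1} (kA w), integral {0..1} (kB w)) w"
proof -
  let ?F = "\<lambda>v. integral {0..1} (k v)"
  have int: "k v integrable_on {0..1}" if "v \<in> X \<times> Y" for v
  proof -
    have "continuous_on {0..1} (\<lambda>t. (\<lambda>(v, t). k v t) (v, t))"
      by (rule continuous_on_compose2[OF k]) (use that in \<open>auto intro!: continuous_intros\<close>)
    then show ?thesis by (intro integrable_continuous_real) simp
  qed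
  have DA: "((\<lambda>a. ?F (a, b)) has_field_derivative integral {0..1} (kA (a, b))) (at a)"
    if ab: "a \<in> X" "b \<in> Y" for a b
  proof -
    have "((\<lambda>a. integral (cbox 0 1) (k (a, b))) has_field_derivative integral (cbox 0 1) (kA (a, b))) (at a within X)"
    proof (rule leibniz_rule_field_derivative[where U = X])
      have "continuous_on (X \<times> cbox 0 1) (\<lambda>q. (\<lambda>(v, t). kA v t) ((fst q, b), snd q))"
        by (rule continuous_on_compose2[OF kA]) (use ab in \<open>auto intro!: continuous_intros\<close>)
      then show "continuous_on (X \<times> cbox 0 1) (\<lambda>(a, t). kA (a, b) t)" by (simp add: case_prod_beta')
    qed (use ab XY A int in \<open>auto intro: has_field_derivative_at_within\<close>)
    then show ?thesis using XY ab by (simp add: at_within_open[of a X])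
  qed
  have DB: "((\<lambda>b. ?F (a, b)) has_field_derivative integral {0..1} (kB (a, b))) (at b)"
    if ab: "a \<in> X" "b \<in> Y" for a b
  proof -
    have "((\<lambda>b. integral (cbox 0 1) (k (a, b))) has_field_derivative integral (cbox 0 1) (kB (a, b))) (at b within Y)"
    proof (rule leibniz_rule_field_derivative[where U = Y])
      have "continuous_on (Y \<times> cbox 0 1) (\<lambda>q. (\<lambda>(v, t). kB v t) ((a, fst q), snd q))"
        by (rule continuous_on_compose2[OF kB]) (use ab in \<open>auto intro!: continuous_intros\<close>)
      then show "continuous_on (Y \<times> cbox 0 1) (\<lambda>(b, t). kB (a, b) t)" by (simp add: case_prod_beta')
    qed (use ab XY B int in \<open>auto intro: has_field_derivative_at_within\<close>)
    then show ?thesis using XY ab by (simp add: at_within_open[of b Y])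
  qed
  have "holomorphic2 ?F (X \<times> Y)"
    unfolding holomorphic2_def
  proof (intro conjI ballI)
    show "open (X \<times> Y)" using XY by (simp add: open_Times)
    have "continuous_on ((X \<times> Y) \<times> cbox 0 1) (\<lambda>(v, t). k v t)" using k by simp
    from integral_continuous_on_param[OF this] show "continuous_on (X \<times> Y) ?F" by simp
    fix u assume "u \<in> X \<times> Y"
    then have u: "fst u \<in> X" "snd u \<in> Y" by auto
    show "(\<lambda>a. ?F (a, snd u)) field_differentiable at (fst u)"
      using DA[OF u] field_differentiable_def by blast
    show "(\<lambda>b. ?F (fst u, b)) field_differentiable at (snd u)"
      using DB[OF u] field_differentiable_def by blast
  qed
  from holomorphic2_imp_has_differential[OF this w]
  have "has_differential ?F (partial1 ?F w, partial2 ?F w) w" .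
  moreover have w': "fst w \<in> X" "snd w \<in> Y" using w by (simp_all add: mem_Times_iff)
  have "partial1 ?F w = integral {0..1} (kA w)" "partial2 ?F w = integral {0..1} (kB w)"
    unfolding partial1_def partial2_def
    using DERIV_imp_deriv[OF DA[OF w']] DERIV_imp_deriv[OF DB[OF w']] by simp_all
  ultimately show ?thesis by simp
qed

section \<open>Differentiation of loop integrals in the parameters\<close>

lemma has_differential_transform:
  assumes "has_differential F \<alpha> u" "open N" "u \<in> N" "\<And>v. v \<in> N \<Longrightarrow> F v = G v"
  shows "has_differential G \<alpha> u"
  using has_derivative_transform_within_open[of F _ u UNIV N G] assms by (simp add: has_differential_def)

lemma has_differential_add:
  "has_differential F \<alpha> u \<Longrightarrow> has_differential G \<beta> u \<Longrightarrow> has_differential (\<lambda>v. F v + G v) (\<alpha> + \<beta>) u"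
  unfolding has_differential_def by (drule (1) has_derivative_add) (simp add: algebra_simps)

lemma has_differential_scaleR:
  "has_differential F \<alpha> u \<Longrightarrow> has_differential (\<lambda>v. c *\<^sub>R F v) (c *\<^sub>R \<alpha>) u"
  unfolding has_differential_def by (drule has_derivative_scaleR_right[of _ _ _ c]) (simp add: algebra_simps)

lemma has_differential_diff:
  "has_differential F \<alpha> u \<Longrightarrow> has_differential G \<beta> u \<Longrightarrow> has_differential (\<lambda>v. F v - G v) (\<alpha> - \<beta>) u"
  unfolding has_differential_def by (drule (1) has_derivative_diff) (simp add: algebra_simps)

lemma has_differential_sum:
  "(\<And>i. i \<in> I \<Longrightarrow> has_differential (F i) (\<alpha> i) u) \<Longrightarrow> has_differential (\<lambda>v. \<Sum>i\<in>I. F i v) (\<Sum>i\<in>I. \<alpha> i) u"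
proof (induction I rule: infinite_finite_induct)
  case (insert i I)
  then show ?case by (simp add: has_differential_add)
qed (simp_all add: has_differential_def)

lemma open_discr_nonzero: "open {u. discr u \<noteq> 0}"
  unfolding discr_def by (intro open_Collect_neq continuous_intros)

lemma laurent_has_loop_integral:
  assumes "laurent True f" "discr u \<noteq> 0" "regular_loop u p"
  shows "has_loop_integral (f u) (loop_integral (f u) p) p"
proof -
  obtain I where "has_loop_integral (f u) I p"
    using reducible_laurent[OF assms(1) TrueI] assms(2,3) unfolding reducible_def by blast
  then show ?thesis using has_loop_integral_imp_eq by blast
qed

text \<open>The branch along the loops is only assumed continuous in the parameter. On a short time
  interval it agrees with \<open>branch\<close>, which is holomorphic in a and b, and the integral
  moves to a segment with end points independent of the parameter.\<close>

lemma loop_integral_has_differential: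
  assumes M: "open M" "w \<in> M" and d: "discr w \<noteq> 0"
    and \<eta>: "continuous_on (M \<times> {0..1}) (\<lambda>(v, t). \<eta> v t :: complex)"
    and loop: "\<And>v. v \<in> M \<Longrightarrow> regular_loop v (\<lambda>t. (\<xi> t, \<eta> v t))"
    and f: "laurent True f" "laurent True A" "laurent True B"
    and D: "has_param_derivs f A B"
  shows "has_differential (\<lambda>v. loop_integral (f v) (\<lambda>t. (\<xi> t, \<eta> v t)))
    (loop_integral (A w) (\<lambda>t. (\<xi> t, \<eta> w t)), loop_integral (B w) (\<lambda>t. (\<xi> t, \<eta> w t))) w"
proof -
  define P where "P v t = (\<xi> t, \<eta> v t)" for v t
  define g where "g h v r = h v (P v r) * vector_derivative (fst \<circ> P v) (at r within {0..1})"
    for h :: "param \<Rightarrow> point \<Rightarrow> complex" and v r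
  have Pf: "fst (P v t) = \<xi> t" for v t by (simp add: P_def)
  have Ploop: "regular_loop v (P v)" if "v \<in> M" for v
    using loop[OF that] by (simp add: P_def[abs_def])
  define M' where "M' = M \<inter> {v. discr v \<noteq> 0}"
  have M': "open M'" "w \<in> M'" using M d open_discr_nonzero by (auto simp: M'_def)
  have int: "g h v integrable_on {s..t}" if "laurent True h" "v \<in> M'" "0 \<le> s" "t \<le> 1" for h v s t
  proof -
    have "g h v integrable_on {0..1}"
      using laurent_has_loop_integral[OF that(1) _ Ploop] that(2)
      unfolding g_def has_loop_integral_def M'_def by blast
    then show ?thesis by (rule integrable_on_subinterval) (use that in auto)
  qed
  \<comment> \<open>The bounds are premises because the intervals around a time at the boundary may
    leave the unit interval.\<close>
  define Pr where "Pr s t \<longleftrightarrow> (0 \<le> s \<longrightarrow> s \<le> t \<longrightarrow> t \<le> 1 \<longrightarrow> has_differential (\<lambda>v. integral {s..t} (g f v))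
      (integral {s..t} (g A w), integral {s..t} (g B w)) w)" for s t
  have "Pr 0 1"
  \<comment> \<open>Differentiability of the partial integral is additive under joining adjacent
    intervals and holds for all short intervals around each time, hence on the whole
    interval.\<close>
  proof (rule Bolzano[of 0 1 Pr])
    fix s r t assume 1: "Pr s r" and 2: "Pr r t" and le: "s \<le> r" "r \<le> t"
    show "Pr s t"
      unfolding Pr_def
    proof (intro impI)
      assume st: "0 \<le> s" "s \<le> t" "t \<le> 1"
      have comb: "integral {s..r} (g h v) + integral {r..t} (g h v) = integral {s..t} (g h v)"
        if "laurent True h" "v \<in> M'" for h v
        by (rule Henstock_Kurzweil_Integration.integral_combine[OF le int[OF that st(1,3)]])
      have "has_differential (\<lambda>v. integral {s..r} (g f v) + integral {r..t} (g f v))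
          ((integral {s..r} (g A w), integral {s..r} (g B w)) + (integral {r..t} (g A w), integral {r..t} (g B w))) w"
        using 1 2 le st unfolding Pr_def by (intro has_differential_add) auto
      then have "has_differential (\<lambda>v. integral {s..r} (g f v) + integral {r..t} (g f v))
          (integral {s..t} (g A w), integral {s..t} (g B w)) w"
        by (simp add: comb f M')
      then show "has_differential (\<lambda>v. integral {s..t} (g f v)) (integral {s..t} (g A w), integral {s..t} (g B w)) w"
        by (rule has_differential_transform[OF _ M']) (rule comb[OF f(1)])
    qed
  next
    fix t0 :: real assume t0: "0 \<le> t0" "t0 \<le> 1"
    define z where "z = P w t0"
    have z: "z \<in> curve w" "snd z \<noteq> 0"
      using Ploop[OF M(2)] t0 by (auto simp: z_def regular_loop_def path_image_def)
    have zf: "fst z = \<xi> t0" by (simp add: z_def P_def)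
    obtain N1 N2 where N: "open N1" "open N2" "w \<in> N1" "\<xi> t0 \<in> N2" "N1 \<times> N2 \<subseteq> branch_dom z"
    proof -
      obtain N1 N2 where "open N1" "open N2" "(w, fst z) \<in> N1 \<times> N2" "N1 \<times> N2 \<subseteq> branch_dom z"
        using open_prod_elim[OF open_branch_dom center_in_branch_dom[OF z]] by blast
      then show ?thesis using that[of N1 N2] zf by simp
    qed
    obtain \<rho> where \<rho>: "\<rho> > 0" "ball (\<xi> t0) \<rho> \<subseteq> N2" using N open_contains_ball by blast
    \<comment> \<open>Within \<open>d1\<close> the moving value of y is closer to
      \<open>snd z\<close> than the modulus of \<open>snd z\<close>, which is the condition of
      \<open>branch_eq\<close>.\<close>
    obtain d1 where d1: "d1 > 0" "\<And>v t. v \<in> M \<Longrightarrow> t \<in> {0..1} \<Longrightarrow> dist (v, t) (w, t0) < d1 \<Longrightarrow>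
        dist (\<eta> v t) (\<eta> w t0) < cmod (snd z)"
    proof -
      have "(w, t0) \<in> M \<times> {0..1}" "cmod (snd z) > 0" using M t0 z by auto
      then obtain d1 where "d1 > 0" "\<forall>q\<in>M \<times> {0..1}. dist q (w, t0) < d1 \<longrightarrow>
          dist ((\<lambda>(v, t). \<eta> v t) q) ((\<lambda>(v, t). \<eta> v t) (w, t0)) < cmod (snd z)"
        using \<eta> unfolding continuous_on_iff by blast
      then show ?thesis using that[of d1] by auto
    qed
    have "continuous_on {0..1} \<xi>"
    proof -
      have "continuous_on {0..1} (P w)"
        using Ploop[OF M(2)] valid_path_imp_path unfolding regular_loop_def path_def by blast
      then have "continuous_on {0..1} (\<lambda>t. fst (P w t))" by (intro continuous_intros)
      then show ?thesis by (simp add: P_def)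
    qed
    then obtain d2 where d2: "d2 > 0" "\<And>t. t \<in> {0..1} \<Longrightarrow> dist t t0 < d2 \<Longrightarrow> dist (\<xi> t) (\<xi> t0) < \<rho>"
    proof -
      have "t0 \<in> {0..1}" using t0 by simp
      with \<open>continuous_on {0..1} \<xi>\<close> \<rho>(1) obtain d2 where "d2 > 0"
          "\<forall>t\<in>{0..1}. dist t t0 < d2 \<longrightarrow> dist (\<xi> t) (\<xi> t0) < \<rho>"
        unfolding continuous_on_iff by blast
      then show ?thesis using that[of d2] by blast
    qed
    have "open (M' \<inter> N1 \<inter> ball w (d1 / 2))" "w \<in> M' \<inter> N1 \<inter> ball w (d1 / 2)"
      using M' N d1 by auto
    then obtain r where r: "r > 0" "cball (fst w) r \<times> cball (snd w) r \<subseteq> M' \<inter> N1 \<inter> ball w (d1 / 2)"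
      using open_imp_polydisc by metis
    define X Y where "X = ball (fst w) r" and "Y = ball (snd w) r"
    have XY: "open X" "convex X" "open Y" "convex Y" "w \<in> X \<times> Y" and XYsub: "X \<times> Y \<subseteq> M' \<inter> N1 \<inter> ball w (d1 / 2)"
      using r by (auto simp: X_def Y_def mem_Times_iff)
    show "\<exists>d>0. \<forall>s t. s \<le> t0 \<and> t0 \<le> t \<and> t - s < d \<longrightarrow> Pr s t"
    proof (intro exI conjI allI impI)
      show "min (d1 / 2) d2 > 0" using d1 d2 by simp
      fix s t assume st': "s \<le> t0 \<and> t0 \<le> t \<and> t - s < min (d1 / 2) d2"
      show "Pr s t"
        unfolding Pr_def
      proof (intro impI)
        assume st: "0 \<le> s" "s \<le> t" "t \<le> 1"
        let ?l = "linepath (\<xi> s) (\<xi> t)"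
        define k where "k h v \<tau> = h v (?l \<tau>, branch v z (?l \<tau>)) * (\<xi> t - \<xi> s)"
          for h :: "param \<Rightarrow> point \<Rightarrow> complex" and v \<tau>
        have \<xi>: "\<xi> r \<in> ball (\<xi> t0) \<rho>" if "r \<in> {s..t}" for r
          using d2(2)[of r] that st st' by (auto simp: dist_commute dist_real_def)
        have dom: "(v, x) \<in> branch_dom z" if "v \<in> X \<times> Y" "x \<in> ball (\<xi> t0) \<rho>" for v x
          using that XYsub N(5) \<rho>(2) by blast
        have br: "branch v z (\<xi> r) = \<eta> v r" if v: "v \<in> X \<times> Y" and r: "r \<in> {s..t}" for v r
        proof (rule branch_eq)
          have r01: "r \<in> {0..1}" using r st by auto
          have vM: "v \<in> M" "dist w v < d1 / 2" using v XYsub by (auto simp: M'_def)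
          show "(\<xi> r, \<eta> v r) \<in> curve v"
            using Ploop[OF vM(1)] r01 by (auto simp: regular_loop_def path_image_def P_def)
          have "dist (v, r) (w, t0) \<le> dist v w + dist r t0"
            by (simp add: dist_Pair_Pair sqrt_sum_squares_le_sum)
          also have "\<dots> < d1" using vM(2) r st' by (auto simp: dist_commute dist_real_def)
          finally have "dist (\<eta> v r) (\<eta> w t0) < cmod (snd z)" using d1(2)[OF vM(1) r01] by blast
          then show "cmod (\<eta> v r - snd z) < cmod (snd z)" by (simp add: dist_norm z_def P_def)
        qed
        have piece: "integral {s..t} (g h v) = integral {0..1} (k h v)"
          if "laurent True h" "v \<in> X \<times> Y" for h v
        proof -
          have vM: "v \<in> M" using that(2) XYsub by (auto simp: M'_def)
          have "\<And>r. r \<in> {s..t} \<Longrightarrow> fst (P v r) \<in> ball (\<xi> t0) \<rho> \<and> branch v z (fst (P v r)) = snd (P v r)"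
            unfolding P_def fst_conv snd_conv using \<xi> br[OF that(2)] by blast
          from integral_piece_eq_segment[OF that(1) Ploop[OF vM] st dom[OF that(2)] this]
          have "(g h v has_integral integral {0..1} (k h v)) {s..t}"
            unfolding g_def k_def by (simp only: Pf)
          then show ?thesis by (rule integral_unique)
        qed
        have lin: "?l \<tau> \<in> ball (\<xi> t0) \<rho>" if "\<tau> \<in> {0..1}" for \<tau>
        proof -
          have "?l \<tau> \<in> closed_segment (\<xi> s) (\<xi> t)" using that linepath_in_path by blast
          then show ?thesis
            using closed_segment_subset[of "\<xi> s" "ball (\<xi> t0) \<rho>" "\<xi> t"] \<xi>[of s] \<xi>[of t] st by auto
        qed
        have cont: "continuous_on ((X \<times> Y) \<times> {0..1}) (\<lambda>(v, \<tau>). k h v \<tau>)" if "laurent True h" for h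
        proof -
          have l: "continuous_on ((X \<times> Y) \<times> {0..1}) (\<lambda>q. ?l (snd q))"
            unfolding linepath_def by (intro continuous_intros)
          have "continuous_on ((X \<times> Y) \<times> {0..1}) (\<lambda>q. (\<lambda>(v, x). branch v z x) (fst q, ?l (snd q)))"
            by (rule continuous_on_compose2[OF continuous_on_branch])
              (use dom lin in \<open>auto intro!: continuous_intros l\<close>)
          then have "continuous_on ((X \<times> Y) \<times> {0..1}) (\<lambda>q. (fst q, (?l (snd q), branch (fst q) z (?l (snd q)))))"
            by (intro continuous_intros l) simp
          then have "continuous_on ((X \<times> Y) \<times> {0..1})
              (\<lambda>q. (\<lambda>q. h (fst q) (snd q)) (fst q, (?l (snd q), branch (fst q) z (?l (snd q)))))"
            by (rule continuous_on_compose2[OF laurent_continuous[OF that]])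
              (use branch_dom_Re(3)[OF dom] lin in auto)
          then show ?thesis
            unfolding k_def case_prod_beta' by (intro continuous_intros) simp
        qed
        have "has_differential (\<lambda>v. integral {0..1} (k f v)) (integral {0..1} (k A w), integral {0..1} (k B w)) w"
        proof (rule has_differential_integral[OF XY])
          fix a b \<tau> assume ab: "a \<in> X" "b \<in> Y" "\<tau> \<in> {0..1::real}"
          have dm: "((a, b), ?l \<tau>) \<in> branch_dom z" using ab lin by (intro dom) auto
          show "((\<lambda>a. k f (a, b) \<tau>) has_field_derivative k A (a, b) \<tau>) (at a)"
            unfolding k_def
            by (intro DERIV_cmult_right has_param_derivsD(1)[OF D, of "\<lambda>a. branch (a, b) z (?l \<tau>)"] branch_deriv_a dm branch_dom_Re(3)[OF dm])
          show "((\<lambda>b. k f (a, b) \<tau>) has_field_derivative k B (a, b) \<tau>) (at b)"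
            unfolding k_def
            by (intro DERIV_cmult_right has_param_derivsD(2)[OF D, of "\<lambda>b. branch (a, b) z (?l \<tau>)"] branch_deriv_b dm branch_dom_Re(3)[OF dm])
        qed (use cont f in auto)
        then have "has_differential (\<lambda>v. integral {0..1} (k f v)) (integral {s..t} (g A w), integral {s..t} (g B w)) w"
          using piece f XY(5) by simp
        then show "has_differential (\<lambda>v. integral {s..t} (g f v)) (integral {s..t} (g A w), integral {s..t} (g B w)) w"
          by (rule has_differential_transform[where N = "X \<times> Y"])
            (use piece[OF f(1)] XY in \<open>auto simp: open_Times\<close>)
      qed
    qed
  qed simp
  then show ?thesis
    unfolding Pr_def g_def P_def[abs_def] loop_integral_def by simp
qed

section \<open>Expansions\<close>

text \<open>\<open>A\<close> and \<open>B\<close> are the parameter derivatives of the integrand.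
  They depend on \<open>k\<close> only, which gives the differentials coefficients that are uniform
  in the parameter and the cycle.\<close>

lemma flat_section_qperiod:
  "\<exists>A B. laurent True A \<and> laurent True B \<and> (\<forall>N g u. flat_section N g \<longrightarrow> u \<in> N \<longrightarrow> discr u \<noteq> 0 \<longrightarrow>
     (\<exists>p. regular_loop u p \<and> loop_class u p = g u \<and>
        has_differential (\<lambda>v. qperiod k v (g v)) (loop_integral (A u) p, loop_integral (B u) p) u))"
proof -
  let ?f = "\<lambda>u. riccati_coeff u (2 * k)"
  have f: "laurent True ?f" using laurent_riccati_coeff[of "2 * k"] by simp
  obtain A B where AB: "laurent True A" "laurent True B" "has_param_derivs ?f A B"
    using laurent_param_deriv[OF f] by blast
  have "\<exists>p. regular_loop u p \<and> loop_class u p = g u \<and>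
        has_differential (\<lambda>v. qperiod k v (g v)) (loop_integral (A u) p, loop_integral (B u) p) u"
    if g: "flat_section N g" and u: "u \<in> N" and d: "discr u \<noteq> 0" for N g u
  proof -
    from g have "\<forall>w \<in> N. \<exists>M \<xi> \<eta>. open M \<and> w \<in> M \<and> M \<subseteq> N \<and>
        continuous_on (M \<times> {0..1}) (\<lambda>(v, t). \<eta> v t :: complex) \<and>
        (\<forall>v \<in> M. regular_loop v (\<lambda>t. (\<xi> t, \<eta> v t)) \<and> loop_class v (\<lambda>t. (\<xi> t, \<eta> v t)) = g v)"
      unfolding flat_section_def by (rule conjunct2)
    from bspec[OF this u] obtain M \<xi> \<eta> where M: "open M" "u \<in> M"
        "continuous_on (M \<times> {0..1}) (\<lambda>(v, t). \<eta> v t :: complex)"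
        and loops: "\<forall>v \<in> M. regular_loop v (\<lambda>t. (\<xi> t, \<eta> v t)) \<and> loop_class v (\<lambda>t. (\<xi> t, \<eta> v t)) = g v"
      by (elim exE conjE)
    note M = M conjunct1[OF bspec[OF loops]] conjunct2[OF bspec[OF loops]]
    have "has_differential (\<lambda>v. loop_integral (?f v) (\<lambda>t. (\<xi> t, \<eta> v t)))
      (loop_integral (A u) (\<lambda>t. (\<xi> t, \<eta> u t)), loop_integral (B u) (\<lambda>t. (\<xi> t, \<eta> u t))) u"
      by (rule loop_integral_has_differential[OF M(1,2) d M(3,4) f AB])
    then have "has_differential (\<lambda>v. qperiod k v (g v))
      (loop_integral (A u) (\<lambda>t. (\<xi> t, \<eta> u t)), loop_integral (B u) (\<lambda>t. (\<xi> t, \<eta> u t))) u"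
    proof (rule has_differential_transform)
      show "open (M \<inter> {v. discr v \<noteq> 0})" using M(1) open_discr_nonzero by blast
      show "u \<in> M \<inter> {v. discr v \<noteq> 0}" using M(2) d by simp
      fix v assume v: "v \<in> M \<inter> {v. discr v \<noteq> 0}"
      show "loop_integral (?f v) (\<lambda>t. (\<xi> t, \<eta> v t)) = qperiod k v (g v)"
        using period_laurent[OF f, of v "\<lambda>t. (\<xi> t, \<eta> v t)"] M(4,5)[of v] v by (simp add: qperiod_def)
    qed
    then show ?thesis using M(4)[OF M(2)] M(5)[OF M(2)] by (intro exI conjI)
  qed
  then show ?thesis using AB(1,2) by blast
qed

text \<open>The components of the differential are loop integrals of odd Laurent polynomials, so
  they depend on the class \<open>g u\<close> alone and not on the section through it. This
  justifies the definite description in \<open>dqperiod\<close>, and the section at hand shows that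
  it is not vacuous.\<close>

lemma dqperiod_formula:
  "\<exists>A B. laurent True A \<and> laurent True B \<and> (\<forall>N g u. flat_section N g \<longrightarrow> u \<in> N \<longrightarrow> discr u \<noteq> 0 \<longrightarrow>
     has_differential (\<lambda>v. qperiod k v (g v)) (dqperiod k u (g u)) u \<and>
     (\<exists>p. regular_loop u p \<and> loop_class u p = g u \<and>
        dqperiod k u (g u) = (loop_integral (A u) p, loop_integral (B u) p)))"
proof -
  obtain A B where AB: "laurent True A" "laurent True B"
    and flat: "\<And>N g u. flat_section N g \<Longrightarrow> u \<in> N \<Longrightarrow> discr u \<noteq> 0 \<Longrightarrow>
     \<exists>p. regular_loop u p \<and> loop_class u p = g u \<and>
        has_differential (\<lambda>v. qperiod k v (g v)) (loop_integral (A u) p, loop_integral (B u) p) u"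
    using flat_section_qperiod[of k] by blast
  have "has_differential (\<lambda>v. qperiod k v (g v)) (dqperiod k u (g u)) u \<and>
     (\<exists>p. regular_loop u p \<and> loop_class u p = g u \<and>
        dqperiod k u (g u) = (loop_integral (A u) p, loop_integral (B u) p))"
    if g: "flat_section N g" and u: "u \<in> N" and d: "discr u \<noteq> 0" for N g u
  proof -
    obtain p where p: "regular_loop u p" "loop_class u p = g u"
        "has_differential (\<lambda>v. qperiod k v (g v)) (loop_integral (A u) p, loop_integral (B u) p) u"
      using flat[OF g u d] by blast
    have "dqperiod k u (g u) = (loop_integral (A u) p, loop_integral (B u) p)"
      unfolding dqperiod_def
    proof (rule the_equality)
      show "\<forall>N' g'. flat_section N' g' \<and> u \<in> N' \<and> g' u = g u \<longrightarrow>
         has_differential (\<lambda>v. qperiod k v (g' v)) (loop_integral (A u) p, loop_integral (B u) p) u"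
      proof (intro allI impI)
        fix N' g' assume g': "flat_section N' g' \<and> u \<in> N' \<and> g' u = g u"
        then obtain q where q: "regular_loop u q" "loop_class u q = g' u"
            "has_differential (\<lambda>v. qperiod k v (g' v)) (loop_integral (A u) q, loop_integral (B u) q) u"
          using flat[of N' g' u] d by blast
        have "loop_class u q = loop_class u p" using q(2) p(2) g' by simp
        then have "loop_integral (A u) q = loop_integral (A u) p" "loop_integral (B u) q = loop_integral (B u) p"
          using loop_integral_laurent_invariant[OF AB(1) d q(1) p(1)]
            loop_integral_laurent_invariant[OF AB(2) d q(1) p(1)] by blast+
        then show "has_differential (\<lambda>v. qperiod k v (g' v)) (loop_integral (A u) p, loop_integral (B u) p) u"
          using q(3) by simp
      qed
      fix \<alpha> assume "\<forall>N' g'. flat_section N' g' \<and> u \<in> N' \<and> g' u = g u \<longrightarrow>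
         has_differential (\<lambda>v. qperiod k v (g' v)) \<alpha> u"
      then have "has_differential (\<lambda>v. qperiod k v (g v)) \<alpha> u" using g u by blast
      from has_differential_unique[OF this] has_differential_unique[OF p(3)]
      show "\<alpha> = (loop_integral (A u) p, loop_integral (B u) p)" by simp
    qed
    then show ?thesis using p by auto
  qed
  then show ?thesis using AB by blast
qed

lemma dqperiod_has_differential:
  assumes "flat_section N g" "u \<in> N" "discr u \<noteq> 0"
  shows "has_differential (\<lambda>v. qperiod k v (g v)) (dqperiod k u (g u)) u"
proof -
  obtain A B where dq0: "\<forall>N g u. flat_section N g \<longrightarrow> u \<in> N \<longrightarrow> discr u \<noteq> 0 \<longrightarrow>
     has_differential (\<lambda>v. qperiod k v (g v)) (dqperiod k u (g u)) u \<and>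
     (\<exists>p. regular_loop u p \<and> loop_class u p = g u \<and>
        dqperiod k u (g u) = (loop_integral (A u) p, loop_integral (B u) p))"
    using dqperiod_formula[of k] by (elim exE conjE)
  show ?thesis
    by (rule conjunct1[OF mp[OF mp[OF mp[OF spec[OF spec[OF spec[OF dq0]]]]], OF assms]])
qed

section \<open>Primitive, curvature and poles of the period form\<close>

lemma open_locally_constant_at: "open {u. locally_constant_at V u}"
proof (subst open_subopen, intro ballI)
  fix u assume "u \<in> {u. locally_constant_at V u}"
  then have "locally_constant_at V u" by simp
  then obtain N G where N: "open N" "u \<in> N" and G: "finite G" "\<forall>g \<in> G. flat_section N g"
     "\<forall>v \<in> N. inj_on (\<lambda>g. g v) G \<and> V v = (\<lambda>g. g v) ` G"
    unfolding locally_constant_at_def by (elim exE conjE)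
  have "locally_constant_at V v" if "v \<in> N" for v
    unfolding locally_constant_at_def by (intro exI[of _ N] exI[of _ G] conjI N(1) that G)
  then show "\<exists>T. open T \<and> u \<in> T \<and> T \<subseteq> {u. locally_constant_at V u}" using N by blast
qed

text \<open>Near \<open>u\<close> the sum over \<open>V\<close> is a sum over a fixed finite set of
  flat sections. Their values are distinct at each parameter, so no cycle is counted twice, and the
  sum is differentiated termwise.\<close>

lemma period_form_has_primitive:
  assumes lc: "locally_constant_at V u" and d: "discr u \<noteq> 0"
  shows "has_differential (\<lambda>v. (1/2) * (\<Sum>\<gamma> \<in> V v. qperiod k v \<gamma>)) (period_form V k u) u"
proof -
  from lc obtain N G where N: "open N" "u \<in> N" and G0: "finite G" "\<forall>g \<in> G. flat_section N g"
     "\<forall>v \<in> N. inj_on (\<lambda>g. g v) G \<and> V v = (\<lambda>g. g v) ` G"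
    unfolding locally_constant_at_def by (elim exE conjE)
  note G = G0(1) bspec[OF G0(2)] conjunct1[OF bspec[OF G0(3)]] conjunct2[OF bspec[OF G0(3)]]
  have "has_differential (\<lambda>v. \<Sum>g\<in>G. qperiod k v (g v)) (\<Sum>g\<in>G. dqperiod k u (g u)) u"
    by (intro has_differential_sum dqperiod_has_differential[OF G(2) N(2) d])
  from has_differential_scaleR[OF this, of "1/2"]
  have "has_differential (\<lambda>v. (1/2) *\<^sub>R (\<Sum>g\<in>G. qperiod k v (g v))) (period_form V k u) u"
    unfolding period_form_def G(4)[OF N(2)] by (simp add: sum.reindex[OF G(3)[OF N(2)]])
  then show ?thesis
  proof (rule has_differential_transform[OF _ N])
    fix v assume v: "v \<in> N"
    show "(1/2) *\<^sub>R (\<Sum>g\<in>G. qperiod k v (g v)) = (1/2) * (\<Sum>\<gamma> \<in> V v. qperiod k v \<gamma>)"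
      unfolding G(4)[OF v] by (simp add: sum.reindex[OF G(3)[OF v]] scaleR_conv_of_real)
  qed
qed

lemma period_form_has_curvature_zero:
  assumes "locally_constant_at V u" "discr u \<noteq> 0"
  shows "has_curvature (period_form V k) 0 u"
proof (rule has_curvature_zero)
  show "open ({u. locally_constant_at V u} \<inter> {u. discr u \<noteq> 0})"
    using open_locally_constant_at open_discr_nonzero by blast
qed (use assms period_form_has_primitive in auto)

lemma period_form_poles_on_discriminant: "poles_on_discriminant V (period_form V k)"
proof -
  let ?D = "[:[:0, 0, 0, 4:], 0, [:27:]:] :: complex poly poly"
  let ?h = "[:[:1/2:]:] :: complex poly poly"
  from dqperiod_formula[of k] obtain A B where AB: "laurent True A" "laurent True B"
    and dq0: "\<forall>N g u. flat_section N g \<longrightarrow> u \<in> N \<longrightarrow> discr u \<noteq> 0 \<longrightarrow>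
     has_differential (\<lambda>v. qperiod k v (g v)) (dqperiod k u (g u)) u \<and>
     (\<exists>p. regular_loop u p \<and> loop_class u p = g u \<and>
        dqperiod k u (g u) = (loop_integral (A u) p, loop_integral (B u) p))"
    by (elim exE conjE)
  note dq = conjunct2[OF mp[OF mp[OF mp[OF spec[OF spec[OF spec[OF dq0]]]]]]]
  obtain m p q where A: "\<And>u \<gamma>. discr u \<noteq> 0 \<Longrightarrow> regular_loop u \<gamma> \<Longrightarrow>
    period u (A u) (loop_class u \<gamma>) = elliptic_comb p q u (loop_class u \<gamma>) / discr u ^ m"
    using period_reduction[OF AB(1)] by blast
  obtain m' p' q' where B: "\<And>u \<gamma>. discr u \<noteq> 0 \<Longrightarrow> regular_loop u \<gamma> \<Longrightarrow>
    period u (B u) (loop_class u \<gamma>) = elliptic_comb p' q' u (loop_class u \<gamma>) / discr u ^ m'"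
    using period_reduction[OF AB(2)] by blast
  \<comment> \<open>Numerator and denominator are expanded by a power of the discriminant to give
    both components the same exponent; the factor 1/2 is absorbed into the polynomials.\<close>
  have comb: "elliptic_comb (?h * ?D ^ n * P) (?h * ?D ^ n * Q) u \<gamma> / discr u ^ (l + n)
      = (1/2) * (elliptic_comb P Q u \<gamma> / discr u ^ l)"
    if "discr u \<noteq> 0" for n l P Q u \<gamma>
  proof -
    have "elliptic_comb (?h * ?D ^ n * P) (?h * ?D ^ n * Q) u \<gamma> = (1/2) * discr u ^ n * elliptic_comb P Q u \<gamma>"
      unfolding elliptic_comb_def poly2_simps poly2_generators by (simp add: algebra_simps)
    moreover have "(1/2) * d ^ n * X / d ^ (l + n) = (1/2) * (X / d ^ l)" if "d \<noteq> 0" for d X :: complex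
      using that by (simp add: power_add)
    ultimately show ?thesis using that by (simp only:)
  qed
  have "period_form V k u = (\<Sum>\<gamma> \<in> V u.
      (elliptic_comb (?h * ?D ^ m' * p) (?h * ?D ^ m' * q) u \<gamma> / discr u ^ (m + m'),
       elliptic_comb (?h * ?D ^ m * p') (?h * ?D ^ m * q') u \<gamma> / discr u ^ (m + m')))"
    if d: "discr u \<noteq> 0" and w: "u \<notin> walls V" for u
  proof -
    have "locally_constant_at V u" using d w by (simp add: walls_def)
    then obtain N G where "open N" and N: "u \<in> N" and G0: "finite G" "\<forall>g \<in> G. flat_section N g"
     "\<forall>v \<in> N. inj_on (\<lambda>g. g v) G \<and> V v = (\<lambda>g. g v) ` G"
    unfolding locally_constant_at_def by (elim exE conjE)
    note G = bspec[OF G0(2)] conjunct2[OF bspec[OF G0(3)]]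
    have "(1/2) *\<^sub>R dqperiod k u \<gamma> =
      (elliptic_comb (?h * ?D ^ m' * p) (?h * ?D ^ m' * q) u \<gamma> / discr u ^ (m + m'),
       elliptic_comb (?h * ?D ^ m * p') (?h * ?D ^ m * q') u \<gamma> / discr u ^ (m + m'))" if "\<gamma> \<in> V u" for \<gamma>
    proof -
      have "\<gamma> \<in> (\<lambda>g. g u) ` G" using that unfolding G(2)[OF N] .
      then obtain g where g: "\<gamma> = g u" "g \<in> G" by (elim imageE)
      from dq[OF G(1)[OF g(2)] N d] obtain c where c0: "regular_loop u c" "loop_class u c = g u"
          "dqperiod k u (g u) = (loop_integral (A u) c, loop_integral (B u) c)"
        by (elim exE conjE)
      note c = c0[folded g(1)]
      have "dqperiod k u \<gamma> = (elliptic_comb p q u \<gamma> / discr u ^ m, elliptic_comb p' q' u \<gamma> / discr u ^ m')"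
        using c(3) A[OF d c(1)] B[OF d c(1)] period_laurent[OF AB(1) d c(1)] period_laurent[OF AB(2) d c(1)]
        by (simp add: c(2))
      then show ?thesis
        using comb[OF d, of m' p q \<gamma> m] comb[OF d, of m p' q' \<gamma> m']
        by (simp add: add.commute scaleR_conv_of_real)
    qed
    then show ?thesis
      unfolding period_form_def scaleR_sum_right by (rule sum.cong[OF refl])
  qed
  then show ?thesis unfolding poles_on_discriminant_def by blast
qed

section \<open>The expansion of the logarithm and of its differential\<close>

lemma has_differential_chain:
  assumes F: "has_differential F \<alpha> u" and g: "(g has_field_derivative g') (at (F u))"
  shows "has_differential (\<lambda>v. g (F v)) (g' * fst \<alpha>, g' * snd \<alpha>) u"
  using has_derivative_compose[OF F[unfolded has_differential_def] g[unfolded has_field_derivative_def]]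
  by (simp add: has_differential_def algebra_simps)

text \<open>A continuous branch of the logarithm differs from the principal branch by a constant nearby.\<close>

lemma log_branch_has_differential:
  assumes N: "open N" "u \<in> N" and L: "continuous_on N L" "\<And>v. v \<in> N \<Longrightarrow> exp (L v) = D v"
    and D: "has_differential D \<alpha> u"
  shows "has_differential L (fst \<alpha> / D u, snd \<alpha> / D u) u"
proof -
  have D0: "D u \<noteq> 0" using L(2)[OF N(2)] by (metis exp_not_eq_zero)
  obtain d where d: "d > 0" "\<And>v. v \<in> N \<Longrightarrow> dist v u < d \<Longrightarrow> dist (L v) (L u) < pi"
    using L(1) N(2) pi_gt_zero unfolding continuous_on_iff by blast
  have scaled: "has_differential (\<lambda>v. D v / D u) (fst \<alpha> / D u, snd \<alpha> / D u) u"
    using has_differential_chain[OF D DERIV_cdivide[OF DERIV_ident], of "D u"] by simp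
  have "(Ln has_field_derivative 1) (at ((\<lambda>v. D v / D u) u))"
    using has_field_derivative_Ln[of 1] D0 by simp
  from has_differential_chain[OF scaled this]
  have "has_differential (\<lambda>v. Ln (D v / D u)) (fst \<alpha> / D u, snd \<alpha> / D u) u" by simp
  then have "has_differential (\<lambda>v. Ln (D v / D u) + L u) ((fst \<alpha> / D u, snd \<alpha> / D u) + (0, 0)) u"
    by (rule has_differential_add) (simp add: has_differential_def)
  then have "has_differential (\<lambda>v. Ln (D v / D u) + L u) (fst \<alpha> / D u, snd \<alpha> / D u) u" by simp
  then show ?thesis
  proof (rule has_differential_transform)
    show "open (N \<inter> ball u d)" "u \<in> N \<inter> ball u d" using N d by auto
    fix v assume v: "v \<in> N \<inter> ball u d"
    have "D v / D u = exp (L v - L u)" using v N L(2) by (simp add: exp_diff)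
    moreover have "\<bar>Im (L v - L u)\<bar> < pi"
      using d(2)[of v] v abs_Im_le_cmod[of "L v - L u"] by (simp add: dist_norm norm_minus_commute)
    ultimately show "Ln (D v / D u) + L u = L v"
      by (simp add: Ln_exp)
  qed
qed

lemma dlog_det_eq:
  "has_differential (spectral_det h) \<alpha> u \<Longrightarrow>
    dlog_det h u = (fst \<alpha> / spectral_det h u, snd \<alpha> / spectral_det h u)"
  unfolding dlog_det_def using has_differential_partials[of "spectral_det h" \<alpha> u]
  by (simp add: DERIV_imp_deriv)

definition differential :: "(param \<Rightarrow> complex) \<Rightarrow> one_form" where
  "differential F u = (partial1 F u, partial2 F u)"

context
  fixes V :: "param \<Rightarrow> hclass set" and U :: "param set" and c :: "param \<Rightarrow> complex"
  assumes entire: "\<forall>h > 0. \<forall>u. \<exists>\<alpha>. has_differential (spectral_det h) \<alpha> u"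
    and region: "region V U" and expansion: "log_det_expansion V c U"
begin

text \<open>Here the holomorphy of the determinant enters: it makes every continuous branch of the
  logarithm a primitive of \<open>dlog_det h\<close>.\<close>

lemma log_det_branch:
  assumes u: "u \<in> U"
  shows "\<exists>N L \<delta>. \<delta> > 0 \<and> open N \<and> u \<in> N \<and> N \<subseteq> U \<and>
    (\<forall>h v. 0 < h \<longrightarrow> h < \<delta> \<longrightarrow> v \<in> N \<longrightarrow> has_differential (L h) (dlog_det h v) v) \<and>
    expands_on N L (log_coeff V c)"
proof -
  from bspec[OF expansion[unfolded log_det_expansion_def] u]
  obtain N L \<delta> where N: "\<delta> > 0" "open N" "u \<in> N" "N \<subseteq> U"
    and L: "\<forall>h. 0 < h \<and> h < \<delta> \<longrightarrow> continuous_on N (L h) \<and> (\<forall>v \<in> N. exp (L h v) = spectral_det h v)"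
    and ex: "expands_on N L (log_coeff V c)"
    by (elim exE conjE)
  have "has_differential (L h) (dlog_det h v) v" if h: "0 < h" "h < \<delta>" and v: "v \<in> N" for h v
  proof -
    obtain \<alpha> where \<alpha>: "has_differential (spectral_det h) \<alpha> v" using entire h by blast
    show ?thesis
      using log_branch_has_differential[OF N(2) v _ _ \<alpha>, of "L h"] L h dlog_det_eq[OF \<alpha>] by simp
  qed
  then show ?thesis using N ex by (intro exI[of _ N] exI[of _ L] exI[of _ \<delta>]) simp
qed

lemma log_coeff_even_has_differential:
  assumes "u \<in> U" "even n"
  shows "has_differential (log_coeff V c n) (period_form V (n div 2) u) u"
proof -
  have "log_coeff V c n = (\<lambda>v. (1/2) * (\<Sum>\<gamma> \<in> V v. qperiod (n div 2) v \<gamma>))"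
    using assms(2) by (auto simp: log_coeff_def fun_eq_iff)
  then show ?thesis
    using period_form_has_primitive[of V u "n div 2"] region assms(1) by (auto simp: region_def)
qed

text \<open>The expansion up to order 1 says that the branch minus its leading term differs from
  \<open>c\<close> by at most a constant times h, uniformly on \<open>N\<close>. So \<open>c\<close>
  is a uniform limit of holomorphic functions, taken along h = 1/(n+1).\<close>

lemma constant_term_has_differential:
  assumes u: "u \<in> U"
  shows "has_differential c (differential c u) u"
proof -
  from log_det_branch[OF u] obtain N L \<delta> where N: "\<delta> > 0" "open N" "u \<in> N" "N \<subseteq> U"
    and L0: "\<forall>h v. 0 < h \<longrightarrow> h < \<delta> \<longrightarrow> v \<in> N \<longrightarrow> has_differential (L h) (dlog_det h v) v"
    and ex: "expands_on N L (log_coeff V c)"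
    by (elim exE conjE)
  note L = mp[OF mp[OF mp[OF spec[OF spec[OF L0]]]]]
  from spec[OF ex[unfolded expands_on_def], of 1] obtain C \<delta>' where C1: "\<delta>' > 0"
    and C2: "\<forall>h v. 0 < h \<and> h < \<delta>' \<and> v \<in> N \<longrightarrow>
      norm (L h v - (\<Sum>j\<le>1. (h powi (int j - 1)) *\<^sub>R log_coeff V c j v)) \<le> C * h ^ 1"
    by (elim exE conjE)
  note C = C1 mp[OF spec[OF spec[OF C2]], OF conjI, OF _ conjI]
  define h where "h n = inverse (real (Suc n))" for n
  define F where "F n v = L (h n) v - inverse (h n) *\<^sub>R log_coeff V c 0 v" for n v
  have h0: "h n > 0" for n by (simp add: h_def)
  have hlim: "h \<longlonglongrightarrow> 0" unfolding h_def by (rule LIMSEQ_inverse_real_of_nat)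
  have ev: "eventually (\<lambda>n. h n < \<delta>) sequentially" "eventually (\<lambda>n. h n < \<delta>') sequentially"
    using order_tendstoD(2)[OF hlim] N(1) C(1) by auto
  have "holomorphic2 c N"
  proof (rule holomorphic2_uniform_limit[OF _ N(2)])
    show "eventually (\<lambda>n. holomorphic2 (F n) N) sequentially"
      using ev(1)
    proof (rule eventually_mono)
      fix n assume hn: "h n < \<delta>"
      show "holomorphic2 (F n) N"
      proof (rule has_differential_imp_holomorphic2[OF N(2)])
        fix v assume v: "v \<in> N"
        show "has_differential (F n) (dlog_det (h n) v - inverse (h n) *\<^sub>R period_form V (0 div 2) v) v"
          unfolding F_def using v N(4)
          by (intro has_differential_diff has_differential_scaleR L[OF h0 hn v] log_coeff_even_has_differential) auto
      qed
    qed
    show "uniform_limit N F c sequentially"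
    proof (rule uniform_limitI)
      fix e :: real assume e: "e > 0"
      have "(\<lambda>n. C * h n) \<longlonglongrightarrow> C * 0" by (intro tendsto_intros hlim)
      then have "eventually (\<lambda>n. C * h n < e) sequentially" using e by (simp add: order_tendstoD)
      then show "eventually (\<lambda>n. \<forall>v\<in>N. dist (F n v) (c v) < e) sequentially"
        using ev(2)
      proof eventually_elim
        case (elim n)
        have "dist (F n v) (c v) \<le> C * h n" if "v \<in> N" for v
          using C(2)[OF h0 elim(2) that]
          by (simp add: dist_norm F_def log_coeff_def power_int_minus algebra_simps)
        then show ?case using elim(1) by (meson le_less_trans)
      qed
    qed
  qed
  from holomorphic2_imp_has_differential[OF this N(3)] show ?thesis by (simp add: differential_def)
qed

lemma log_coeff_has_differential:
  assumes u: "u \<in> U"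
  shows "has_differential (log_coeff V c n) (form_coeff V (differential c) n u) u"
proof -
  consider "n = 1" | "n \<noteq> 1" "even n" | "n \<noteq> 1" "odd n" by blast
  then show ?thesis
  proof cases
    case 1
    then have "log_coeff V c n = c" by (auto simp: log_coeff_def)
    then show ?thesis
      using constant_term_has_differential[OF u] 1 by (simp add: form_coeff_def)
  next
    case 2
    then show ?thesis using log_coeff_even_has_differential[OF u] by (simp add: form_coeff_def)
  next
    case 3
    then have "log_coeff V c n = (\<lambda>v. 0)" by (auto simp: log_coeff_def)
    then show ?thesis using 3 by (simp add: form_coeff_def has_differential_def)
  qed
qed

text \<open>The remainder of order n is holomorphic in the parameters for fixed h. Cauchy's
  estimates bound its derivatives by the same power of h on a smaller polydisc.\<close>

lemma dlog_det_has_expansion: "dlog_det_expansion V (differential c) U"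
  unfolding dlog_det_expansion_def
proof
  fix u assume u: "u \<in> U"
  from log_det_branch[OF u] obtain N L \<delta> where N: "\<delta> > 0" "open N" "u \<in> N" "N \<subseteq> U"
    and L0: "\<forall>h v. 0 < h \<longrightarrow> h < \<delta> \<longrightarrow> v \<in> N \<longrightarrow> has_differential (L h) (dlog_det h v) v"
    and ex: "expands_on N L (log_coeff V c)"
    by (elim exE conjE)
  note L = mp[OF mp[OF mp[OF spec[OF spec[OF L0]]]]]
  obtain r' where r': "r' > 0" "cball (fst u) r' \<times> cball (snd u) r' \<subseteq> N"
    using open_imp_polydisc N by metis
  \<comment> \<open>Half the radius: the closed polydisc of radius \<open>r\<close> about any point
    of \<open>M\<close> lies in \<open>N\<close>, so one radius serves all points. Each component of
    the form then costs a factor 1 / r, whence the constant 2 C / r.\<close>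
  define r where "r = r' / 2"
  define M where "M = ball (fst u) r \<times> ball (snd u) r"
  have r: "r > 0" using r' by (simp add: r_def)
  have ball: "cball x r \<subseteq> cball y r'" if "x \<in> ball y r" for x y :: complex
  proof
    fix w assume "w \<in> cball x r"
    then show "w \<in> cball y r'" using that dist_triangle[of y w x] by (simp add: r_def)
  qed
  have sub: "cball (fst v) r \<times> cball (snd v) r \<subseteq> N" if "v \<in> M" for v
    using ball[of "fst v" "fst u"] ball[of "snd v" "snd u"] that r'(2) unfolding M_def by fastforce
  have MN: "M \<subseteq> N"
  proof
    fix v assume "v \<in> M"
    then show "v \<in> N" by (rule subsetD[OF sub]) (use r in \<open>simp add: mem_Times_iff\<close>)
  qed
  have "expands_on M dlog_det (form_coeff V (differential c))"
    unfolding expands_on_def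
  proof
    fix n
    from spec[OF ex[unfolded expands_on_def], of n] obtain C \<delta>' where C1: "\<delta>' > 0"
      and C2: "\<forall>h v. 0 < h \<and> h < \<delta>' \<and> v \<in> N \<longrightarrow>
        norm (L h v - (\<Sum>j\<le>n. (h powi (int j - 1)) *\<^sub>R log_coeff V c j v)) \<le> C * h ^ n"
      by (elim exE conjE)
    note C = C1 mp[OF spec[OF spec[OF C2]], OF conjI, OF _ conjI]
    have "norm (dlog_det h v - (\<Sum>j\<le>n. (h powi (int j - 1)) *\<^sub>R form_coeff V (differential c) j v))
        \<le> (2 * C / r) * h ^ n" if h: "0 < h" "h < min \<delta> \<delta>'" and v: "v \<in> M" for h v
    proof -
      define R where "R v = L h v - (\<Sum>j\<le>n. (h powi (int j - 1)) *\<^sub>R log_coeff V c j v)" for v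
      define \<theta> where "\<theta> v = dlog_det h v - (\<Sum>j\<le>n. (h powi (int j - 1)) *\<^sub>R form_coeff V (differential c) j v)" for v
      have dR: "has_differential R (\<theta> v) v" if "v \<in> N" for v
        unfolding R_def \<theta>_def using that N(4) h
        by (intro has_differential_diff has_differential_sum has_differential_scaleR L log_coeff_has_differential) auto
      then have hol: "holomorphic2 R N" by (rule has_differential_imp_holomorphic2[OF N(2)])
      have bd: "cmod (R v) \<le> C * h ^ n" if "v \<in> N" for v
        using C(2)[of h v] that h by (simp add: R_def)
      have "\<theta> v = (partial1 R v, partial2 R v)"
        using has_differential_unique[OF dR] MN v by blast
      then have "norm (\<theta> v) \<le> cmod (partial1 R v) + cmod (partial2 R v)"
        by (simp add: norm_Pair_le)
      also have "\<dots> \<le> C * h ^ n / r + C * h ^ n / r"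
        by (intro add_mono partial1_bound[OF hol r sub[OF v] bd] partial2_bound[OF hol r sub[OF v] bd])
      finally show ?thesis by (simp add: \<theta>_def)
    qed
    then show "\<exists>C. \<exists>\<delta>>0. \<forall>h v. 0 < h \<and> h < \<delta> \<and> v \<in> M \<longrightarrow>
       norm (dlog_det h v - (\<Sum>j\<le>n. (h powi (int j - 1)) *\<^sub>R form_coeff V (differential c) j v)) \<le> C * h ^ n"
      using N(1) C(1) by (intro exI[of _ "2 * C / r"] exI[of _ "min \<delta> \<delta>'"]) auto
  qed
  moreover have "open M" "u \<in> M" "M \<subseteq> U" using r MN N(4) by (auto simp: M_def open_Times mem_Times_iff)
  ultimately show "\<exists>N. open N \<and> u \<in> N \<and> N \<subseteq> U \<and> expands_on N dlog_det (form_coeff V (differential c))" by blast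
qed

lemma form_coeff_has_curvature_zero:
  assumes "u \<in> U"
  shows "has_curvature (form_coeff V (differential c) n) 0 u"
  using has_curvature_zero[of U u "log_coeff V c n"] region assms log_coeff_has_differential
  by (auto simp: region_def)

text \<open>For each small h the branch \<open>L h\<close> is itself a primitive, so the curvature
  of the determinant line is exactly zero and not merely small.\<close>

lemma dlog_det_has_curvature_zero:
  assumes u: "u \<in> U"
  shows "\<exists>\<delta>>0. \<forall>h. 0 < h \<and> h < \<delta> \<longrightarrow> has_curvature (dlog_det h) 0 u"
proof -
  from log_det_branch[OF u] obtain N L \<delta> where N: "\<delta> > 0" "open N" "u \<in> N" "N \<subseteq> U"
    and L0: "\<forall>h v. 0 < h \<longrightarrow> h < \<delta> \<longrightarrow> v \<in> N \<longrightarrow> has_differential (L h) (dlog_det h v) v"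
    and ex: "expands_on N L (log_coeff V c)"
    by (elim exE conjE)
  note L = mp[OF mp[OF mp[OF spec[OF spec[OF L0]]]]]
  have "has_curvature (dlog_det h) 0 u" if "0 < h" "h < \<delta>" for h
    by (rule has_curvature_zero[OF N(2,3) L[OF that]])
  then show ?thesis using N(1) by blast
qed

end

theorem corollary8p3:
  fixes V :: "param \<Rightarrow> hclass set"
  assumes V: "boundary_cycles V"
    and entire: "\<forall>h > 0. \<forall>u. \<exists>\<alpha>. has_differential (spectral_det h) \<alpha> u"
  shows
    "(\<forall>U. region V U \<longrightarrow>
        (\<forall>k. exact_on U (period_form V k)) \<and>
        (\<forall>c. log_det_expansion V c U \<longrightarrow>
           (\<exists>\<kappa>. (\<forall>u \<in> U. has_differential c (\<kappa> u) u) \<and> dlog_det_expansion V \<kappa> U \<and>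
              (\<forall>n. exact_on U (form_coeff V \<kappa> n)))))
     \<and>
     (\<forall>u. discr u \<noteq> 0 \<and> u \<notin> walls V \<longrightarrow>
        (\<forall>k. has_curvature (period_form V k) 0 u) \<and>
        (\<forall>U c. region V U \<and> u \<in> U \<and> log_det_expansion V c U \<longrightarrow>
           (\<exists>\<kappa>. dlog_det_expansion V \<kappa> U \<and> (\<forall>n. has_curvature (form_coeff V \<kappa> n) 0 u)) \<and>
           (\<forall>n. \<exists>C. \<exists>\<delta> > 0. \<forall>h. 0 < h \<and> h < \<delta> \<longrightarrow>
              (\<exists>K. has_curvature (dlog_det h) K u \<and> cmod K \<le> C * h ^ n))))
     \<and>
     (\<forall>U. region V U \<longrightarrow>
        (\<forall>u \<in> U. \<forall>h > 0. has_curvature (\<lambda>v. (1/h) *\<^sub>R period_form V 0 v) 0 u) \<and>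
        (\<forall>k \<ge> 1. exact_on U (period_form V k)))
     \<and>
     (\<forall>k \<ge> 1. poles_on_discriminant V (period_form V k))"
proof (intro conjI allI impI ballI)
  fix U k assume "region V U"
  then show "exact_on U (period_form V k)"
    unfolding exact_on_def region_def using period_form_has_primitive by blast
next
  fix U c assume reg: "region V U" and ex: "log_det_expansion V c U"
  have "\<forall>u \<in> U. has_differential c (differential c u) u"
    using constant_term_has_differential[OF entire reg ex] by blast
  moreover have "exact_on U (form_coeff V (differential c) n)" for n
    unfolding exact_on_def using log_coeff_has_differential[OF entire reg ex] by blast
  ultimately show "\<exists>\<kappa>. (\<forall>u \<in> U. has_differential c (\<kappa> u) u) \<and> dlog_det_expansion V \<kappa> U \<and>
      (\<forall>n. exact_on U (form_coeff V \<kappa> n))"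
    using dlog_det_has_expansion[OF entire reg ex] by blast
next
  fix u k assume "discr u \<noteq> 0 \<and> u \<notin> walls V"
  then show "has_curvature (period_form V k) 0 u"
    by (intro period_form_has_curvature_zero) (auto simp: walls_def)
next
  fix u U c assume "region V U \<and> u \<in> U \<and> log_det_expansion V c U"
  then have reg: "region V U" and u: "u \<in> U" and ex: "log_det_expansion V c U" by auto
  show "\<exists>\<kappa>. dlog_det_expansion V \<kappa> U \<and> (\<forall>n. has_curvature (form_coeff V \<kappa> n) 0 u)"
    using dlog_det_has_expansion[OF entire reg ex] form_coeff_has_curvature_zero[OF entire reg ex u] by blast
  fix n
  obtain \<delta> where \<delta>: "\<delta> > 0" "\<And>h. 0 < h \<Longrightarrow> h < \<delta> \<Longrightarrow> has_curvature (dlog_det h) 0 u"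
    using dlog_det_has_curvature_zero[OF entire reg ex u] by blast
  \<comment> \<open>Since the curvature vanishes for small h, the constant 0 serves for every order
    n.\<close>
  have "\<forall>h. 0 < h \<and> h < \<delta> \<longrightarrow> (\<exists>K. has_curvature (dlog_det h) K u \<and> cmod K \<le> 0 * h ^ n)"
    using \<delta>(2) by (auto intro!: exI[of _ 0])
  then show "\<exists>C. \<exists>\<delta> > 0. \<forall>h. 0 < h \<and> h < \<delta> \<longrightarrow>
      (\<exists>K. has_curvature (dlog_det h) K u \<and> cmod K \<le> C * h ^ n)"
    using \<delta>(1) by blast
next
  fix U u and h :: real assume reg: "region V U" and u: "u \<in> U"
  show "has_curvature (\<lambda>v. (1/h) *\<^sub>R period_form V 0 v) 0 u"
  proof (rule has_curvature_zero)
    show "open U" using reg by (simp add: region_def)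
    fix v assume "v \<in> U"
    then have "has_differential (\<lambda>v. (1/2) * (\<Sum>\<gamma> \<in> V v. qperiod 0 v \<gamma>)) (period_form V 0 v) v"
      using reg period_form_has_primitive unfolding region_def by blast
    then show "has_differential (\<lambda>v. (1/h) *\<^sub>R ((1/2) * (\<Sum>\<gamma> \<in> V v. qperiod 0 v \<gamma>))) ((1/h) *\<^sub>R period_form V 0 v) v"
      by (rule has_differential_scaleR)
  qed (rule u)
next
  fix U and k :: nat assume "region V U"
  then show "exact_on U (period_form V k)"
    unfolding exact_on_def region_def using period_form_has_primitive by blast
next
  fix k :: nat
  show "poles_on_discriminant V (period_form V k)" by (rule period_form_poles_on_discriminant)
qed

end
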